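(* Let $k,m,n$ be positive integers with $m<n$, let $\mathbf{A}=[\mathbf{A}_1^T~\cdots~\mathbf{A}_k^T]^T\in\mathbb{R}^{km\times n}$ (blocks $\mathbf{A}_i\in\mathbb{R}^{m\times n}$) have entries drawn independently from $\mathcal{N}(0,1)$, and let $\mathbf{b}=[\mathbf{b}_1^T~\cdots~\mathbf{b}_k^T]^T\in\mathbb{R}^{km}$. Let $\mathbf{x}_0$ be a vector maximizing, over $\mathbf{x}\in\mathbb{R}^n$, the number of indices $i$ with $\mathbf{b}_i=\mathbf{A}_i\mathbf{x}$, satisfying exactly $s>k/2$ of the $k$ subsystems. Let $\beta:=s/k$, $\gamma:=n/(km)$, and $c_0(\beta,\gamma):=\frac12\left(\frac{2\beta-1}{\sqrt{\gamma}}-1\right)^2$, and let $\alpha\in(0,1)$. If $\beta>\frac{\sqrt{\gamma}+1}{2}$, then whenever $m\ge\frac{\beta\log(e/\beta)}{(1-\alpha)c_0(\beta,\gamma)\gamma}$, the vector $\mathbf{x}_0$ is the unique minimizer of $\min_{\mathbf{x}\in\mathbb{R}^n}\sum_{i=1}^k\|\mathbf{b}_i-\mathbf{A}_i\mathbf{x}\|_2$ with probability exceeding $1-e^{-\alpha c_0(\beta,\gamma)n+o_n(n)}$.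
   Context: The asymptotic notation $o_n(n)$ refers to the regime where $k$, $\beta$ and $\gamma$ are held fixed and $n\to\infty$ (so $m=n/(\gamma k)$ grows with $n$); $o_n(n)$ denotes a term $g(n)$ with $g(n)/n\to0$. *)

theory Defs
  imports "HOL-Probability.Probability"
begin

definition std_gauss :: "real measure" where
  "std_gauss = density lborel (\<lambda>x. ennreal (std_normal_density x))"

text \<open>Random matrix A in R^{km x n}, stacked from k blocks A_i in R^{m x n};
  entry (row r of block i, column j) is A (i, r, j). Entries i.i.d. N(0,1).\<close>
definition gauss_blocks :: "nat \<Rightarrow> nat \<Rightarrow> nat \<Rightarrow> (nat \<times> nat \<times> nat \<Rightarrow> real) measure" where
  "gauss_blocks k m n = PiM ({..<k} \<times> {..<m} \<times> {..<n}) (\<lambda>_. std_gauss)"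

definition vecs :: "nat \<Rightarrow> (nat \<Rightarrow> real) set" where
  "vecs n = {x. \<forall>j\<ge>n. x j = 0}"

definition blk_mul :: "nat \<Rightarrow> (nat \<times> nat \<times> nat \<Rightarrow> real) \<Rightarrow> nat \<Rightarrow> (nat \<Rightarrow> real) \<Rightarrow> nat \<Rightarrow> real" where
  "blk_mul n A i x r = (\<Sum>j<n. A (i, r, j) * x j)"

definition num_sat :: "nat \<Rightarrow> nat \<Rightarrow> nat \<Rightarrow> (nat \<times> nat \<times> nat \<Rightarrow> real) \<Rightarrow> (nat \<Rightarrow> nat \<Rightarrow> real) \<Rightarrow> (nat \<Rightarrow> real) \<Rightarrow> nat" where
  "num_sat k m n A b x = card {i. i < k \<and> (\<forall>r<m. b i r = blk_mul n A i x r)}"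

definition obj :: "nat \<Rightarrow> nat \<Rightarrow> nat \<Rightarrow> (nat \<times> nat \<times> nat \<Rightarrow> real) \<Rightarrow> (nat \<Rightarrow> nat \<Rightarrow> real) \<Rightarrow> (nat \<Rightarrow> real) \<Rightarrow> real" where
  "obj k m n A b x = (\<Sum>i<k. sqrt (\<Sum>r<m. (b i r - blk_mul n A i x r)\<^sup>2))"

definition recovery_event :: "nat \<Rightarrow> nat \<Rightarrow> nat \<Rightarrow> nat \<Rightarrow> (nat \<times> nat \<times> nat \<Rightarrow> real) \<Rightarrow> bool" where
  "recovery_event k m n s A \<longleftrightarrow>
     (\<forall>b x0. x0 \<in> vecs n \<and> (\<forall>x\<in>vecs n. num_sat k m n A b x \<le> num_sat k m n A b x0)
        \<and> num_sat k m n A b x0 = s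
        \<longrightarrow> (\<forall>x\<in>vecs n. x \<noteq> x0 \<longrightarrow> obj k m n A b x0 < obj k m n A b x))"

definition c0 :: "real \<Rightarrow> real \<Rightarrow> real" where
  "c0 \<beta> \<gamma> = (1/2) * ((2*\<beta> - 1) / sqrt \<gamma> - 1)\<^sup>2"

end

theory Submission
  imports Defs
begin

text \<open>
  Failure at \<open>(b, x0)\<close> forces a direction \<open>h\<close> on the unit sphere with
  \<open>\<Sum>i\<in>S. |A\<^sub>i h| \<le> \<Sum>i\<notin>S. |A\<^sub>i h|\<close>, where \<open>S\<close> is the set of satisfied blocks. The minimum over \<open>h\<close> of
  the difference \<open>F\<^sub>S (A h)\<close> of the two sides is bounded below by Gordon's comparison method in
  exponential-moment form. With independent standard Gaussians \<open>\<zeta>\<close> (block vector), \<open>g\<close> (in \<open>n\<close>-space)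
  and \<open>g0\<close> (scalar), the processes \<open>F\<^sub>S (A h) + \<surd>k g0\<close> and \<open>F\<^sub>S \<zeta> + \<surd>k \<langle>g, h\<rangle>\<close> are joined by a rotation,
  and \<open>E (\<Sum>h. exp (- p X\<^sub>h)) powr (l / p)\<close> is monotone along it, since \<open>F\<^sub>S\<close> is \<open>\<surd>k\<close>-Lipschitz. Letting
  \<open>p\<close> tend to infinity,
  \<open>E exp (- l min F\<^sub>S (A h)) \<le> exp (- l\<^sup>2 k / 2) E exp (- l F\<^sub>S \<zeta>) E exp (l \<surd>k |g|)\<close>. The moments of
  Gaussian norms and the choice \<open>l = \<delta> \<surd>(n / k)\<close> with \<open>c\<^sub>0 = \<delta>\<^sup>2 / 2\<close> give the exponent \<open>- c\<^sub>0 n\<close> up to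
  \<open>O(\<surd>n)\<close>; the fixed number of sets \<open>S\<close> costs a constant factor.

  The Gaussian product measure is not complete, so measurability of the recovery event needs its own
  argument: its complement is a countable union of projections of closed sets along compact boxes.
\<close>

text \<open>The comparison is run on the exponential moment itself, not on the expected minimum: no
  separate concentration inequality enters, and optimizing over \<open>l\<close> gives the rate
  \<open>c0\<close> at once. The exponent \<open>a = l / p\<close> lies in (0, 1), and the negative
  factor \<open>a * (a - 1)\<close> in the mixed second derivatives fixes the direction of the
  inequality. The number of vectors enters only through \<open>card H powr a\<close>, which tends to
  1; the bound is therefore the same for every finite subset of the sphere and passes to a countable
  dense subset without any net argument. Block norms are not differentiable at the origin, so each
  is replaced by the root of one plus its square, which moves it by at most 1. Since
  \<open>l\<close> is of order \<surd>n, a bounded error multiplied by \<open>l\<close> costs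
  O(\<surd>n) in the exponent, and a power of \<open>m\<close> costs O(log n). Hence crude estimates
  are harmless except in the terms \<open>l * sqrt m\<close>, \<open>l * sqrt k * sqrt n\<close> and
  the coefficient of \<open>l\<^sup>2\<close>, which must be sharp.\<close>

section \<open>Exponential moments of the standard Gaussian\<close>

lemma space_std_gauss [simp]: "space std_gauss = UNIV"
  by (simp add: std_gauss_def)

lemma sets_std_gauss [simp, measurable_cong]: "sets std_gauss = sets borel"
  by (simp add: std_gauss_def)

lemma prob_space_std_gauss: "prob_space std_gauss"
  unfolding std_gauss_def by (rule prob_space_normal_density) simp

interpretation std_gauss: prob_space std_gauss
  by (rule prob_space_std_gauss)

interpretation gauss_prod: product_sigma_finite "\<lambda>_. std_gauss"
  by unfold_locales

lemma integrable_std_gauss_iff: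
  fixes f :: "real \<Rightarrow> real"
  assumes "f \<in> borel_measurable borel"
  shows "integrable std_gauss f \<longleftrightarrow> integrable lborel (\<lambda>x. std_normal_density x * f x)"
  unfolding std_gauss_def using assms by (subst integrable_density) auto

lemma integral_std_gauss:
  fixes f :: "real \<Rightarrow> real"
  assumes "f \<in> borel_measurable borel"
  shows "integral\<^sup>L std_gauss f = (\<integral>x. std_normal_density x * f x \<partial>lborel)"
  unfolding std_gauss_def using assms by (subst integral_density) auto

lemma std_gauss_exp_linear:
  shows "integrable std_gauss (\<lambda>x. exp (t * x))"
    and "(\<integral>x. exp (t * x) \<partial>std_gauss) = exp (t\<^sup>2 / 2)"
proof -
  have eq: "std_normal_density x * exp (t * x) = exp (t\<^sup>2 / 2) * normal_density t 1 x" for x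
    by (simp add: normal_density_def exp_add [symmetric] field_simps power2_eq_square)
  show "integrable std_gauss (\<lambda>x. exp (t * x))"
    by (subst integrable_std_gauss_iff) (simp_all add: eq)
  show "(\<integral>x. exp (t * x) \<partial>std_gauss) = exp (t\<^sup>2 / 2)"
    by (subst integral_std_gauss) (simp_all add: eq)
qed

text \<open>The tilted density is a multiple of the Gaussian density with variance
  \<open>1 / (1 - t)\<close>. Negative \<open>t\<close> is included: it is the case used for lower
  tails of Gaussian norms.\<close>

lemma std_gauss_exp_square:
  assumes "t < 1"
  shows "integrable std_gauss (\<lambda>x. exp (t * x\<^sup>2 / 2))"
    and "(\<integral>x. exp (t * x\<^sup>2 / 2) \<partial>std_gauss) = 1 / sqrt (1 - t)"
proof -
  define \<sigma> where "\<sigma> = 1 / sqrt (1 - t)"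
  have \<sigma>: "\<sigma> > 0" "1 / \<sigma>\<^sup>2 = 1 - t" using assms by (auto simp: \<sigma>_def power_divide)
  have eq: "std_normal_density x * exp (t * x\<^sup>2 / 2) = \<sigma> * normal_density 0 \<sigma> x" for x
  proof -
    have "- x\<^sup>2 / (2 * \<sigma>\<^sup>2) = - (x\<^sup>2 / 2) * (1 / \<sigma>\<^sup>2)" using \<sigma>(1) by simp
    then have "- x\<^sup>2 / (2 * \<sigma>\<^sup>2) = - x\<^sup>2 / 2 + t * x\<^sup>2 / 2"
      unfolding \<sigma>(2) by (simp add: field_simps)
    then show ?thesis using \<sigma>(1)
      by (simp add: normal_density_def real_sqrt_mult flip: exp_add)
  qed
  show "integrable std_gauss (\<lambda>x. exp (t * x\<^sup>2 / 2))"
    using \<sigma> by (subst integrable_std_gauss_iff) (simp_all add: eq)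
  show "(\<integral>x. exp (t * x\<^sup>2 / 2) \<partial>std_gauss) = 1 / sqrt (1 - t)"
    using \<sigma> by (subst integral_std_gauss) (simp_all add: eq \<sigma>_def)
qed

lemma integrable_std_gauss_exp_abs: "integrable std_gauss (\<lambda>x. exp (B * \<bar>x\<bar>))"
proof (rule Bochner_Integration.integrable_bound)
  show "integrable std_gauss (\<lambda>x. exp (B * x) + exp ((-B) * x))"
    by (intro Bochner_Integration.integrable_add std_gauss_exp_linear)
  show "AE x in std_gauss. norm (exp (B * \<bar>x\<bar>)) \<le> norm (exp (B * x) + exp ((-B) * x))"
  proof (rule AE_I2)
    fix x :: real
    show "norm (exp (B * \<bar>x\<bar>)) \<le> norm (exp (B * x) + exp ((-B) * x))"
      using abs_of_pos[OF add_pos_pos[OF exp_gt_zero[of "B * x"] exp_gt_zero[of "(-B) * x"]]]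
      by (cases "x \<ge> 0") auto
  qed
qed simp

text \<open>Growth is measured in the l1 norm throughout because its exponential factors over the
  coordinates.\<close>

lemma integrable_gauss_prod_exp_abs:
  assumes "finite I"
  shows "integrable (PiM I (\<lambda>_. std_gauss)) (\<lambda>w. exp (B * (\<Sum>i\<in>I. \<bar>w i\<bar>)))"
proof -
  have "integrable (PiM I (\<lambda>_. std_gauss)) (\<lambda>w. \<Prod>i\<in>I. exp (B * \<bar>w i\<bar>))"
    using assms integrable_std_gauss_exp_abs by (intro gauss_prod.product_integrable_prod) auto
  then show ?thesis using assms by (simp add: sum_distrib_left exp_sum)
qed

section \<open>Gaussian integration by parts\<close>

text \<open>Stein's identity: the density times \<open>f' x - x * f x\<close> is the derivative of
  the density times \<open>f\<close>, and the boundary terms vanish because the Gaussian beats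
  exponential growth.\<close>

lemma std_gauss_integral_by_parts:
  fixes f f' :: "real \<Rightarrow> real"
  assumes f: "\<And>x. (f has_real_derivative f' x) (at x)" and f': "\<And>x. isCont f' x"
    and bf: "\<And>x. \<bar>f x\<bar> \<le> C * exp (B * \<bar>x\<bar>)" and bf': "\<And>x. \<bar>f' x\<bar> \<le> C * exp (B * \<bar>x\<bar>)"
  shows "(\<integral>x. x * f x \<partial>std_gauss) = (\<integral>x. f' x \<partial>std_gauss)"
proof -
  have mf [measurable]: "f \<in> borel_measurable borel"
    using f DERIV_isCont by (intro borel_measurable_continuous_onI continuous_at_imp_continuous_on) auto
  have mf' [measurable]: "f' \<in> borel_measurable borel"
    using f' by (intro borel_measurable_continuous_onI continuous_at_imp_continuous_on) auto
  have C: "C \<ge> 0" using bf[of 0] by simp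
  have i': "integrable std_gauss f'"
    by (rule Bochner_Integration.integrable_bound[OF integrable_mult_right[OF integrable_std_gauss_exp_abs[of B], of C]])
      (use bf' in \<open>auto intro: order_trans[OF _ abs_ge_self]\<close>)
  \<comment> \<open>The extra factor satisfies \<open>\<bar>x\<bar> \<le> exp \<bar>x\<bar>\<close>,
    which raises the growth rate from \<open>B\<close> to \<open>B + 1\<close>.\<close>
  have i: "integrable std_gauss (\<lambda>x. x * f x)"
  proof (rule Bochner_Integration.integrable_bound[OF integrable_mult_right[OF integrable_std_gauss_exp_abs[of "B+1"], of C]])
    show "AE x in std_gauss. norm (x * f x) \<le> norm (C * exp ((B+1) * \<bar>x\<bar>))"
    proof (rule AE_I2)
      fix x :: real
      have "\<bar>x\<bar> * \<bar>f x\<bar> \<le> exp \<bar>x\<bar> * (C * exp (B * \<bar>x\<bar>))"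
        using exp_ge_add_one_self[of "\<bar>x\<bar>"] bf[of x] by (intro mult_mono) linarith+
      then show "norm (x * f x) \<le> norm (C * exp ((B+1) * \<bar>x\<bar>))"
        using C by (simp add: abs_mult algebra_simps exp_add)
    qed
  qed simp
  let ?d = "\<lambda>x. std_normal_density x * f' x - std_normal_density x * (x * f x)"
  have id: "integrable lborel ?d"
    using i i' by (intro Bochner_Integration.integrable_diff) (simp_all add: integrable_std_gauss_iff)
  have lim: "((\<lambda>x. std_normal_density x * f x) \<longlongrightarrow> 0) F" if "F = at_top \<or> F = at_bot" for F
  proof (rule Lim_null_comparison)
    show "\<forall>\<^sub>F x in F. norm (std_normal_density x * f x) \<le> C * (std_normal_density x * exp (B * \<bar>x\<bar>))"
      using mult_left_mono[OF bf normal_density_nonneg[of 0 1]]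
      by (intro always_eventually allI) (simp add: abs_mult mult.left_commute)
    have "((\<lambda>x. exp (- x\<^sup>2 / 2 + B * \<bar>x\<bar>)) \<longlongrightarrow> 0) F"
    proof (rule filterlim_compose[OF exp_at_bot])
      \<comment> \<open>Completing the square spends half of the quadratic decay on the linear
        term.\<close>
      have b: "- x\<^sup>2 / 2 + B * \<bar>x\<bar> \<le> B\<^sup>2 - x\<^sup>2 / 4" for x
      proof -
        have "(\<bar>x\<bar> / 2 - B)\<^sup>2 \<ge> 0" by simp
        then show ?thesis by (simp add: power2_diff power_divide mult.commute[of B])
      qed
      have "LIM x F. x\<^sup>2 :> at_top"
        using that filterlim_pow_at_top[OF _ filterlim_ident, of 2]
          filterlim_pow_at_bot_even[OF _ filterlim_ident, of 2] by auto
      then have "LIM x F. (B\<^sup>2 - x\<^sup>2 / 4) :> at_bot"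
        unfolding filterlim_at_bot filterlim_at_top
        apply (intro allI)
        subgoal for Z by (drule spec[of _ "4 * (B\<^sup>2 - Z)"]) (auto elim!: eventually_mono)
        done
      then show "LIM x F. - x\<^sup>2 / 2 + B * \<bar>x\<bar> :> at_bot"
        by (rule filterlim_at_bot_mono) (intro always_eventually allI b)
    qed
    then have "((\<lambda>x. C * ((1 / sqrt (2 * pi)) * exp (- x\<^sup>2 / 2 + B * \<bar>x\<bar>))) \<longlongrightarrow> C * ((1 / sqrt (2 * pi)) * 0)) F"
      by (intro tendsto_mult tendsto_const)
    then show "((\<lambda>x. C * (std_normal_density x * exp (B * \<bar>x\<bar>))) \<longlongrightarrow> 0) F"
      by (simp add: std_normal_density_def flip: exp_add)
  qed
  have "(LBINT x=-\<infinity>..\<infinity>. ?d x) = 0 - 0"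
  proof (rule interval_integral_FTC_integrable)
    show "((\<lambda>x. std_normal_density x * f x) has_vector_derivative ?d x) (at x)" for x
    proof -
      have "(std_normal_density has_real_derivative (- x * std_normal_density x)) (at x)"
      proof -
        have "((\<lambda>x. c * exp (- x\<^sup>2 / 2)) has_real_derivative - x * (c * exp (- x\<^sup>2 / 2))) (at x)" for c :: real
          by (auto intro!: derivative_eq_intros)
        then show ?thesis unfolding std_normal_density_def .
      qed
      from DERIV_mult[OF this f[of x]] show ?thesis
        unfolding has_real_derivative_iff_has_vector_derivative[symmetric]
        by (rule back_subst[where P="\<lambda>D. (_ has_real_derivative D) _"]) (simp add: algebra_simps)
    qed
    show "isCont ?d x" for x
      unfolding std_normal_density_def using f' DERIV_isCont[OF f] by (intro continuous_intros) auto
    show "set_integrable lborel (einterval (-\<infinity>) \<infinity>) ?d"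
      using id by (simp add: set_integrable_def)
    show "(((\<lambda>x. std_normal_density x * f x) \<circ> real_of_ereal) \<longlongrightarrow> 0) (at_right (-\<infinity>))"
      using lim[of at_bot] by (simp add: ereal_tendsto_simps)
    show "(((\<lambda>x. std_normal_density x * f x) \<circ> real_of_ereal) \<longlongrightarrow> 0) (at_left \<infinity>)"
      using lim[of at_top] by (simp add: ereal_tendsto_simps)
  qed simp
  then have "(\<integral>x. ?d x \<partial>lborel) = 0"
    by (simp add: interval_lebesgue_integral_def set_lebesgue_integral_def)
  then show ?thesis
    using i i' by (subst (1 2) integral_std_gauss) (simp_all add: integrable_std_gauss_iff)
qed

text \<open>Fubini isolates coordinate \<open>i\<close>; with the other coordinates frozen, their
  share of the exponential growth bound is a constant, so the one-dimensional identity
  applies.\<close>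

lemma gauss_prod_integral_by_parts:
  fixes f f' :: "('i \<Rightarrow> real) \<Rightarrow> real"
  assumes I: "finite I" "i \<in> I"
    and [measurable]: "f \<in> borel_measurable (PiM I (\<lambda>_. std_gauss))"
      "f' \<in> borel_measurable (PiM I (\<lambda>_. std_gauss))"
    and f: "\<And>w x. ((\<lambda>y. f (w(i := y))) has_real_derivative f' (w(i := x))) (at x)"
    and f': "\<And>w x. isCont (\<lambda>y. f' (w(i := y))) x"
    and bf: "\<And>w. \<bar>f w\<bar> \<le> C * exp (B * (\<Sum>i\<in>I. \<bar>w i\<bar>))"
    and bf': "\<And>w. \<bar>f' w\<bar> \<le> C * exp (B * (\<Sum>i\<in>I. \<bar>w i\<bar>))"
  shows "integrable (PiM I (\<lambda>_. std_gauss)) (\<lambda>w. w i * f w)"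
    and "integrable (PiM I (\<lambda>_. std_gauss)) f'"
    and "(\<integral>w. w i * f w \<partial>PiM I (\<lambda>_. std_gauss)) = (\<integral>w. f' w \<partial>PiM I (\<lambda>_. std_gauss))"
proof -
  have C: "C \<ge> 0"
    using order_trans[OF abs_ge_zero bf[of "\<lambda>_. 0"]] by simp
  show 1: "integrable (PiM I (\<lambda>_. std_gauss)) f'"
    by (rule Bochner_Integration.integrable_bound[OF integrable_mult_right[OF integrable_gauss_prod_exp_abs[OF I(1), of B], of C]])
      (use bf' in \<open>auto intro: order_trans[OF _ abs_ge_self]\<close>)
  show 2: "integrable (PiM I (\<lambda>_. std_gauss)) (\<lambda>w. w i * f w)"
  proof (rule Bochner_Integration.integrable_bound[OF integrable_mult_right[OF integrable_gauss_prod_exp_abs[OF I(1), of "B+1"], of C]])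
    show "(\<lambda>w. w i * f w) \<in> borel_measurable (PiM I (\<lambda>_. std_gauss))"
      using I(2) by measurable
    show "AE w in PiM I (\<lambda>_. std_gauss). norm (w i * f w) \<le> norm (C * exp ((B+1) * (\<Sum>i\<in>I. \<bar>w i\<bar>)))"
    proof (rule AE_I2)
      fix w :: "'i \<Rightarrow> real"
      have "\<bar>w i\<bar> \<le> (\<Sum>i\<in>I. \<bar>w i\<bar>)" using I by (intro member_le_sum) auto
      then have "\<bar>w i\<bar> * \<bar>f w\<bar> \<le> exp (\<Sum>i\<in>I. \<bar>w i\<bar>) * (C * exp (B * (\<Sum>i\<in>I. \<bar>w i\<bar>)))"
        using exp_ge_add_one_self[of "\<Sum>i\<in>I. \<bar>w i\<bar>"] bf[of w] by (intro mult_mono) linarith+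
      then show "norm (w i * f w) \<le> norm (C * exp ((B+1) * (\<Sum>i\<in>I. \<bar>w i\<bar>)))"
        using C by (simp add: abs_mult algebra_simps exp_add)
    qed
  qed
  define J where "J = I - {i}"
  have J: "finite J" "i \<notin> J" "I = insert i J" using I by (auto simp: J_def)
  have *: "(\<integral>y. (w(i:=y)) i * f (w(i:=y)) \<partial>std_gauss) = (\<integral>y. f' (w(i:=y)) \<partial>std_gauss)" for w
  proof -
    have s: "(\<Sum>j\<in>I. \<bar>(w(i:=x)) j\<bar>) = \<bar>x\<bar> + (\<Sum>j\<in>J. \<bar>w j\<bar>)" for x
      using J by (auto intro!: sum.cong)
    have "(\<integral>y. y * f (w(i:=y)) \<partial>std_gauss) = (\<integral>y. f' (w(i:=y)) \<partial>std_gauss)"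
    proof (rule std_gauss_integral_by_parts[OF f f'])
      show "\<bar>f (w(i:=x))\<bar> \<le> (C * exp (B * (\<Sum>j\<in>J. \<bar>w j\<bar>))) * exp (B * \<bar>x\<bar>)" for x
        using bf[of "w(i:=x)"] unfolding s by (simp add: distrib_left exp_add mult_ac)
      show "\<bar>f' (w(i:=x))\<bar> \<le> (C * exp (B * (\<Sum>j\<in>J. \<bar>w j\<bar>))) * exp (B * \<bar>x\<bar>)" for x
        using bf'[of "w(i:=x)"] unfolding s by (simp add: distrib_left exp_add mult_ac)
    qed
    then show ?thesis by simp
  qed
  show "(\<integral>w. w i * f w \<partial>PiM I (\<lambda>_. std_gauss)) = (\<integral>w. f' w \<partial>PiM I (\<lambda>_. std_gauss))"
    using 1 2 unfolding J(3)
    by (subst (1 2) gauss_prod.product_integral_insert[OF J(1,2)]) (simp_all only: *)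
qed

section \<open>Derivative of a Gaussian expectation along a rotation\<close>

text \<open>By the mean value inequality the bound on the derivative also dominates all difference
  quotients, so dominated convergence applies along each sequence.\<close>

lemma has_real_derivative_integral:
  fixes f f' :: "real \<Rightarrow> 'a \<Rightarrow> real"
  assumes f: "\<And>t. integrable M (f t)"
    and [measurable]: "\<And>t. f' t \<in> borel_measurable M"
    and d: "\<And>t x. x \<in> space M \<Longrightarrow> ((\<lambda>t. f t x) has_real_derivative f' t x) (at t)"
    and b: "\<And>t x. x \<in> space M \<Longrightarrow> \<bar>f' t x\<bar> \<le> u x"
    and u: "integrable M u"
  shows "((\<lambda>t. \<integral>x. f t x \<partial>M) has_real_derivative (\<integral>x. f' t x \<partial>M)) (at t)"
  unfolding has_field_derivative_iff tendsto_at_iff_sequentially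
proof (intro allI impI)
  fix X :: "nat \<Rightarrow> real"
  assume X: "\<forall>i. X i \<in> UNIV - {t}" "X \<longlonglongrightarrow> t"
  have [measurable]: "\<And>t. f t \<in> borel_measurable M" using f by auto
  have eq: "((\<lambda>y. ((\<integral>x. f y x \<partial>M) - (\<integral>x. f t x \<partial>M)) / (y - t)) \<circ> X)
      = (\<lambda>i. \<integral>x. (f (X i) x - f t x) / (X i - t) \<partial>M)"
    using f by (auto simp: fun_eq_iff)
  have "(\<lambda>i. \<integral>x. (f (X i) x - f t x) / (X i - t) \<partial>M) \<longlonglongrightarrow> (\<integral>x. f' t x \<partial>M)"
  proof (rule integral_dominated_convergence[where w=u])
    show "AE x in M. (\<lambda>i. (f (X i) x - f t x) / (X i - t)) \<longlonglongrightarrow> f' t x"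
    proof (rule AE_I2)
      fix x assume "x \<in> space M"
      from d[OF this, of t] X show "(\<lambda>i. (f (X i) x - f t x) / (X i - t)) \<longlonglongrightarrow> f' t x"
        unfolding has_field_derivative_iff tendsto_at_iff_sequentially by (auto simp: o_def)
    qed
    show "AE x in M. norm ((f (X i) x - f t x) / (X i - t)) \<le> u x" for i
    proof (rule AE_I2)
      fix x assume x: "x \<in> space M"
      have "norm (f (X i) x - f t x) \<le> u x * norm (X i - t)"
        by (rule field_differentiable_bound[where S=UNIV and f'="\<lambda>t. f' t x"])
          (use d[OF x] b[OF x] in auto)
      then show "norm ((f (X i) x - f t x) / (X i - t)) \<le> u x"
        using X(1) by (simp add: divide_simps)
    qed
  qed (use u in auto)
  then show "((\<lambda>y. ((\<integral>x. f y x \<partial>M) - (\<integral>x. f t x \<partial>M)) / (y - t)) \<circ> X) \<longlonglongrightarrow> (\<integral>x. f' t x \<partial>M)"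
    unfolding eq .
qed

text \<open>The chain rule and the continuity and measurability of the derivatives are required along
  arbitrary curves, which avoids any structure on the function space \<open>'q \<Rightarrow> real\<close>.\<close>

lemma gauss_interpolation_has_derivative:
  fixes P Q :: "'q \<Rightarrow> 'i \<Rightarrow> real" and \<Psi> :: "('q \<Rightarrow> real) \<Rightarrow> real"
    and D1 :: "'q \<Rightarrow> ('q \<Rightarrow> real) \<Rightarrow> real" and D2 :: "'q \<Rightarrow> 'q \<Rightarrow> ('q \<Rightarrow> real) \<Rightarrow> real"
    and I :: "'i set" and J :: "'q set" and B C :: real
  defines "M \<equiv> PiM I (\<lambda>_. std_gauss)"
  defines "L \<equiv> (\<lambda>\<theta> w q. sin \<theta> * (\<Sum>i\<in>I. P q i * w i) + cos \<theta> * (\<Sum>i\<in>I. Q q i * w i))"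
  assumes I: "finite I" and J: "finite J" and B: "B \<ge> 0"
    and orth: "\<And>q q'. q \<in> J \<Longrightarrow> q' \<in> J \<Longrightarrow> (\<Sum>i\<in>I. P q i * Q q' i) = 0"
    and d1: "\<And>c c' t. (\<And>q. q \<in> J \<Longrightarrow> ((\<lambda>t. c t q) has_real_derivative c' q) (at t)) \<Longrightarrow>
        ((\<lambda>t. \<Psi> (c t)) has_real_derivative (\<Sum>q\<in>J. D1 q (c t) * c' q)) (at t)"
    and d2: "\<And>p c c' t. p \<in> J \<Longrightarrow> (\<And>q. q \<in> J \<Longrightarrow> ((\<lambda>t. c t q) has_real_derivative c' q) (at t)) \<Longrightarrow>
        ((\<lambda>t. D1 p (c t)) has_real_derivative (\<Sum>q\<in>J. D2 p q (c t) * c' q)) (at t)"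
    and cont: "\<And>p q c t. p \<in> J \<Longrightarrow> q \<in> J \<Longrightarrow> (\<And>q. q \<in> J \<Longrightarrow> isCont (\<lambda>t. c t q) t) \<Longrightarrow>
        isCont (\<lambda>t::real. D2 p q (c t)) t"
    and m0: "\<And>c. (\<And>q. q \<in> J \<Longrightarrow> (\<lambda>w. c w q) \<in> borel_measurable M) \<Longrightarrow> (\<lambda>w. \<Psi> (c w)) \<in> borel_measurable M"
    and m1: "\<And>p c. p \<in> J \<Longrightarrow> (\<And>q. q \<in> J \<Longrightarrow> (\<lambda>w. c w q) \<in> borel_measurable M) \<Longrightarrow>
        (\<lambda>w. D1 p (c w)) \<in> borel_measurable M"
    and m2: "\<And>p q c. p \<in> J \<Longrightarrow> q \<in> J \<Longrightarrow> (\<And>q. q \<in> J \<Longrightarrow> (\<lambda>w. c w q) \<in> borel_measurable M) \<Longrightarrow>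
        (\<lambda>w. D2 p q (c w)) \<in> borel_measurable M"
    and b0: "\<And>v. \<bar>\<Psi> v\<bar> \<le> C * exp (B * (\<Sum>q\<in>J. \<bar>v q\<bar>))"
    and b1: "\<And>p v. p \<in> J \<Longrightarrow> \<bar>D1 p v\<bar> \<le> C * exp (B * (\<Sum>q\<in>J. \<bar>v q\<bar>))"
    and b2: "\<And>p q v. p \<in> J \<Longrightarrow> q \<in> J \<Longrightarrow> \<bar>D2 p q v\<bar> \<le> C * exp (B * (\<Sum>q\<in>J. \<bar>v q\<bar>))"
  shows "\<And>\<theta>. integrable M (\<lambda>w. \<Psi> (L \<theta> w))"
    and "\<And>p q \<theta>. p \<in> J \<Longrightarrow> q \<in> J \<Longrightarrow> integrable M (\<lambda>w. D2 p q (L \<theta> w))"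
    and "((\<lambda>\<theta>. \<integral>w. \<Psi> (L \<theta> w) \<partial>M) has_real_derivative
        (\<Sum>p\<in>J. \<Sum>q\<in>J. sin \<theta> * cos \<theta> * (\<Sum>i\<in>I. P p i * P q i - Q p i * Q q i) *
           (\<integral>w. D2 p q (L \<theta> w) \<partial>M))) (at \<theta>)"
proof -
  define A where "A = (\<Sum>q\<in>J. \<Sum>i\<in>I. \<bar>P q i\<bar> + \<bar>Q q i\<bar>)"
  define S where "S w = (\<Sum>i\<in>I. \<bar>w i\<bar>)" for w :: "'i \<Rightarrow> real"
  have C: "C \<ge> 0" using order_trans[OF abs_ge_zero b0[of "\<lambda>_. 0"]] by simp
  have A: "A \<ge> 0" by (auto simp: A_def intro!: sum_nonneg)
  have S0: "S w \<ge> 0" for w by (auto simp: S_def intro!: sum_nonneg)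
  have trig: "\<bar>sin \<theta> * a + cos \<theta> * b\<bar> \<le> \<bar>a\<bar> + \<bar>b\<bar>" for \<theta> a b :: real
  proof -
    have "\<bar>sin \<theta> * a\<bar> \<le> 1 * \<bar>a\<bar>" "\<bar>cos \<theta> * b\<bar> \<le> 1 * \<bar>b\<bar>"
      unfolding abs_mult by (intro mult_right_mono; simp)+
    then show ?thesis by linarith
  qed
  have Leq: "L \<theta> w q = (\<Sum>i\<in>I. (sin \<theta> * P q i + cos \<theta> * Q q i) * w i)" for \<theta> w q
    unfolding L_def by (simp add: sum_distrib_left distrib_right sum.distrib mult.assoc)
  have coef: "\<bar>sin \<theta> * P q i + cos \<theta> * Q q i\<bar> \<le> A" "\<bar>cos \<theta> * P q i - sin \<theta> * Q q i\<bar> \<le> A"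
    if "q \<in> J" "i \<in> I" for q i \<theta>
  proof -
    have "\<bar>P q i\<bar> + \<bar>Q q i\<bar> \<le> (\<Sum>i\<in>I. \<bar>P q i\<bar> + \<bar>Q q i\<bar>)"
      using that I by (intro member_le_sum[of i I "\<lambda>i. \<bar>P q i\<bar> + \<bar>Q q i\<bar>"]) auto
    also have "\<dots> \<le> A" unfolding A_def
      using that J by (intro member_le_sum[of q J "\<lambda>q. \<Sum>i\<in>I. \<bar>P q i\<bar> + \<bar>Q q i\<bar>"]) (auto intro: sum_nonneg)
    finally have *: "\<bar>P q i\<bar> + \<bar>Q q i\<bar> \<le> A" .
    show "\<bar>sin \<theta> * P q i + cos \<theta> * Q q i\<bar> \<le> A" "\<bar>cos \<theta> * P q i - sin \<theta> * Q q i\<bar> \<le> A"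
      using trig[of \<theta> "P q i" "Q q i"] trig[of \<theta> "- Q q i" "P q i"] * by (auto simp: algebra_simps)
  qed
  define A' where "A' = card J * A"
  have A': "A' \<ge> 0" using A by (simp add: A'_def)
  have LS: "(\<Sum>q\<in>J. \<bar>L \<theta> w q\<bar>) \<le> A' * S w" for \<theta> w
  proof -
    have "(\<Sum>q\<in>J. \<bar>L \<theta> w q\<bar>) \<le> (\<Sum>q\<in>J. A * S w)"
    proof (rule sum_mono)
      fix q assume q: "q \<in> J"
      have "\<bar>L \<theta> w q\<bar> \<le> (\<Sum>i\<in>I. \<bar>(sin \<theta> * P q i + cos \<theta> * Q q i) * w i\<bar>)"
        unfolding Leq by (rule sum_abs)
      also have "\<dots> \<le> (\<Sum>i\<in>I. A * \<bar>w i\<bar>)"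
        unfolding abs_mult using coef[OF q] by (intro sum_mono mult_right_mono) auto
      finally show "\<bar>L \<theta> w q\<bar> \<le> A * S w" by (simp add: S_def sum_distrib_left)
    qed
    then show ?thesis by (simp add: A'_def)
  qed
  have expLS: "C * exp (B * (\<Sum>q\<in>J. \<bar>L \<theta> w q\<bar>)) \<le> C * exp (B * A' * S w)" for \<theta> w
    using mult_left_mono[OF LS B, of \<theta> w] C by (intro mult_left_mono) (auto simp: mult.assoc)
  have Lm: "(\<lambda>w. L \<theta> w q) \<in> borel_measurable M" for \<theta> q
    unfolding L_def M_def by measurable
  have intE: "integrable M (\<lambda>w. K * exp (b * S w))" for K b :: real
    unfolding M_def S_def by (intro integrable_mult_right integrable_gauss_prod_exp_abs I)
  have intb: "integrable M f" if "f \<in> borel_measurable M" "\<And>w. \<bar>f w\<bar> \<le> K * exp (b * S w)" for f K b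
    by (rule Bochner_Integration.integrable_bound[OF intE that(1)])
      (use that(2) in \<open>auto intro!: AE_I2 intro: order_trans[OF _ abs_ge_self]\<close>)
  show int0: "integrable M (\<lambda>w. \<Psi> (L \<theta> w))" for \<theta>
    by (rule intb[OF m0 order_trans[OF b0 expLS]]) (rule Lm)
  show int2: "integrable M (\<lambda>w. D2 p q (L \<theta> w))" if "p \<in> J" "q \<in> J" for p q \<theta>
    by (rule intb[OF m2[OF that] order_trans[OF b2[OF that] expLS]]) (rule Lm)
  have ibp: "integrable M (\<lambda>w. w i * D1 p (L \<theta> w))"
      "(\<integral>w. w i * D1 p (L \<theta> w) \<partial>M) = (\<Sum>q\<in>J. (sin \<theta> * P q i + cos \<theta> * Q q i) * (\<integral>w. D2 p q (L \<theta> w) \<partial>M))"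
    if i: "i \<in> I" and p: "p \<in> J" for i p \<theta>
  proof -
    let ?e = "\<lambda>q. sin \<theta> * P q i + cos \<theta> * Q q i"
    let ?f' = "\<lambda>w. \<Sum>q\<in>J. D2 p q (L \<theta> w) * ?e q"
    have Lupd: "L \<theta> (w(i := y)) q = L \<theta> (w(i := 0)) q + ?e q * y" for w y q
      unfolding Leq using i I by (subst (1 2) sum.remove[of I i]) auto
    have dL: "((\<lambda>y. L \<theta> (w(i := y)) q) has_real_derivative ?e q) (at x)" for w q x
      by (subst Lupd) (auto intro!: derivative_eq_intros)
    \<comment> \<open>Integration by parts takes one growth constant for the function and its
      derivative; \<open>1 + A'\<close> serves both.\<close>
    have bf': "\<bar>?f' w\<bar> \<le> (C * (1 + A')) * exp (B * A' * S w)" for w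
    proof -
      have "\<bar>?f' w\<bar> \<le> (\<Sum>q\<in>J. \<bar>D2 p q (L \<theta> w) * ?e q\<bar>)" by (rule sum_abs)
      also have "\<dots> \<le> (\<Sum>q\<in>J. (C * exp (B * A' * S w)) * A)"
        unfolding abs_mult using coef(1)[OF _ i] order_trans[OF b2[OF p] expLS] C
        by (intro sum_mono mult_mono) auto
      also have "\<dots> = C * A' * exp (B * A' * S w)" by (simp add: A'_def)
      also have "\<dots> \<le> (C * (1 + A')) * exp (B * A' * S w)" using C A' by (intro mult_right_mono) (auto simp: distrib_left)
      finally show ?thesis .
    qed
    have bf: "\<bar>D1 p (L \<theta> w)\<bar> \<le> (C * (1 + A')) * exp (B * A' * S w)" for w
    proof -
      have "\<bar>D1 p (L \<theta> w)\<bar> \<le> C * exp (B * A' * S w)" by (rule order_trans[OF b1[OF p] expLS])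
      also have "\<dots> \<le> (C * (1 + A')) * exp (B * A' * S w)" using C A' by (intro mult_right_mono) (auto simp: distrib_left)
      finally show ?thesis .
    qed
    have mf: "(\<lambda>w. D1 p (L \<theta> w)) \<in> borel_measurable M" by (rule m1[OF p Lm])
    have mf': "?f' \<in> borel_measurable M"
      by (intro borel_measurable_sum borel_measurable_times m2[OF p _ Lm]) auto
    have df: "((\<lambda>y. D1 p (L \<theta> (w(i := y)))) has_real_derivative ?f' (w(i := x))) (at x)" for w x
      by (rule d2[OF p dL])
    have cf: "isCont (\<lambda>y. ?f' (w(i := y))) x" for w x
      using DERIV_isCont[OF dL] by (intro continuous_intros cont[OF p]) auto
    note ib = gauss_prod_integral_by_parts[OF I i mf[unfolded M_def] mf'[unfolded M_def] df cf
        bf[unfolded S_def] bf'[unfolded S_def], folded M_def]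
    show "integrable M (\<lambda>w. w i * D1 p (L \<theta> w))" by (rule ib(1))
    have "(\<integral>w. w i * D1 p (L \<theta> w) \<partial>M) = (\<integral>w. ?f' w \<partial>M)" by (rule ib(3))
    also have "\<dots> = (\<Sum>q\<in>J. ?e q * (\<integral>w. D2 p q (L \<theta> w) \<partial>M))"
      using int2[OF p] by (subst Bochner_Integration.integral_sum) (auto simp: mult.commute)
    finally show "(\<integral>w. w i * D1 p (L \<theta> w) \<partial>M) = (\<Sum>q\<in>J. ?e q * (\<integral>w. D2 p q (L \<theta> w) \<partial>M))" .
  qed
  \<comment> \<open>Differentiation in the angle leaves a factor \<open>w i\<close>; integrating by
    parts in that entry trades it for the second derivatives \<open>D2\<close>.\<close>
  define f' where "f' \<theta> w = (\<Sum>p\<in>J. \<Sum>i\<in>I. (cos \<theta> * P p i - sin \<theta> * Q p i) * (w i * D1 p (L \<theta> w)))" for \<theta> w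
  have "((\<lambda>\<theta>. \<integral>w. \<Psi> (L \<theta> w) \<partial>M) has_real_derivative (\<integral>w. f' \<theta> w \<partial>M)) (at \<theta>)"
  proof (rule has_real_derivative_integral[where u="\<lambda>w. (card J * (card I * (A * C))) * exp ((1 + B * A') * S w)"])
    show "f' t \<in> borel_measurable M" for t
      unfolding f'_def
      by (intro borel_measurable_sum borel_measurable_times[OF borel_measurable_const]
          ibp(1)[THEN borel_measurable_integrable])
    show "((\<lambda>\<theta>. \<Psi> (L \<theta> w)) has_real_derivative f' t w) (at t)" for t w
    proof -
      have "((\<lambda>\<theta>. \<Psi> (L \<theta> w)) has_real_derivative
          (\<Sum>q\<in>J. D1 q (L t w) * (cos t * (\<Sum>i\<in>I. P q i * w i) - sin t * (\<Sum>i\<in>I. Q q i * w i)))) (at t)"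
        by (rule d1) (auto simp: L_def intro!: derivative_eq_intros)
      also have "(\<Sum>q\<in>J. D1 q (L t w) * (cos t * (\<Sum>i\<in>I. P q i * w i) - sin t * (\<Sum>i\<in>I. Q q i * w i))) = f' t w"
        unfolding f'_def sum_distrib_left sum_subtractf[symmetric] by (intro sum.cong refl) (simp add: algebra_simps)
      finally show ?thesis .
    qed
    show "\<bar>f' t w\<bar> \<le> (card J * (card I * (A * C))) * exp ((1 + B * A') * S w)" for t w
    proof -
      have "\<bar>f' t w\<bar> \<le> (\<Sum>p\<in>J. \<bar>\<Sum>i\<in>I. (cos t * P p i - sin t * Q p i) * (w i * D1 p (L t w))\<bar>)"
        unfolding f'_def by (rule sum_abs)
      also have "\<dots> \<le> (\<Sum>p\<in>J. \<Sum>i\<in>I. \<bar>(cos t * P p i - sin t * Q p i) * (w i * D1 p (L t w))\<bar>)"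
        by (intro sum_mono sum_abs)
      also have "\<dots> \<le> (\<Sum>p\<in>J. \<Sum>i\<in>I. A * (exp (S w) * (C * exp (B * A' * S w))))"
      proof (intro sum_mono)
        fix p i assume p: "p \<in> J" and i: "i \<in> I"
        have "\<bar>w i\<bar> \<le> S w" unfolding S_def using i I by (intro member_le_sum) auto
        then have "\<bar>w i\<bar> \<le> exp (S w)" using exp_ge_add_one_self[of "S w"] by linarith
        then show "\<bar>(cos t * P p i - sin t * Q p i) * (w i * D1 p (L t w))\<bar> \<le> A * (exp (S w) * (C * exp (B * A' * S w)))"
          unfolding abs_mult using coef(2)[OF p i] order_trans[OF b1[OF p] expLS] A
          by (intro mult_mono) auto
      qed
      also have "\<dots> = (card J * (card I * (A * C))) * exp ((1 + B * A') * S w)"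
        by (simp add: distrib_right exp_add)
      finally show ?thesis .
    qed
  qed (fact int0 intE)+
  also have "(\<integral>w. f' \<theta> w \<partial>M) = (\<Sum>p\<in>J. \<Sum>i\<in>I. (cos \<theta> * P p i - sin \<theta> * Q p i) *
      (\<Sum>q\<in>J. (sin \<theta> * P q i + cos \<theta> * Q q i) * (\<integral>w. D2 p q (L \<theta> w) \<partial>M)))"
    unfolding f'_def using ibp by (simp add: Bochner_Integration.integral_sum)
  also have "\<dots> = (\<Sum>p\<in>J. \<Sum>q\<in>J. (\<Sum>i\<in>I. (cos \<theta> * P p i - sin \<theta> * Q p i) * (sin \<theta> * P q i + cos \<theta> * Q q i)) *
      (\<integral>w. D2 p q (L \<theta> w) \<partial>M))"
    unfolding sum_distrib_left sum_distrib_right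
    by (intro sum.cong refl trans[OF sum.swap]) (simp add: mult.assoc)
  also have "\<dots> = (\<Sum>p\<in>J. \<Sum>q\<in>J. sin \<theta> * cos \<theta> * (\<Sum>i\<in>I. P p i * P q i - Q p i * Q q i) *
           (\<integral>w. D2 p q (L \<theta> w) \<partial>M))"
  \<comment> \<open>The terms with squared sine or cosine pair a row of \<open>P\<close> with a row
    of \<open>Q\<close> and vanish by orthogonality. What survives is the difference of the two
    covariances.\<close>
  proof (intro sum.cong refl arg_cong2[where f="(*)"])
    fix p q assume p: "p \<in> J" and q: "q \<in> J"
    have "(\<Sum>i\<in>I. (cos \<theta> * P p i - sin \<theta> * Q p i) * (sin \<theta> * P q i + cos \<theta> * Q q i)) =
      (\<Sum>i\<in>I. sin \<theta> * cos \<theta> * (P p i * P q i - Q p i * Q q i) + (cos \<theta>)\<^sup>2 * (P p i * Q q i) - (sin \<theta>)\<^sup>2 * (P q i * Q p i))"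
      by (intro sum.cong refl) (simp add: algebra_simps power2_eq_square)
    also have "\<dots> = sin \<theta> * cos \<theta> * (\<Sum>i\<in>I. P p i * P q i - Q p i * Q q i)"
      unfolding sum_subtractf sum.distrib sum_distrib_left[symmetric] orth[OF p q] orth[OF q p] by simp
    finally show "(\<Sum>i\<in>I. (cos \<theta> * P p i - sin \<theta> * Q p i) * (sin \<theta> * P q i + cos \<theta> * Q q i)) =
      sin \<theta> * cos \<theta> * (\<Sum>i\<in>I. P p i * P q i - Q p i * Q q i)" .
  qed
  finally show "((\<lambda>\<theta>. \<integral>w. \<Psi> (L \<theta> w) \<partial>M) has_real_derivative
        (\<Sum>p\<in>J. \<Sum>q\<in>J. sin \<theta> * cos \<theta> * (\<Sum>i\<in>I. P p i * P q i - Q p i * Q q i) *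
           (\<integral>w. D2 p q (L \<theta> w) \<partial>M))) (at \<theta>)" .
qed

section \<open>The smoothed comparison functional and its derivatives\<close>

lemma sqrt_one_plus_sum_squares_le:
  fixes f :: "'a \<Rightarrow> real"
  shows "sqrt (1 + (\<Sum>r\<in>A. (f r)\<^sup>2)) \<le> 1 + (\<Sum>r\<in>A. \<bar>f r\<bar>)"
proof -
  have "sqrt (1 + (\<Sum>r\<in>A. (f r)\<^sup>2)) \<le> sqrt 1 + sqrt (\<Sum>r\<in>A. (f r)\<^sup>2)"
    by (rule sqrt_add_le_add_sqrt) (auto intro: sum_nonneg)
  also have "sqrt (\<Sum>r\<in>A. (f r)\<^sup>2) \<le> (\<Sum>r\<in>A. \<bar>f r\<bar>)"
    using L2_set_le_sum_abs[of f A] by (simp add: L2_set_def)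
  finally show ?thesis by simp
qed

lemma mult_le_mean_squares: "x * y \<le> (x\<^sup>2 + y\<^sup>2) / 2" for x y :: real
  using sum_squares_bound[of x y] by simp

text \<open>The Gaussian entries: \<open>(i, r, j)\<close> with \<open>i < k\<close>, \<open>j < n\<close> for the matrix and \<open>j = n\<close> for an
  independent vector of the block space; \<open>(k, 0, j)\<close> with \<open>j < n\<close> for an independent vector
  in \<open>n\<close>-space and \<open>j = n\<close> for an independent scalar.\<close>

definition gidx :: "nat \<Rightarrow> nat \<Rightarrow> nat \<Rightarrow> (nat \<times> nat \<times> nat) set" where
  "gidx k m n = {..<k} \<times> {..<m} \<times> {..n} \<union> {k} \<times> {0} \<times> {..n}"

text \<open>Index \<open>(h, i, r)\<close> with \<open>i < k\<close> is row \<open>r\<close> of block \<open>i\<close> of the Gaussian vector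
  attached to \<open>h\<close>; index \<open>(h, k, 0)\<close> is the scalar Gaussian attached to \<open>h\<close>.\<close>

locale gordon =
  fixes k m n :: nat and sg :: "nat \<Rightarrow> real" and H :: "(nat \<Rightarrow> real) set" and p a :: real
  assumes sg: "\<And>i. \<bar>sg i\<bar> \<le> 1" and H: "finite H" "H \<noteq> {}"
    and unit: "\<And>h. h \<in> H \<Longrightarrow> (\<Sum>j<n. (h j)\<^sup>2) = 1"
    and p: "p > 0" and a: "0 < a" "a < 1" and k: "k > 0"
begin

definition K :: "(nat \<times> nat) set" where "K = {..<k} \<times> {..<m} \<union> {(k, 0)}"

abbreviation J where "J \<equiv> H \<times> K"

abbreviation I where "I \<equiv> gidx k m n"

type_synonym pt = "(nat \<Rightarrow> real) \<times> nat \<times> nat \<Rightarrow> real"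

text \<open>The 1 under the root makes the block norm smooth at the origin and keeps quotients by it
  bounded.\<close>

definition R :: "pt \<Rightarrow> (nat \<Rightarrow> real) \<Rightarrow> nat \<Rightarrow> real" where
  "R v h i = sqrt (1 + (\<Sum>r<m. (v (h, i, r))\<^sup>2))"

definition Y :: "pt \<Rightarrow> (nat \<Rightarrow> real) \<Rightarrow> real" where
  "Y v h = (\<Sum>i<k. sg i * R v h i) + sqrt k * v (h, k, 0)"

definition W :: "pt \<Rightarrow> real" where "W v = (\<Sum>h\<in>H. exp (- p * Y v h))"

text \<open>A soft maximum of \<open>exp (- p * a * Y v h)\<close> over \<open>h\<close>: it lies
  between the true maximum and \<open>card H powr a\<close> times it.\<close>

definition \<Psi> :: "pt \<Rightarrow> real" where "\<Psi> v = W v powr a"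

text \<open>The gradient of \<open>Y\<close>; in the scalar slot, with first index \<open>k\<close>,
  it is the constant \<open>sqrt k\<close>. \<open>DN\<close> collects the second
  derivatives.\<close>

definition N :: "pt \<Rightarrow> (nat \<Rightarrow> real) \<Rightarrow> nat \<times> nat \<Rightarrow> real" where
  "N v h x = (if fst x < k then sg (fst x) * (v (h, x) / R v h (fst x)) else sqrt k)"

definition DN :: "pt \<Rightarrow> (nat \<Rightarrow> real) \<Rightarrow> nat \<times> nat \<Rightarrow> nat \<times> nat \<Rightarrow> real" where
  "DN v h x y = (if fst x < k \<and> fst y = fst x then
     sg (fst x) * (((if x = y then 1 else 0) - v (h, x) / R v h (fst x) * (v (h, y) / R v h (fst x))) / R v h (fst x))
     else 0)"

definition D1 :: "(nat \<Rightarrow> real) \<times> nat \<times> nat \<Rightarrow> pt \<Rightarrow> real" where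
  "D1 q v = - p * a * W v powr (a - 1) * exp (- p * Y v (fst q)) * N v (fst q) (snd q)"

text \<open>For distinct vectors only the first summand is present, and its factor
  \<open>a - 1\<close> is negative; this decides the sign of the interpolation. For equal vectors
  the covariance difference that multiplies \<open>D2\<close> is zero.\<close>

definition D2 :: "(nat \<Rightarrow> real) \<times> nat \<times> nat \<Rightarrow> (nat \<Rightarrow> real) \<times> nat \<times> nat \<Rightarrow> pt \<Rightarrow> real" where
  "D2 q q' v = p\<^sup>2 * a * (a - 1) * W v powr (a - 2) * exp (- p * Y v (fst q)) * exp (- p * Y v (fst q')) *
       N v (fst q) (snd q) * N v (fst q') (snd q') +
     (if fst q' = fst q then
        p\<^sup>2 * a * W v powr (a - 1) * exp (- p * Y v (fst q)) * N v (fst q) (snd q) * N v (fst q) (snd q') -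
        p * a * W v powr (a - 1) * exp (- p * Y v (fst q)) * DN v (fst q) (snd q) (snd q') else 0)"

lemma finK: "finite K" by (simp add: K_def)

lemma finI: "finite I" by (simp add: gidx_def)

lemma sum_K: "(\<Sum>x\<in>K. f x) = (\<Sum>i<k. \<Sum>r<m. f (i, r)) + f (k, 0)" for f :: "_ \<Rightarrow> real"
  unfolding K_def by (subst sum.union_disjoint) (auto simp: sum.cartesian_product)

lemma sum_J: "(\<Sum>q\<in>J. f q) = (\<Sum>h\<in>H. \<Sum>x\<in>K. f (h, x))" for f :: "_ \<Rightarrow> real"
  by (simp add: sum.cartesian_product)

lemma R_ge1: "R v h i \<ge> 1"
  unfolding R_def by (auto intro: sum_nonneg)

lemma R_sq: "(R v h i)\<^sup>2 = 1 + (\<Sum>r<m. (v (h, i, r))\<^sup>2)"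
  unfolding R_def by (auto intro!: real_sqrt_pow2 add_nonneg_nonneg sum_nonneg)

lemma W_pos: "W v > 0"
  unfolding W_def using H by (intro sum_pos) auto

lemma exp_le_W: "h \<in> H \<Longrightarrow> exp (- p * Y v h) \<le> W v"
  unfolding W_def using H by (intro member_le_sum[of h H "\<lambda>h. exp (- p * Y v h)"]) auto

lemma quotient_R_le: "r < m \<Longrightarrow> \<bar>v (h, i, r) / R v h i\<bar> \<le> 1"
proof -
  assume r: "r < m"
  have "(v (h, i, r))\<^sup>2 \<le> (\<Sum>r<m. (v (h, i, r))\<^sup>2)"
    using r by (intro member_le_sum) auto
  also have "\<dots> \<le> (R v h i)\<^sup>2" by (simp add: R_sq)
  finally have "\<bar>v (h, i, r)\<bar> \<le> R v h i" using R_ge1[of v h i] by (auto simp: abs_le_square_iff[symmetric])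
  then show ?thesis using R_ge1[of v h i] by (simp add: divide_simps)
qed

lemma N_le: "x \<in> K \<Longrightarrow> \<bar>N v h x\<bar> \<le> sqrt k"
proof -
  assume x: "x \<in> K"
  have 1: "1 \<le> sqrt k" using k by simp
  show ?thesis
  proof (cases "fst x < k")
    case True
    then obtain i r where x': "x = (i, r)" "r < m" using x by (auto simp: K_def)
    have "\<bar>sg i\<bar> * \<bar>v (h, i, r) / R v h i\<bar> \<le> 1 * 1"
      using sg quotient_R_le[OF x'(2)] by (intro mult_mono) auto
    then have "\<bar>N v h x\<bar> \<le> 1" using True x' by (simp add: N_def abs_mult)
    then show ?thesis using 1 by linarith
  qed (simp add: N_def)
qed

lemma DN_le: "x \<in> K \<Longrightarrow> y \<in> K \<Longrightarrow> \<bar>DN v h x y\<bar> \<le> 2"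
proof -
  assume x: "x \<in> K" and y: "y \<in> K"
  show ?thesis
  proof (cases "fst x < k \<and> fst y = fst x")
    case True
    then obtain i r r' where xy: "x = (i, r)" "y = (i, r')" "r < m" "r' < m" "i < k"
      using x y by (auto simp: K_def)
    have R: "R v h i \<ge> 1" by (rule R_ge1)
    define e :: real where "e = (if x = y then 1 else 0)"
    define z where "z = v (h, i, r) / R v h i * (v (h, i, r') / R v h i)"
    define u where "u = e - z"
    have "\<bar>z\<bar> \<le> 1 * 1"
      unfolding z_def abs_mult by (intro mult_mono quotient_R_le xy) auto
    moreover have "0 \<le> e" "e \<le> 1" by (auto simp: e_def)
    ultimately have "\<bar>u\<bar> \<le> 2" unfolding u_def by linarith
    then have "\<bar>u / R v h i\<bar> \<le> 2 / 1"
      unfolding abs_divide using R by (intro frac_le) auto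
    then have "\<bar>sg i\<bar> * \<bar>u / R v h i\<bar> \<le> 1 * 2"
      using sg by (intro mult_mono) auto
    moreover have "DN v h x y = sg i * (u / R v h i)"
      using xy(5) unfolding DN_def u_def z_def e_def xy(1,2) by (simp only: fst_conv if_True simp_thms)
    ultimately show ?thesis by (simp only: abs_mult mult_1)
  next
    case False
    then have "DN v h x y = 0" unfolding DN_def by (simp only: if_False)
    then show ?thesis by simp
  qed
qed

lemma R_deriv:
  assumes "\<And>r. r < m \<Longrightarrow> ((\<lambda>t. c t (h, i, r)) has_real_derivative c' (h, i, r)) (at t)"
  shows "((\<lambda>t. R (c t) h i) has_real_derivative (\<Sum>r<m. c t (h, i, r) / R (c t) h i * c' (h, i, r))) (at t)"
proof -
  have "((\<lambda>t. 1 + (\<Sum>r<m. (c t (h, i, r))\<^sup>2)) has_real_derivative (\<Sum>r<m. 2 * c t (h, i, r) * c' (h, i, r))) (at t)"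
    by (rule derivative_eq_intros refl assms | simp add: mult_ac)+
  note d = this
  have pos: "1 + (\<Sum>r<m. (c t (h, i, r))\<^sup>2) > 0"
    by (intro add_pos_nonneg sum_nonneg) auto
  have "((\<lambda>t. R (c t) h i) has_real_derivative
      inverse (R (c t) h i) / 2 * (\<Sum>r<m. 2 * c t (h, i, r) * c' (h, i, r))) (at t)"
    using DERIV_chain2[OF DERIV_real_sqrt[OF pos] d] unfolding R_def .
  then show ?thesis by (simp add: sum_distrib_left field_simps)
qed

lemma Y_deriv:
  assumes c: "\<And>x. x \<in> K \<Longrightarrow> ((\<lambda>t. c t (h, x)) has_real_derivative c' (h, x)) (at t)"
  shows "((\<lambda>t. Y (c t) h) has_real_derivative (\<Sum>x\<in>K. N (c t) h x * c' (h, x))) (at t)"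
proof -
  have R: "((\<lambda>t. R (c t) h i) has_real_derivative (\<Sum>r<m. c t (h, i, r) / R (c t) h i * c' (h, i, r))) (at t)"
    if "i < k" for i
    using that by (intro R_deriv c) (auto simp: K_def)
  have "((\<lambda>t. Y (c t) h) has_real_derivative
      (\<Sum>i<k. sg i * (\<Sum>r<m. c t (h, i, r) / R (c t) h i * c' (h, i, r))) + sqrt k * c' (h, k, 0)) (at t)"
    unfolding Y_def by (intro DERIV_add DERIV_sum DERIV_cmult R c) (auto simp: K_def)
  then show ?thesis
    by (simp add: sum_K N_def sum_distrib_left mult.assoc)
qed

lemma N_deriv:
  assumes x: "x \<in> K"
    and c: "\<And>x. x \<in> K \<Longrightarrow> ((\<lambda>t. c t (h, x)) has_real_derivative c' (h, x)) (at t)"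
  shows "((\<lambda>t. N (c t) h x) has_real_derivative (\<Sum>y\<in>K. DN (c t) h x y * c' (h, y))) (at t)"
proof (cases "fst x < k")
  case True
  then obtain i r where x': "x = (i, r)" "r < m" "i < k" using x by (auto simp: K_def)
  let ?R = "R (c t) h i"
  have R0: "?R \<noteq> 0" using R_ge1[of "c t" h i] by linarith
  have dR: "((\<lambda>t. R (c t) h i) has_real_derivative (\<Sum>r<m. c t (h, i, r) / ?R * c' (h, i, r))) (at t)"
    using x' by (intro R_deriv c) (auto simp: K_def)
  have Neq: "(\<lambda>t. N (c t) h x) = (\<lambda>t. sg i * (c t (h, x) / R (c t) h i))"
    using x' by (simp add: N_def)
  have "((\<lambda>t. N (c t) h x) has_real_derivative
      sg i * ((c' (h, x) * ?R - c t (h, x) * (\<Sum>r'<m. c t (h, i, r') / ?R * c' (h, i, r'))) / (?R * ?R))) (at t)"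
    unfolding Neq by (intro DERIV_cmult DERIV_divide dR c x R0)
  also have "sg i * ((c' (h, x) * ?R - c t (h, x) * (\<Sum>r'<m. c t (h, i, r') / ?R * c' (h, i, r'))) / (?R * ?R))
      = (\<Sum>r'<m. DN (c t) h x (i, r') * c' (h, i, r'))"
  proof -
    have "(\<Sum>r'<m. DN (c t) h x (i, r') * c' (h, i, r')) =
        (\<Sum>r'<m. sg i / ?R * ((if r' = r then c' (h, i, r') else 0) - c t (h, x) / ?R * (c t (h, i, r') / ?R * c' (h, i, r'))))"
      using x' by (intro sum.cong refl) (auto simp: DN_def algebra_simps divide_simps)
    also have "\<dots> = sg i / ?R * (c' (h, x) - c t (h, x) / ?R * (\<Sum>r'<m. c t (h, i, r') / ?R * c' (h, i, r')))"
      using x' by (simp only: sum_distrib_left[symmetric] sum_subtractf sum.delta finite_lessThan) simp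
    finally show ?thesis using R0 by (simp add: field_simps)
  qed
  also have "\<dots> = (\<Sum>i'<k. if i' = i then (\<Sum>r'<m. DN (c t) h x (i, r') * c' (h, i, r')) else 0)"
    using x' by simp
  also have "\<dots> = (\<Sum>y\<in>K. DN (c t) h x y * c' (h, y))"
  proof -
    have DN0: "DN (c t) h x (i', r') = 0" if "i' \<noteq> i" for i' r'
      using that x' by (simp add: DN_def)
    have "DN (c t) h x (k, 0) = 0" using x' by (intro DN0) auto
    moreover have "(\<Sum>i'<k. if i' = i then (\<Sum>r'<m. DN (c t) h x (i, r') * c' (h, i, r')) else 0) =
        (\<Sum>i'<k. \<Sum>r'<m. DN (c t) h x (i', r') * c' (h, i', r'))"
      by (intro sum.cong refl) (simp add: DN0)
    ultimately show ?thesis by (simp add: sum_K)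
  qed
  finally show ?thesis .
next
  case False
  then show ?thesis by (simp add: N_def DN_def)
qed

lemma W_deriv:
  assumes c: "\<And>q. q \<in> J \<Longrightarrow> ((\<lambda>t. c t q) has_real_derivative c' q) (at t)"
  shows "((\<lambda>t. W (c t)) has_real_derivative
      (\<Sum>q\<in>J. - p * exp (- p * Y (c t) (fst q)) * N (c t) (fst q) (snd q) * c' q)) (at t)"
proof -
  have "((\<lambda>t. W (c t)) has_real_derivative
      (\<Sum>h\<in>H. exp (- p * Y (c t) h) * (- p * (\<Sum>x\<in>K. N (c t) h x * c' (h, x))))) (at t)"
    unfolding W_def by (intro DERIV_sum DERIV_fun_exp DERIV_cmult Y_deriv c) auto
  then show ?thesis by (simp add: sum_J sum_distrib_left mult_ac)
qed

lemma \<Psi>_deriv: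
  assumes c: "\<And>q. q \<in> J \<Longrightarrow> ((\<lambda>t. c t q) has_real_derivative c' q) (at t)"
  shows "((\<lambda>t. \<Psi> (c t)) has_real_derivative (\<Sum>q\<in>J. D1 q (c t) * c' q)) (at t)"
proof -
  have "((\<lambda>t. \<Psi> (c t)) has_real_derivative a * W (c t) powr (a - 1) *
      (\<Sum>q\<in>J. - p * exp (- p * Y (c t) (fst q)) * N (c t) (fst q) (snd q) * c' q)) (at t)"
    unfolding \<Psi>_def using DERIV_fun_powr[where r=a, OF W_deriv[OF c] W_pos] by simp
  then show ?thesis by (simp add: sum_distrib_left D1_def mult_ac)
qed

lemma D1_deriv:
  assumes q: "q \<in> J" and c: "\<And>q. q \<in> J \<Longrightarrow> ((\<lambda>t. c t q) has_real_derivative c' q) (at t)"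
  shows "((\<lambda>t. D1 q (c t)) has_real_derivative (\<Sum>q'\<in>J. D2 q q' (c t) * c' q')) (at t)"
proof -
  obtain h x where qx: "q = (h, x)" "h \<in> H" "x \<in> K" using q by auto
  let ?E = "\<lambda>h. exp (- p * Y (c t) h)" and ?W = "W (c t)"
  have ch: "\<And>x. x \<in> K \<Longrightarrow> ((\<lambda>t. c t (h, x)) has_real_derivative c' (h, x)) (at t)" using c qx by auto
  have "((\<lambda>t. W (c t) powr (a - 1)) has_real_derivative (a - 1) * ?W powr (a - 2) *
      (\<Sum>q\<in>J. - p * ?E (fst q) * N (c t) (fst q) (snd q) * c' q)) (at t)"
    using DERIV_fun_powr[where r="a - 1", OF W_deriv[OF c] W_pos] by simp
  moreover have "((\<lambda>t. exp (- p * Y (c t) h)) has_real_derivative ?E h * (- p * (\<Sum>y\<in>K. N (c t) h y * c' (h, y)))) (at t)"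
    by (intro DERIV_fun_exp DERIV_cmult Y_deriv ch)
  ultimately have "((\<lambda>t. - p * a * (W (c t) powr (a - 1) * exp (- p * Y (c t) h) * N (c t) h x)) has_real_derivative
     - p * a * ((((a - 1) * ?W powr (a - 2) * (\<Sum>q\<in>J. - p * ?E (fst q) * N (c t) (fst q) (snd q) * c' q)) * ?E h
       + (?E h * (- p * (\<Sum>y\<in>K. N (c t) h y * c' (h, y)))) * ?W powr (a - 1)) * N (c t) h x
       + (\<Sum>y\<in>K. DN (c t) h x y * c' (h, y)) * (?W powr (a - 1) * ?E h))) (at t)"
    by (intro DERIV_cmult DERIV_mult N_deriv qx ch)
  also have "(\<lambda>t. - p * a * (W (c t) powr (a - 1) * exp (- p * Y (c t) h) * N (c t) h x)) = (\<lambda>t. D1 q (c t))"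
    by (simp add: D1_def qx mult.assoc)
  also have "- p * a * ((((a - 1) * ?W powr (a - 2) * (\<Sum>q\<in>J. - p * ?E (fst q) * N (c t) (fst q) (snd q) * c' q)) * ?E h
       + (?E h * (- p * (\<Sum>y\<in>K. N (c t) h y * c' (h, y)))) * ?W powr (a - 1)) * N (c t) h x
       + (\<Sum>y\<in>K. DN (c t) h x y * c' (h, y)) * (?W powr (a - 1) * ?E h))
     = (\<Sum>h'\<in>H. \<Sum>y\<in>K. p\<^sup>2 * a * (a - 1) * ?W powr (a - 2) * ?E h * ?E h' * N (c t) h x * N (c t) h' y * c' (h', y))
       + (\<Sum>h'\<in>H. if h' = h then (\<Sum>y\<in>K. (p\<^sup>2 * a * ?W powr (a - 1) * ?E h * N (c t) h x * N (c t) h y -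
            p * a * ?W powr (a - 1) * ?E h * DN (c t) h x y) * c' (h, y)) else 0)"
    using H(1) qx(2)
    by (simp add: sum_J sum_distrib_left sum_distrib_right sum_subtractf sum.distrib algebra_simps power2_eq_square sum_negf)
  also have "\<dots> = (\<Sum>q'\<in>J. D2 q q' (c t) * c' q')"
    unfolding sum_J sum.distrib[symmetric]
    by (intro sum.cong refl) (auto simp: D2_def qx sum.distrib distrib_right)
  finally show ?thesis .
qed

section \<open>Continuity, measurability and growth of the derivatives\<close>

lemma R_cont: "(\<And>x. x \<in> K \<Longrightarrow> isCont (\<lambda>t. c t (h, x)) t) \<Longrightarrow> i < k \<Longrightarrow> isCont (\<lambda>t. R (c t) h i) t"
  unfolding R_def by (intro continuous_intros) (auto simp: K_def)

lemma Y_cont: "(\<And>x. x \<in> K \<Longrightarrow> isCont (\<lambda>t. c t (h, x)) t) \<Longrightarrow> isCont (\<lambda>t. Y (c t) h) t"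
  unfolding Y_def by (intro continuous_intros R_cont) (auto simp: K_def)

lemma W_cont: "(\<And>q. q \<in> J \<Longrightarrow> isCont (\<lambda>t. c t q) t) \<Longrightarrow> isCont (\<lambda>t. W (c t)) t"
  unfolding W_def by (intro continuous_intros Y_cont) auto

lemma R_neq0: "R v h i \<noteq> 0"
  using R_ge1[of v h i] by linarith

lemma N_cont:
  assumes "\<And>x. x \<in> K \<Longrightarrow> isCont (\<lambda>t. c t (h, x)) t" "x \<in> K"
  shows "isCont (\<lambda>t. N (c t) h x) t"
  using assms unfolding N_def
  by (cases "fst x < k") (simp_all only: if_True if_False, (intro continuous_intros R_cont R_neq0; simp)+)

lemma DN_cont:
  assumes "\<And>x. x \<in> K \<Longrightarrow> isCont (\<lambda>t. c t (h, x)) t" "x \<in> K" "y \<in> K"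
  shows "isCont (\<lambda>t. DN (c t) h x y) t"
  using assms unfolding DN_def
  by (cases "fst x < k \<and> fst y = fst x")
    (simp_all only: if_True if_False simp_thms, (intro continuous_intros R_cont R_neq0; simp)+)

lemma D2_cont:
  assumes "q \<in> J" "q' \<in> J" and c: "\<And>q. q \<in> J \<Longrightarrow> isCont (\<lambda>t. c t q) t"
  shows "isCont (\<lambda>t::real. D2 q q' (c t)) t"
proof -
  obtain h x h' x' where q: "q = (h, x)" "q' = (h', x')" "h \<in> H" "h' \<in> H" "x \<in> K" "x' \<in> K"
    using assms by auto
  have *: "\<And>x. x \<in> K \<Longrightarrow> isCont (\<lambda>t. c t (h, x)) t" "\<And>x. x \<in> K \<Longrightarrow> isCont (\<lambda>t. c t (h', x)) t"
    using c q by auto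
  have W: "isCont (\<lambda>t. W (c t) powr b) t" for b
    using W_pos[of "c t"] by (intro continuous_intros W_cont c) auto
  have E: "isCont (\<lambda>t. exp (- p * Y (c t) g)) t" if "g = h \<or> g = h'" for g
    using that * by (intro isCont_exp' isCont_mult continuous_const Y_cont) auto
  have N: "isCont (\<lambda>t. N (c t) g y) t" if "g = h \<or> g = h'" "y = x \<or> y = x'" for g y
    using that * q by (intro N_cont) auto
  have DN: "isCont (\<lambda>t. DN (c t) h x x') t"
    using * q by (intro DN_cont) auto
  show ?thesis
    unfolding D2_def q fst_conv snd_conv
    by (cases "h' = h") (simp_all only: if_True if_False simp_thms,
      (intro isCont_add isCont_diff isCont_mult continuous_const W E N DN; simp)+)
qed

lemma R_meas: "(\<And>x. x \<in> K \<Longrightarrow> (\<lambda>w. c w (h, x)) \<in> borel_measurable M) \<Longrightarrow> i < k \<Longrightarrow> (\<lambda>w. R (c w) h i) \<in> borel_measurable M"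
  unfolding R_def
  by (intro borel_measurable_add borel_measurable_const borel_measurable_sum borel_measurable_power
      measurable_compose[OF _ borel_measurable_sqrt]) (auto simp: K_def)

lemma Y_meas: "(\<And>x. x \<in> K \<Longrightarrow> (\<lambda>w. c w (h, x)) \<in> borel_measurable M) \<Longrightarrow> (\<lambda>w. Y (c w) h) \<in> borel_measurable M"
  unfolding Y_def
  by (intro borel_measurable_add borel_measurable_const borel_measurable_sum borel_measurable_times R_meas) (auto simp: K_def)

lemma E_meas: "(\<And>x. x \<in> K \<Longrightarrow> (\<lambda>w. c w (h, x)) \<in> borel_measurable M) \<Longrightarrow> (\<lambda>w. exp (- p * Y (c w) h)) \<in> borel_measurable M"
  by (intro borel_measurable_const borel_measurable_times measurable_compose[OF _ borel_measurable_exp] Y_meas)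

lemma W_meas: "(\<And>q. q \<in> J \<Longrightarrow> (\<lambda>w. c w q) \<in> borel_measurable M) \<Longrightarrow> (\<lambda>w. W (c w) powr b) \<in> borel_measurable M"
  unfolding W_def by (intro powr_real_measurable borel_measurable_const borel_measurable_sum E_meas) auto

lemma N_meas:
  assumes "\<And>x. x \<in> K \<Longrightarrow> (\<lambda>w. c w (h, x)) \<in> borel_measurable M" "x \<in> K"
  shows "(\<lambda>w. N (c w) h x) \<in> borel_measurable M"
  using assms unfolding N_def
  by (cases "fst x < k") (simp_all only: if_True if_False,
     (intro borel_measurable_const borel_measurable_times borel_measurable_divide R_meas; simp)+)

lemma DN_meas:
  assumes "\<And>x. x \<in> K \<Longrightarrow> (\<lambda>w. c w (h, x)) \<in> borel_measurable M" "x \<in> K" "y \<in> K"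
  shows "(\<lambda>w. DN (c w) h x y) \<in> borel_measurable M"
  using assms unfolding DN_def
  by (cases "fst x < k \<and> fst y = fst x") (simp_all only: if_True if_False simp_thms,
     (intro borel_measurable_const borel_measurable_times borel_measurable_divide borel_measurable_diff R_meas; simp)+)

lemma D1_meas:
  assumes "q \<in> J" and c: "\<And>q. q \<in> J \<Longrightarrow> (\<lambda>w. c w q) \<in> borel_measurable M"
  shows "(\<lambda>w. D1 q (c w)) \<in> borel_measurable M"
  using assms unfolding D1_def
  by (intro borel_measurable_const borel_measurable_times E_meas W_meas N_meas) auto

lemma D2_meas:
  assumes "q \<in> J" "q' \<in> J" and c: "\<And>q. q \<in> J \<Longrightarrow> (\<lambda>w. c w q) \<in> borel_measurable M"
  shows "(\<lambda>w. D2 q q' (c w)) \<in> borel_measurable M"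
proof -
  obtain h x h' x' where q: "q = (h, x)" "q' = (h', x')" "h \<in> H" "h' \<in> H" "x \<in> K" "x' \<in> K"
    using assms by auto
  have *: "\<And>x. x \<in> K \<Longrightarrow> (\<lambda>w. c w (h, x)) \<in> borel_measurable M" "\<And>x. x \<in> K \<Longrightarrow> (\<lambda>w. c w (h', x)) \<in> borel_measurable M"
    using c q by auto
  have E: "(\<lambda>w. exp (- p * Y (c w) g)) \<in> borel_measurable M" if "g = h \<or> g = h'" for g
    using that * by (intro E_meas) auto
  have N: "(\<lambda>w. N (c w) g y) \<in> borel_measurable M" if "g = h \<or> g = h'" "y = x \<or> y = x'" for g y
    using that * q by (intro N_meas) auto
  have DN: "(\<lambda>w. DN (c w) h x x') \<in> borel_measurable M"
    using * q by (intro DN_meas) auto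
  have W: "(\<lambda>w. W (c w) powr b) \<in> borel_measurable M" for b
    by (intro W_meas c)
  show ?thesis
    unfolding D2_def q fst_conv snd_conv
    by (cases "h' = h") (simp_all only: if_True if_False simp_thms,
      (intro borel_measurable_add borel_measurable_diff borel_measurable_times borel_measurable_const W E N DN; simp)+)
qed

lemma Y_bound:
  assumes "h \<in> H"
  shows "\<bar>Y v h\<bar> \<le> k + (1 + sqrt k) * (\<Sum>q\<in>J. \<bar>v q\<bar>)"
proof -
  define T where "T = (\<Sum>x\<in>K. \<bar>v (h, x)\<bar>)"
  have T: "T = (\<Sum>i<k. \<Sum>r<m. \<bar>v (h, i, r)\<bar>) + \<bar>v (h, k, 0)\<bar>" unfolding T_def by (rule sum_K)
  have TS: "T \<le> (\<Sum>q\<in>J. \<bar>v q\<bar>)"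
    unfolding sum_J T_def using assms H
    by (intro member_le_sum[of h H "\<lambda>h. \<Sum>x\<in>K. \<bar>v (h, x)\<bar>"]) (auto intro: sum_nonneg)
  have "\<bar>\<Sum>i<k. sg i * R v h i\<bar> \<le> (\<Sum>i<k. \<bar>sg i\<bar> * \<bar>R v h i\<bar>)"
    using sum_abs[of "\<lambda>i. sg i * R v h i"] by (simp add: abs_mult)
  also have "\<dots> \<le> (\<Sum>i<k. 1 * (1 + (\<Sum>r<m. \<bar>v (h, i, r)\<bar>)))"
    using sg sqrt_one_plus_sum_squares_le[of "\<lambda>r. v (h, _, r)"] R_ge1[of v h]
    by (intro sum_mono mult_mono) (auto simp: R_def abs_of_nonneg sum_nonneg)
  also have "\<dots> \<le> k + T" by (simp add: T sum.distrib)
  finally have 1: "\<bar>\<Sum>i<k. sg i * R v h i\<bar> \<le> k + T" .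
  have "\<bar>v (h, k, 0)\<bar> \<le> T" unfolding T by (simp add: sum_nonneg)
  then have "\<bar>sqrt k * v (h, k, 0)\<bar> \<le> sqrt k * T" by (simp add: abs_mult mult_left_mono)
  with 1 have "\<bar>Y v h\<bar> \<le> k + T + sqrt k * T" unfolding Y_def by linarith
  also have "\<dots> = k + (1 + sqrt k) * T" by (simp add: algebra_simps)
  also have "\<dots> \<le> k + (1 + sqrt k) * (\<Sum>q\<in>J. \<bar>v q\<bar>)"
    using TS by (intro add_left_mono mult_left_mono) auto
  finally show ?thesis .
qed

lemma \<Psi>_bound: "\<Psi> v \<le> (card H powr a * exp (a * p * k)) * exp ((a * p * (1 + sqrt k)) * (\<Sum>q\<in>J. \<bar>v q\<bar>))"
proof -
  let ?b = "k + (1 + sqrt k) * (\<Sum>q\<in>J. \<bar>v q\<bar>)"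
  have "W v \<le> (\<Sum>h\<in>H. exp (p * ?b))"
    unfolding W_def
  proof (rule sum_mono)
    fix h assume "h \<in> H"
    then have "p * - Y v h \<le> p * ?b" using Y_bound[of h v] p by (intro mult_left_mono) auto
    then show "exp (- p * Y v h) \<le> exp (p * ?b)" by simp
  qed
  then have "W v \<le> card H * exp (p * ?b)" by simp
  then have "\<Psi> v \<le> (card H * exp (p * ?b)) powr a"
    unfolding \<Psi>_def using W_pos[of v] a by (intro powr_mono2) auto
  also have "\<dots> = card H powr a * exp (p * ?b * a)"
    by (simp add: powr_mult exp_powr_real)
  also have "exp (p * ?b * a) = exp (a * p * k) * exp ((a * p * (1 + sqrt k)) * (\<Sum>q\<in>J. \<bar>v q\<bar>))"
    by (simp add: exp_add[symmetric] algebra_simps)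
  finally show ?thesis by simp
qed

text \<open>Each exponential is a summand of \<open>W\<close>, so it pays for one missing power of
  \<open>W\<close>. In this way both derivatives of \<Psi> are bounded by a constant times \<Psi>
  itself and inherit its growth.\<close>

lemma W_powr_exp: "h \<in> H \<Longrightarrow> W v powr (a - 1) * exp (- p * Y v h) \<le> \<Psi> v"
proof -
  assume "h \<in> H"
  then have "W v powr (a - 1) * exp (- p * Y v h) \<le> W v powr (a - 1) * W v"
    using exp_le_W by (intro mult_left_mono) auto
  also have "\<dots> = \<Psi> v" using W_pos[of v] by (simp add: \<Psi>_def powr_diff)
  finally show ?thesis .
qed

lemma W_powr_exp_exp: "h \<in> H \<Longrightarrow> h' \<in> H \<Longrightarrow>
  W v powr (a - 2) * exp (- p * Y v h) * exp (- p * Y v h') \<le> \<Psi> v"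
proof -
  assume "h \<in> H" "h' \<in> H"
  then have "W v powr (a - 2) * exp (- p * Y v h) * exp (- p * Y v h') \<le> W v powr (a - 2) * W v * W v"
    using exp_le_W W_pos[of v] by (intro mult_mono) auto
  also have "\<dots> = \<Psi> v" using W_pos[of v] by (simp add: \<Psi>_def powr_diff power2_eq_square)
  finally show ?thesis .
qed

definition "c1 = 1 + p * a * sqrt k + (2 * p\<^sup>2 * a * k + 2 * p * a)"

lemma \<Psi>_pos: "\<Psi> v > 0" unfolding \<Psi>_def using W_pos[of v] by simp

lemma c1_terms: "1 \<le> c1" "p * a * sqrt k \<le> c1" "2 * p\<^sup>2 * a * k + 2 * p * a \<le> c1"
proof -
  have "0 \<le> p * a * sqrt k" "0 \<le> 2 * p\<^sup>2 * a * k" "0 \<le> 2 * p * a" using p a by simp_all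
  then show "1 \<le> c1" "p * a * sqrt k \<le> c1" "2 * p\<^sup>2 * a * k + 2 * p * a \<le> c1"
    unfolding c1_def by linarith+
qed

lemma D1_bound: "q \<in> J \<Longrightarrow> \<bar>D1 q v\<bar> \<le> c1 * \<Psi> v"
proof -
  assume "q \<in> J"
  then obtain h x where q: "q = (h, x)" "h \<in> H" "x \<in> K" by auto
  have "\<bar>D1 q v\<bar> = (p * a) * ((W v powr (a - 1) * exp (- p * Y v h)) * \<bar>N v h x\<bar>)"
    using p a by (simp add: D1_def q abs_mult)
  also have "\<dots> \<le> (p * a) * (\<Psi> v * sqrt k)"
    using p a W_powr_exp[OF q(2)] N_le[OF q(3)] \<Psi>_pos[of v] by (intro mult_left_mono mult_mono) auto
  also have "\<dots> = (p * a * sqrt k) * \<Psi> v" by simp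
  also have "\<dots> \<le> c1 * \<Psi> v" using c1_terms(2) \<Psi>_pos[of v] by (intro mult_right_mono) auto
  finally show ?thesis .
qed

lemma D2_bound: "q \<in> J \<Longrightarrow> q' \<in> J \<Longrightarrow> \<bar>D2 q q' v\<bar> \<le> c1 * \<Psi> v"
proof -
  assume "q \<in> J" "q' \<in> J"
  then obtain h x h' x' where q: "q = (h, x)" "q' = (h', x')" "h \<in> H" "h' \<in> H" "x \<in> K" "x' \<in> K"
    by auto
  let ?E = "\<lambda>h. exp (- p * Y v h)"
  have NN: "\<bar>N v g x\<bar> * \<bar>N v g' x'\<bar> \<le> k" for g g'
  proof -
    have "\<bar>N v g x\<bar> * \<bar>N v g' x'\<bar> \<le> sqrt k * sqrt k" using N_le q by (intro mult_mono) auto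
    then show ?thesis by simp
  qed
  define t1 where "t1 = p\<^sup>2 * a * (a - 1) * W v powr (a - 2) * ?E h * ?E h' * N v h x * N v h' x'"
  define t2 where "t2 = p\<^sup>2 * a * W v powr (a - 1) * ?E h * N v h x * N v h x'"
  define t3 where "t3 = p * a * W v powr (a - 1) * ?E h * DN v h x x'"
  have "\<bar>t1\<bar> = (p\<^sup>2 * a) * (\<bar>a - 1\<bar> * ((W v powr (a - 2) * ?E h * ?E h') * (\<bar>N v h x\<bar> * \<bar>N v h' x'\<bar>)))"
    using p a by (simp add: t1_def abs_mult)
  also have "\<dots> \<le> (p\<^sup>2 * a) * (1 * (\<Psi> v * k))"
    using p a W_powr_exp_exp[OF q(3,4), of v] NN \<Psi>_pos[of v] by (intro mult_left_mono mult_mono) auto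
  finally have 1: "\<bar>t1\<bar> \<le> (p\<^sup>2 * a * k) * \<Psi> v" by (simp add: mult_ac)
  have "\<bar>t2\<bar> = (p\<^sup>2 * a) * ((W v powr (a - 1) * ?E h) * (\<bar>N v h x\<bar> * \<bar>N v h x'\<bar>))"
    using p a by (simp add: t2_def abs_mult)
  also have "\<dots> \<le> (p\<^sup>2 * a) * (\<Psi> v * k)"
    using p a W_powr_exp[OF q(3), of v] NN \<Psi>_pos[of v] by (intro mult_left_mono mult_mono) auto
  finally have 2: "\<bar>t2\<bar> \<le> (p\<^sup>2 * a * k) * \<Psi> v" by (simp add: mult_ac)
  have "\<bar>t3\<bar> = (p * a) * ((W v powr (a - 1) * ?E h) * \<bar>DN v h x x'\<bar>)"
    using p a by (simp add: t3_def abs_mult)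
  also have "\<dots> \<le> (p * a) * (\<Psi> v * 2)"
    using p a W_powr_exp[OF q(3), of v] DN_le[OF q(5,6)] \<Psi>_pos[of v] by (intro mult_left_mono mult_mono) auto
  finally have 3: "\<bar>t3\<bar> \<le> (2 * p * a) * \<Psi> v" by (simp add: mult_ac)
  have "D2 q q' v = t1 + (if h' = h then t2 - t3 else 0)"
    unfolding D2_def q t1_def t2_def t3_def by simp
  then have "\<bar>D2 q q' v\<bar> \<le> \<bar>t1\<bar> + \<bar>t2\<bar> + \<bar>t3\<bar>" by (auto split: if_splits)
  also have "\<dots> \<le> (2 * p\<^sup>2 * a * k + 2 * p * a) * \<Psi> v" using 1 2 3 by (simp add: algebra_simps)
  also have "\<dots> \<le> c1 * \<Psi> v" using c1_terms(3) \<Psi>_pos[of v] by (intro mult_right_mono) auto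
  finally show ?thesis .
qed


section \<open>The two Gaussian processes and their covariances\<close>

text \<open>Each slot owns \<open>n + 1\<close> Gaussian entries. \<open>u h\<close> reads off the
  inner product of \<open>h\<close> with the first \<open>n\<close>, and \<open>e\<close> reads off
  the last. At angle pi/2 a block slot uses \<open>u\<close> (giving a row of the matrix applied to
  \<open>h\<close>) and the scalar slot uses \<open>e\<close>; at angle 0 the roles are
  exchanged.\<close>

definition u :: "(nat \<Rightarrow> real) \<Rightarrow> nat \<Rightarrow> real" where "u h j = (if j < n then h j else 0)"

definition e :: "nat \<Rightarrow> real" where "e j = (if j = n then 1 else 0)"

definition fP :: "(nat \<Rightarrow> real) \<times> nat \<times> nat \<Rightarrow> nat \<Rightarrow> real" where
  "fP q = (if fst (snd q) < k then u (fst q) else e)"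

definition fQ :: "(nat \<Rightarrow> real) \<times> nat \<times> nat \<Rightarrow> nat \<Rightarrow> real" where
  "fQ q = (if fst (snd q) < k then e else u (fst q))"

definition P :: "(nat \<Rightarrow> real) \<times> nat \<times> nat \<Rightarrow> nat \<times> nat \<times> nat \<Rightarrow> real" where
  "P q x = (if (fst x, fst (snd x)) = snd q then fP q (snd (snd x)) else 0)"

definition Q :: "(nat \<Rightarrow> real) \<times> nat \<times> nat \<Rightarrow> nat \<times> nat \<times> nat \<Rightarrow> real" where
  "Q q x = (if (fst x, fst (snd x)) = snd q then fQ q (snd (snd x)) else 0)"

definition L :: "real \<Rightarrow> (nat \<times> nat \<times> nat \<Rightarrow> real) \<Rightarrow> pt" where
  "L \<theta> w = (\<lambda>q. sin \<theta> * (\<Sum>i\<in>I. P q i * w i) + cos \<theta> * (\<Sum>i\<in>I. Q q i * w i))"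

lemma sum_I:
  fixes F :: "nat \<times> nat \<times> nat \<Rightarrow> real"
  assumes "y \<in> K"
  shows "(\<Sum>x\<in>I. if (fst x, fst (snd x)) = y then F x else 0) = (\<Sum>j\<le>n. F (fst y, snd y, j))"
proof -
  have "(\<Sum>x\<in>I. if (fst x, fst (snd x)) = y then F x else 0) = (\<Sum>x\<in>{x\<in>I. (fst x, fst (snd x)) = y}. F x)"
    by (rule sum.inter_filter[symmetric, OF finI])
  also have "{x\<in>I. (fst x, fst (snd x)) = y} = (\<lambda>j. (fst y, snd y, j)) ` {..n}"
    using assms by (auto simp: gidx_def K_def)
  also have "(\<Sum>x\<in>\<dots>. F x) = (\<Sum>j\<le>n. F (fst y, snd y, j))"
    by (subst sum.reindex) (auto simp: inj_on_def)
  finally show ?thesis .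
qed

lemma sum_atMost_n: "(\<Sum>j\<le>n. f j) = (\<Sum>j<n. f j) + f n" for f :: "nat \<Rightarrow> real"
  unfolding lessThan_Suc_atMost[symmetric] by simp

lemma row_products:
  "(\<Sum>j\<le>n. u h j * u h' j) = (\<Sum>j<n. h j * h' j)" "(\<Sum>j\<le>n. e j * e j) = 1"
  "(\<Sum>j\<le>n. u h j * e j) = 0" "(\<Sum>j\<le>n. e j * u h j) = 0"
  by (simp_all add: sum_atMost_n u_def e_def)

lemma linear_rows:
  "(\<Sum>j\<le>n. u h j * f j) = (\<Sum>j<n. h j * f j)" "(\<Sum>j\<le>n. e j * f j) = f n"
  by (simp_all add: sum_atMost_n u_def e_def)

text \<open>Distinct slots own disjoint sets of entries, and within a slot one side reads the first
  \<open>n\<close> entries while the other reads the last. The two processes are thus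
  independent.\<close>

lemma orth: "q \<in> J \<Longrightarrow> q' \<in> J \<Longrightarrow> (\<Sum>i\<in>I. P q i * Q q' i) = 0"
proof -
  assume q: "q \<in> J" "q' \<in> J"
  have "(\<Sum>i\<in>I. P q i * Q q' i) =
      (\<Sum>x\<in>I. if (fst x, fst (snd x)) = snd q then (if snd q = snd q' then fP q (snd (snd x)) * fQ q' (snd (snd x)) else 0) else 0)"
    by (intro sum.cong refl) (auto simp: P_def Q_def)
  also have "\<dots> = 0"
    using q by (subst sum_I; cases "snd q = snd q'") (auto simp: fP_def fQ_def row_products)
  finally show ?thesis .
qed

text \<open>Unit length of \<open>u h\<close> and \<open>e\<close> equalizes the variances, so the
  difference vanishes for equal vectors. The opposite signs in block and scalar slots reflect the
  exchange of roles there.\<close>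

lemma cov:
  assumes q: "q \<in> J" "q' \<in> J"
  shows "(\<Sum>i\<in>I. P q i * P q' i - Q q i * Q q' i) =
    (if snd q = snd q' then (if fst (snd q) < k then -1 else 1) * (1 - (\<Sum>j<n. fst q j * fst q' j)) else 0)"
proof -
  have "(\<Sum>i\<in>I. P q i * P q' i - Q q i * Q q' i) =
      (\<Sum>x\<in>I. if (fst x, fst (snd x)) = snd q then (if snd q = snd q' then
         fP q (snd (snd x)) * fP q' (snd (snd x)) - fQ q (snd (snd x)) * fQ q' (snd (snd x)) else 0) else 0)"
    by (intro sum.cong refl) (auto simp: P_def Q_def)
  also have "\<dots> = (if snd q = snd q' then (\<Sum>j\<le>n. fP q j * fP q' j) - (\<Sum>j\<le>n. fQ q j * fQ q' j) else 0)"
    using q by (subst sum_I) (auto simp: sum_subtractf)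
  also have "\<dots> = (if snd q = snd q' then (if fst (snd q) < k then -1 else 1) * (1 - (\<Sum>j<n. fst q j * fst q' j)) else 0)"
    by (auto simp: fP_def fQ_def row_products)
  finally show ?thesis .
qed

lemma L_half_pi: "h \<in> H \<Longrightarrow> i < k \<Longrightarrow> r < m \<Longrightarrow> L (pi/2) w (h, i, r) = blk_mul n w i h r"
  "h \<in> H \<Longrightarrow> L (pi/2) w (h, k, 0) = w (k, 0, n)"
  and L_zero: "h \<in> H \<Longrightarrow> i < k \<Longrightarrow> r < m \<Longrightarrow> L 0 w (h, i, r) = w (i, r, n)"
  "h \<in> H \<Longrightarrow> L 0 w (h, k, 0) = (\<Sum>j<n. h j * w (k, 0, j))"
proof -
  have lin: "(\<Sum>x\<in>I. P q x * w x) = (\<Sum>j\<le>n. fP q j * w (fst (snd q), snd (snd q), j))"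
     "(\<Sum>x\<in>I. Q q x * w x) = (\<Sum>j\<le>n. fQ q j * w (fst (snd q), snd (snd q), j))" if "snd q \<in> K" for q
  proof -
    have "(\<Sum>x\<in>I. P q x * w x) = (\<Sum>x\<in>I. if (fst x, fst (snd x)) = snd q then fP q (snd (snd x)) * w x else 0)"
      by (intro sum.cong refl) (auto simp: P_def)
    then show "(\<Sum>x\<in>I. P q x * w x) = (\<Sum>j\<le>n. fP q j * w (fst (snd q), snd (snd q), j))"
      using that by (simp add: sum_I)
    have "(\<Sum>x\<in>I. Q q x * w x) = (\<Sum>x\<in>I. if (fst x, fst (snd x)) = snd q then fQ q (snd (snd x)) * w x else 0)"
      by (intro sum.cong refl) (auto simp: Q_def)
    then show "(\<Sum>x\<in>I. Q q x * w x) = (\<Sum>j\<le>n. fQ q j * w (fst (snd q), snd (snd q), j))"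
      using that by (simp add: sum_I)
  qed
  have blk: "blk_mul n w i h r = (\<Sum>j<n. h j * w (i, r, j))" for i h r
    by (simp add: blk_mul_def mult.commute)
  have K: "(k, 0) \<in> K" "i < k \<Longrightarrow> r < m \<Longrightarrow> (i, r) \<in> K" for i r by (auto simp: K_def)
  show "h \<in> H \<Longrightarrow> i < k \<Longrightarrow> r < m \<Longrightarrow> L (pi/2) w (h, i, r) = blk_mul n w i h r"
    "h \<in> H \<Longrightarrow> L (pi/2) w (h, k, 0) = w (k, 0, n)"
    "h \<in> H \<Longrightarrow> i < k \<Longrightarrow> r < m \<Longrightarrow> L 0 w (h, i, r) = w (i, r, n)"
    "h \<in> H \<Longrightarrow> L 0 w (h, k, 0) = (\<Sum>j<n. h j * w (k, 0, j))"
    by (simp_all add: L_def lin K fP_def fQ_def linear_rows blk)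
qed

section \<open>Monotonicity along the rotation\<close>

lemma inner_le_1: "h \<in> H \<Longrightarrow> h' \<in> H \<Longrightarrow> (\<Sum>j<n. h j * h' j) \<le> 1"
proof -
  assume h: "h \<in> H" "h' \<in> H"
  have "(\<Sum>j<n. h j * h' j) \<le> (\<Sum>j<n. ((h j)\<^sup>2 + (h' j)\<^sup>2) / 2)"
    by (intro sum_mono mult_le_mean_squares)
  also have "\<dots> = 1" using unit[OF h(1)] unit[OF h(2)]
    by (simp add: sum_divide_distrib[symmetric] sum.distrib)
  finally show ?thesis .
qed

text \<open>In each block the gradient has norm at most one: the sign factor is bounded by 1 and the
  1 under the root only shrinks the quotient. The total is compared with the
  \<open>k = sqrt k * sqrt k\<close> of the scalar slot, which explains the weight
  \<open>sqrt k\<close> in \<open>Y\<close>.\<close>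

lemma sum_N_le: "(\<Sum>i<k. \<Sum>r<m. N v h (i, r) * N v h' (i, r)) \<le> k"
proof -
  have sq: "(\<Sum>r<m. (N v h (i, r))\<^sup>2) \<le> 1" if "i < k" for i h
  proof -
    have R: "(R v h i)\<^sup>2 > 0" using R_ge1[of v h i] by auto
    have "(\<Sum>r<m. (N v h (i, r))\<^sup>2) = (sg i)\<^sup>2 * ((\<Sum>r<m. (v (h, i, r))\<^sup>2) / (R v h i)\<^sup>2)"
      using that by (simp add: N_def power_mult_distrib power_divide sum_distrib_left sum_divide_distrib)
    also have "\<dots> \<le> 1 * 1"
    proof (intro mult_mono)
      show "(sg i)\<^sup>2 \<le> 1" using sg[of i] by (simp add: abs_square_le_1)
      show "(\<Sum>r<m. (v (h, i, r))\<^sup>2) / (R v h i)\<^sup>2 \<le> 1"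
        using R by (simp add: divide_le_eq) (simp add: R_sq)
    qed (auto intro!: divide_nonneg_nonneg sum_nonneg)
    finally show ?thesis by simp
  qed
  have "(\<Sum>i<k. \<Sum>r<m. N v h (i, r) * N v h' (i, r)) \<le> (\<Sum>i<k. 1)"
  proof (rule sum_mono)
    fix i assume i: "i \<in> {..<k}"
    have "(\<Sum>r<m. N v h (i, r) * N v h' (i, r)) \<le> (\<Sum>r<m. ((N v h (i, r))\<^sup>2 + (N v h' (i, r))\<^sup>2) / 2)"
      by (intro sum_mono mult_le_mean_squares)
    also have "\<dots> \<le> 1" using sq[of i h] sq[of i h'] i
      by (simp add: sum_divide_distrib[symmetric] sum.distrib)
    finally show "(\<Sum>r<m. N v h (i, r) * N v h' (i, r)) \<le> 1" .
  qed
  then show ?thesis by simp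
qed

text \<open>The Gaussian processes at \<open>h\<close> and \<open>h'\<close> interact through
  \<open>1 - \<langle>h, h'\<rangle>\<close> times this quantity, whose sign makes the interpolation monotone.\<close>

lemma signed_D2_nonpos:
  assumes "h \<noteq> h'"
  shows "(\<Sum>x\<in>K. (if fst x < k then -1 else 1) * D2 (h, x) (h', x) v) \<le> 0"
proof -
  define c where "c = p\<^sup>2 * a * (a - 1) * W v powr (a - 2) * exp (- p * Y v h) * exp (- p * Y v h')"
  have c: "c \<le> 0" unfolding c_def using p a
    by (intro mult_nonpos_nonneg mult_nonneg_nonpos) auto
  have D: "D2 (h, x) (h', x) v = c * (N v h x * N v h' x)" for x
    using assms by (simp add: D2_def c_def)
  have "(\<Sum>x\<in>K. (if fst x < k then -1 else 1) * D2 (h, x) (h', x) v) =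
      c * (k - (\<Sum>i<k. \<Sum>r<m. N v h (i, r) * N v h' (i, r)))"
    unfolding sum_K D by (simp add: N_def[of _ _ "(k, 0)"] sum_distrib_left sum_negf algebra_simps)
  also have "\<dots> \<le> 0" using c sum_N_le[of v h h'] by (intro mult_nonpos_nonneg) auto
  finally show ?thesis .
qed

abbreviation "G \<equiv> PiM I (\<lambda>_. std_gauss)"

text \<open>The derivative in the angle is a sum over pairs of vectors of three factors:
  \<open>sin \<theta> * cos \<theta>\<close> and \<open>1 - \<langle>h, h'\<rangle>\<close>, both
  nonnegative, and a signed sum of second derivatives, nonpositive for distinct vectors.\<close>

lemma interpolation_le:
  shows "\<And>\<theta>. integrable G (\<lambda>w. \<Psi> (L \<theta> w))"
    and "(\<integral>w. \<Psi> (L (pi/2) w) \<partial>G) \<le> (\<integral>w. \<Psi> (L 0 w) \<partial>G)"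
proof -
  let ?C = "c1 * (card H powr a * exp (a * p * k))" and ?B = "a * p * (1 + sqrt k)"
  have \<Psi>b: "c1 * \<Psi> v \<le> ?C * exp (?B * (\<Sum>q\<in>J. \<bar>v q\<bar>))" for v
    using mult_left_mono[OF \<Psi>_bound[of v], of c1] c1_terms(1) by (simp add: mult.assoc)
  have \<Psi>1: "\<bar>\<Psi> v\<bar> \<le> c1 * \<Psi> v" for v
    using mult_right_mono[OF c1_terms(1), of "\<Psi> v"] \<Psi>_pos[of v] by simp
  have B: "?B \<ge> 0" using a p by simp
  have fJ: "finite J" using H finK by simp
  have m0: "(\<lambda>w. \<Psi> (c w)) \<in> borel_measurable G" if "\<And>q. q \<in> J \<Longrightarrow> (\<lambda>w. c w q) \<in> borel_measurable G" for c
    unfolding \<Psi>_def by (rule W_meas) (rule that)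
  note int = gauss_interpolation_has_derivative[where \<Psi>=\<Psi> and ?D1.0=D1 and ?D2.0=D2 and P=P and Q=Q and I=I and J=J
      and C="?C" and B="?B", OF finI fJ B orth \<Psi>_deriv D1_deriv D2_cont m0 D1_meas D2_meas
      order_trans[OF \<Psi>1 \<Psi>b] order_trans[OF D1_bound \<Psi>b] order_trans[OF D2_bound \<Psi>b], folded L_def]
  show "integrable G (\<lambda>w. \<Psi> (L \<theta> w))" for \<theta> by (rule int(1))
  show "(\<integral>w. \<Psi> (L (pi/2) w) \<partial>G) \<le> (\<integral>w. \<Psi> (L 0 w) \<partial>G)"
  proof (rule DERIV_nonpos_imp_nonincreasing[of 0 "pi/2" "\<lambda>\<theta>. \<integral>w. \<Psi> (L \<theta> w) \<partial>G"])
    fix \<theta> :: real assume \<theta>: "0 \<le> \<theta>" "\<theta> \<le> pi/2"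
    let ?s = "\<lambda>x::nat\<times>nat. if fst x < k then -1 else 1 :: real"
    have sc: "sin \<theta> * cos \<theta> \<ge> 0" using \<theta> by (intro mult_nonneg_nonneg sin_ge_zero cos_ge_zero) auto
    \<comment> \<open>Only pairs sharing a slot are correlated, so the double sum over
      \<open>J\<close> collapses to pairs of vectors with one common slot.\<close>
    have "(\<Sum>q\<in>J. \<Sum>q'\<in>J. sin \<theta> * cos \<theta> * (\<Sum>i\<in>I. P q i * P q' i - Q q i * Q q' i) * (\<integral>w. D2 q q' (L \<theta> w) \<partial>G))
      = (\<Sum>h\<in>H. \<Sum>x\<in>K. \<Sum>h'\<in>H. \<Sum>y\<in>K. if y = x then
           sin \<theta> * cos \<theta> * (1 - (\<Sum>j<n. h j * h' j)) * (?s x * (\<integral>w. D2 (h, x) (h', x) (L \<theta> w) \<partial>G)) else 0)"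
      unfolding sum_J
    proof (intro sum.cong refl)
      fix h h' x y assume "h \<in> H" "x \<in> K" "h' \<in> H" "y \<in> K"
      then have q: "(h, x) \<in> J" "(h', y) \<in> J" by auto
      show "sin \<theta> * cos \<theta> * (\<Sum>i\<in>I. P (h, x) i * P (h', y) i - Q (h, x) i * Q (h', y) i) * (\<integral>w. D2 (h, x) (h', y) (L \<theta> w) \<partial>G)
        = (if y = x then sin \<theta> * cos \<theta> * (1 - (\<Sum>j<n. h j * h' j)) * (?s x * (\<integral>w. D2 (h, x) (h', x) (L \<theta> w) \<partial>G)) else 0)"
        unfolding cov[OF q] eq_commute[of x y] snd_conv fst_conv by (cases "y = x") (simp_all only: fst_conv snd_conv if_True if_False simp_thms mult_ac mult_zero_left mult_zero_right)
    qed
    also have "\<dots> = (\<Sum>h\<in>H. \<Sum>x\<in>K. \<Sum>h'\<in>H.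
           sin \<theta> * cos \<theta> * (1 - (\<Sum>j<n. h j * h' j)) * (?s x * (\<integral>w. D2 (h, x) (h', x) (L \<theta> w) \<partial>G)))"
      using finK by (intro sum.cong refl) (simp add: sum.delta)
    also have "\<dots> = (\<Sum>h\<in>H. \<Sum>h'\<in>H.
           sin \<theta> * cos \<theta> * (1 - (\<Sum>j<n. h j * h' j)) * (\<Sum>x\<in>K. ?s x * (\<integral>w. D2 (h, x) (h', x) (L \<theta> w) \<partial>G)))"
      unfolding sum_distrib_left by (intro sum.cong refl sum.swap)
    also have "\<dots> \<le> 0"
    proof (intro sum_nonpos)
      fix h h' assume h: "h \<in> H" "h' \<in> H"
      show "sin \<theta> * cos \<theta> * (1 - (\<Sum>j<n. h j * h' j)) * (\<Sum>x\<in>K. ?s x * (\<integral>w. D2 (h, x) (h', x) (L \<theta> w) \<partial>G)) \<le> 0"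
      \<comment> \<open>On the diagonal \<open>1 - \<langle>h, h\<rangle> = 0\<close>, so no sign
        information on the second derivatives is required there.\<close>
      proof (cases "h = h'")
        case True
        then show ?thesis using unit[OF h(1)] by (simp add: power2_eq_square)
      next
        case False
        have "(\<Sum>x\<in>K. ?s x * (\<integral>w. D2 (h, x) (h', x) (L \<theta> w) \<partial>G)) =
            (\<integral>w. (\<Sum>x\<in>K. ?s x * D2 (h, x) (h', x) (L \<theta> w)) \<partial>G)"
        proof (subst Bochner_Integration.integral_sum)
          show "integrable G (\<lambda>w. ?s x * D2 (h, x) (h', x) (L \<theta> w))" if "x \<in> K" for x
            using that h by (intro integrable_mult_right int(2)) auto
        qed (simp only: integral_mult_right_zero)
        also have "\<dots> \<le> 0"
        proof -
          have "0 \<le> (\<integral>w. - (\<Sum>x\<in>K. ?s x * D2 (h, x) (h', x) (L \<theta> w)) \<partial>G)"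
            using signed_D2_nonpos[OF False] by (intro Bochner_Integration.integral_nonneg) (simp only: neg_0_le_iff_le)
          then show ?thesis unfolding integral_minus by (simp only: neg_0_le_iff_le)
        qed
        finally show ?thesis
          using inner_le_1[OF h] by (intro mult_nonneg_nonpos mult_nonneg_nonneg[OF sc]) auto
      qed
    qed
    finally show "\<exists>y. ((\<lambda>\<theta>. \<integral>w. \<Psi> (L \<theta> w) \<partial>G) has_real_derivative y) (at \<theta>) \<and> y \<le> 0"
      using int(3) by blast
  qed simp
qed

end

section \<open>From the comparison to a probability bound\<close>

text \<open>Independence from entry \<open>i\<close> is expressed as invariance under updates at
  \<open>i\<close>. This serves to split off the scalar Gaussian that was added to the matrix
  process.\<close>

lemma gauss_prod_integral_indep:
  fixes f :: "('i \<Rightarrow> real) \<Rightarrow> real" and g :: "real \<Rightarrow> real"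
  assumes I: "finite I" "i \<in> I"
    and f: "integrable (PiM I (\<lambda>_. std_gauss)) f"
    and fg: "integrable (PiM I (\<lambda>_. std_gauss)) (\<lambda>w. f w * g (w i))"
    and upd: "\<And>w y. f (w(i := y)) = f w"
  shows "(\<integral>w. f w * g (w i) \<partial>PiM I (\<lambda>_. std_gauss)) =
    (\<integral>w. f w \<partial>PiM I (\<lambda>_. std_gauss)) * (\<integral>y. g y \<partial>std_gauss)"
proof -
  have I': "I = insert i (I - {i})" "finite (I - {i})" "i \<notin> I - {i}" using I by auto
  have 1: "(\<integral>w. f w * g (w i) \<partial>PiM I (\<lambda>_. std_gauss)) = (\<integral>w. f w * (\<integral>y. g y \<partial>std_gauss) \<partial>PiM (I - {i}) (\<lambda>_. std_gauss))"
    using fg by (subst (1 2) I'(1)) (subst gauss_prod.product_integral_insert[OF I'(2,3)], simp_all add: upd insert_absorb I)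
  have 2: "(\<integral>w. f w \<partial>PiM I (\<lambda>_. std_gauss)) = (\<integral>w. f w \<partial>PiM (I - {i}) (\<lambda>_. std_gauss))"
    using f by (subst I'(1)) (subst gauss_prod.product_integral_insert[OF I'(2,3)],
      simp_all add: upd insert_absorb I std_gauss.prob_space[simplified])
  show ?thesis unfolding 1 2 by simp
qed

lemma gauss_prod_marginal:
  assumes "J \<subseteq> I" "finite I" "{A \<in> space (PiM J (\<lambda>_. std_gauss)). P A} \<in> sets (PiM J (\<lambda>_. std_gauss))"
    and restr: "\<And>w. P (restrict w J) = P w"
  shows "measure (PiM J (\<lambda>_. std_gauss)) {A \<in> space (PiM J (\<lambda>_. std_gauss)). P A} =
    measure (PiM I (\<lambda>_. std_gauss)) {w \<in> space (PiM I (\<lambda>_. std_gauss)). P w}"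
proof -
  interpret product_prob_space "\<lambda>_. std_gauss" I by unfold_locales
  have d: "distr (PiM I (\<lambda>_. std_gauss)) (PiM J (\<lambda>_. std_gauss)) (\<lambda>w. restrict w J) = PiM J (\<lambda>_. std_gauss)"
    using distr_restrict[OF assms(1,2)] by simp
  have "measure (distr (PiM I (\<lambda>_. std_gauss)) (PiM J (\<lambda>_. std_gauss)) (\<lambda>w. restrict w J)) {A \<in> space (PiM J (\<lambda>_. std_gauss)). P A}
    = measure (PiM I (\<lambda>_. std_gauss)) ((\<lambda>w. restrict w J) -` {A \<in> space (PiM J (\<lambda>_. std_gauss)). P A} \<inter> space (PiM I (\<lambda>_. std_gauss)))"
    by (rule measure_distr[OF measurable_restrict_subset[OF assms(1)] assms(3)])
  also have "(\<lambda>w. restrict w J) -` {A \<in> space (PiM J (\<lambda>_. std_gauss)). P A} \<inter> space (PiM I (\<lambda>_. std_gauss)) =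
     {w \<in> space (PiM I (\<lambda>_. std_gauss)). P w}"
    using restr by (auto simp: space_PiM)
  finally show ?thesis unfolding d .
qed

text \<open>For signs +1 on \<open>S\<close> and -1 elsewhere, this is the overview's
  \<open>F\<^sub>S\<close> with smoothed block norms.\<close>

definition smooth_gap :: "nat \<Rightarrow> nat \<Rightarrow> (nat \<Rightarrow> real) \<Rightarrow> (nat \<Rightarrow> nat \<Rightarrow> real) \<Rightarrow> real" where
  "smooth_gap k m sg z = (\<Sum>i<k. sg i * sqrt (1 + (\<Sum>r<m. (z i r)\<^sup>2)))"

lemma smooth_gap_cong:
  "(\<And>i r. i < k \<Longrightarrow> r < m \<Longrightarrow> z i r = z' i r) \<Longrightarrow> smooth_gap k m sg z = smooth_gap k m sg z'"
  unfolding smooth_gap_def by (intro sum.cong refl arg_cong2[where f="(*)"] arg_cong[where f=sqrt] arg_cong2[where f="(+)"]) auto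

lemma smooth_gap_measurable:
  assumes "\<And>i r. i < k \<Longrightarrow> r < m \<Longrightarrow> (\<lambda>w. z w i r) \<in> borel_measurable M"
  shows "(\<lambda>w. smooth_gap k m sg (z w)) \<in> borel_measurable M"
  unfolding smooth_gap_def using assms
  by (intro borel_measurable_add borel_measurable_const borel_measurable_sum borel_measurable_times borel_measurable_power
      measurable_compose[OF _ borel_measurable_sqrt]) auto

text \<open>The decoupled end of the comparison, with the maximum of
  \<open>- \<langle>g, h\<rangle>\<close> over unit vectors bounded by the norm of \<open>g\<close>.
  Entries \<open>(i, r, n)\<close> form the block vector and entries \<open>(k, 0, j)\<close> form
  \<open>g\<close>; no \<open>h\<close> is left.\<close>

definition gordon_moment :: "nat \<Rightarrow> nat \<Rightarrow> nat \<Rightarrow> (nat \<Rightarrow> real) \<Rightarrow> real \<Rightarrow> real" where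
  "gordon_moment k m n sg l = (\<integral>w. exp (- l * smooth_gap k m sg (\<lambda>i r. w (i, r, n)) +
     l * sqrt k * sqrt (\<Sum>j<n. (w (k, 0, j))\<^sup>2)) \<partial>PiM (gidx k m n) (\<lambda>_. std_gauss))"

lemma finite_gidx: "finite (gidx k m n)" by (simp add: gidx_def)

lemma component_measurable_gidx:
  assumes "x \<in> gidx k m n"
  shows "(\<lambda>w. w x) \<in> borel_measurable (PiM (gidx k m n) (\<lambda>_. std_gauss))"
  using measurable_component_singleton[OF assms, of "\<lambda>_. std_gauss"] by (simp cong: measurable_cong_sets)

lemma integrable_gordon_moment:
  assumes sg: "\<And>i. \<bar>sg i\<bar> \<le> 1" and l: "l > 0"
  shows "integrable (PiM (gidx k m n) (\<lambda>_. std_gauss)) (\<lambda>w. exp (- l * smooth_gap k m sg (\<lambda>i r. w (i, r, n)) +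
     l * sqrt k * sqrt (\<Sum>j<n. (w (k, 0, j))\<^sup>2)))" (is "integrable ?G ?f")
proof (rule Bochner_Integration.integrable_bound)
  let ?S = "\<lambda>w. \<Sum>x\<in>gidx k m n. \<bar>w x\<bar>"
  show "integrable ?G (\<lambda>w. exp (l * k) * exp ((l * (k + sqrt k)) * ?S w))"
    by (intro integrable_mult_right integrable_gauss_prod_exp_abs finite_gidx)
  have inI: "\<And>i r. i < k \<Longrightarrow> r < m \<Longrightarrow> (i, r, n) \<in> gidx k m n" "\<And>j. j < n \<Longrightarrow> (k, 0, j) \<in> gidx k m n"
    by (auto simp: gidx_def)
  have 1: "(\<lambda>w. smooth_gap k m sg (\<lambda>i r. w (i, r, n))) \<in> borel_measurable ?G"
    by (intro smooth_gap_measurable component_measurable_gidx inI)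
  have 2: "(\<lambda>w. sqrt (\<Sum>j<n. (w (k, 0, j))\<^sup>2)) \<in> borel_measurable ?G"
    by (intro borel_measurable_sum borel_measurable_power measurable_compose[OF _ borel_measurable_sqrt]
        component_measurable_gidx inI) auto
  show "?f \<in> borel_measurable ?G"
    using 1 2 by measurable
  show "AE w in ?G. norm (?f w) \<le> norm (exp (l * k) * exp ((l * (k + sqrt k)) * ?S w))"
  proof (rule AE_I2)
    fix w :: "nat \<times> nat \<times> nat \<Rightarrow> real"
    have sub: "(\<Sum>x\<in>X. \<bar>w x\<bar>) \<le> ?S w" if "X \<subseteq> gidx k m n" for X
      using that by (intro sum_mono2 finite_gidx) auto
    have g: "sqrt (\<Sum>j<n. (w (k, 0, j))\<^sup>2) \<le> ?S w"
    proof -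
      have "sqrt (\<Sum>j<n. (w (k, 0, j))\<^sup>2) \<le> (\<Sum>j<n. \<bar>w (k, 0, j)\<bar>)"
        using L2_set_le_sum_abs[of "\<lambda>j. w (k, 0, j)" "{..<n}"] by (simp add: L2_set_def)
      also have "\<dots> = (\<Sum>x\<in>(\<lambda>j. (k, 0, j)) ` {..<n}. \<bar>w x\<bar>)"
        by (subst sum.reindex) (auto simp: inj_on_def)
      also have "\<dots> \<le> ?S w" using inI by (intro sub) auto
      finally show ?thesis .
    qed
    have F: "- smooth_gap k m sg (\<lambda>i r. w (i, r, n)) \<le> k * (1 + ?S w)"
    proof -
      have "- smooth_gap k m sg (\<lambda>i r. w (i, r, n)) \<le> (\<Sum>i<k. 1 + ?S w)"
        unfolding smooth_gap_def sum_negf[symmetric]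
      proof (rule sum_mono)
        fix i assume i: "i \<in> {..<k}"
        let ?q = "sqrt (1 + (\<Sum>r<m. (w (i, r, n))\<^sup>2))"
        have q0: "?q \<ge> 0" by (auto intro!: add_nonneg_nonneg sum_nonneg)
        have "- (sg i * ?q) = (- sg i) * ?q" by simp
        also have "\<dots> \<le> 1 * ?q" using sg[of i] q0 by (intro mult_right_mono) auto
        also have "1 * ?q \<le> 1 + (\<Sum>r<m. \<bar>w (i, r, n)\<bar>)" using sqrt_one_plus_sum_squares_le[of "\<lambda>r. w (i, r, n)" "{..<m}"] by simp
        also have "(\<Sum>r<m. \<bar>w (i, r, n)\<bar>) = (\<Sum>x\<in>(\<lambda>r. (i, r, n)) ` {..<m}. \<bar>w x\<bar>)"
          by (subst sum.reindex) (auto simp: inj_on_def)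
        also have "\<dots> \<le> ?S w" using inI i by (intro sub) auto
        finally show "- (sg i * ?q) \<le> 1 + ?S w" by simp
      qed
      then show ?thesis by simp
    qed
    have "- l * smooth_gap k m sg (\<lambda>i r. w (i, r, n)) + l * sqrt k * sqrt (\<Sum>j<n. (w (k, 0, j))\<^sup>2)
      = l * (- smooth_gap k m sg (\<lambda>i r. w (i, r, n)) + sqrt k * sqrt (\<Sum>j<n. (w (k, 0, j))\<^sup>2))"
      by (simp add: algebra_simps)
    also have "\<dots> \<le> l * (k * (1 + ?S w) + sqrt k * ?S w)"
      using F g l by (intro mult_left_mono add_mono) auto
    also have "\<dots> = l * k + (l * (k + sqrt k)) * ?S w" by (simp add: algebra_simps)
    finally show "norm (?f w) \<le> norm (exp (l * k) * exp ((l * (k + sqrt k)) * ?S w))"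
      by (simp add: exp_add[symmetric])
  qed
qed

lemma blk_mul_measurable:
  assumes "\<And>j. j < n \<Longrightarrow> (i, r, j) \<in> I"
  shows "(\<lambda>w. blk_mul n w i h r) \<in> borel_measurable (PiM I (\<lambda>_. std_gauss))"
  unfolding blk_mul_def
proof (intro borel_measurable_sum borel_measurable_times borel_measurable_const)
  fix j assume "j \<in> {..<n}"
  then show "(\<lambda>w. w (i, r, j)) \<in> borel_measurable (PiM I (\<lambda>_. std_gauss))"
    using measurable_component_singleton[OF assms, of j "\<lambda>_. std_gauss"] by (simp cong: measurable_cong_sets)
qed

text \<open>An exponential Markov inequality: on the event some \<open>h\<close> makes the process
  at angle pi/2 at most \<open>c\<close> plus the scalar term, which bounds \<Psi> from below. The
  right side does not mention \<open>H\<close>, which later permits the passage to infinitely many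
  vectors.\<close>

lemma gordon_prob_finite:
  assumes sg: "\<And>i. \<bar>sg i\<bar> \<le> 1" and l: "l > 0" and k: "k > 0" and H: "finite H" "H \<noteq> {}"
    and unit: "\<And>h. h \<in> H \<Longrightarrow> (\<Sum>j<n. (h j)\<^sup>2) = 1"
  shows "measure (gauss_blocks k m n) {A \<in> space (gauss_blocks k m n). \<exists>h\<in>H. smooth_gap k m sg (\<lambda>i r. blk_mul n A i h r) \<le> c}
    \<le> exp (l * c - l\<^sup>2 * k / 2) * gordon_moment k m n sg l"
proof -
  let ?G = "PiM (gidx k m n) (\<lambda>_. std_gauss)"
  interpret G: prob_space ?G by (intro prob_space_PiM prob_space_std_gauss)
  define ev where "ev A \<longleftrightarrow> (\<exists>h\<in>H. smooth_gap k m sg (\<lambda>i r. blk_mul n A i h r) \<le> c)" for A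
  have ev_sets: "{A \<in> space (PiM I (\<lambda>_. std_gauss)). ev A} \<in> sets (PiM I (\<lambda>_. std_gauss))"
    if "{..<k} \<times> {..<m} \<times> {..<n} \<subseteq> I" for I
  proof -
    have [measurable]: "(\<lambda>A. smooth_gap k m sg (\<lambda>i r. blk_mul n A i h r)) \<in> borel_measurable (PiM I (\<lambda>_. std_gauss))" for h
      using that by (intro smooth_gap_measurable blk_mul_measurable) auto
    show ?thesis unfolding ev_def using H(1) by measurable
  qed
  have sub: "{..<k} \<times> {..<m} \<times> {..<n} \<subseteq> gidx k m n" by (auto simp: gidx_def)
  define p0 where "p0 = measure ?G {w \<in> space ?G. ev w}"
  have marg: "measure (gauss_blocks k m n) {A \<in> space (gauss_blocks k m n). ev A} = p0"
    unfolding p0_def gauss_blocks_def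
  proof (rule gauss_prod_marginal[OF sub finite_gidx ev_sets[OF subset_refl]])
    fix w :: "nat \<times> nat \<times> nat \<Rightarrow> real"
    have "smooth_gap k m sg (\<lambda>i r. blk_mul n (restrict w ({..<k} \<times> {..<m} \<times> {..<n})) i h r) =
        smooth_gap k m sg (\<lambda>i r. blk_mul n w i h r)" for h
      by (rule smooth_gap_cong) (auto simp: blk_mul_def)
    then show "ev (restrict w ({..<k} \<times> {..<m} \<times> {..<n})) = ev w" by (simp add: ev_def)
  qed
  define f where "f w = (if ev w then 1 else 0 :: real)" for w
  have fm: "f \<in> borel_measurable ?G"
    unfolding f_def using ev_sets[OF sub] by (intro measurable_If borel_measurable_const)
  have fint: "integrable ?G f"
    by (rule G.integrable_const_bound[where B=1]) (auto simp: f_def intro: fm)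
  have p0: "p0 = (\<integral>w. f w \<partial>?G)"
  proof -
    have "(\<integral>w. f w \<partial>?G) = (\<integral>w. indicator {w \<in> space ?G. ev w} w \<partial>?G)"
      by (intro Bochner_Integration.integral_cong) (auto simp: f_def)
    then show ?thesis using ev_sets[OF sub] by (simp add: p0_def)
  qed
  have main: "p0 * exp (l\<^sup>2 * k / 2) \<le> exp (l * c) * (card H powr a * gordon_moment k m n sg l)" if a: "0 < a" "a < 1" for a
  proof -
    \<comment> \<open>The choice \<open>p = l / a\<close> keeps \<open>p * a = l\<close>, so both
      ends carry the exponent \<open>l\<close> for every \<open>a\<close>.\<close>
    interpret gordon k m n sg H "l / a" a
      using assms a by unfold_locales auto
    have Y1: "Y (L (pi/2) w) h = smooth_gap k m sg (\<lambda>i r. blk_mul n w i h r) + sqrt k * w (k, 0, n)" if "h \<in> H" for w h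
      using that by (simp add: Y_def R_def smooth_gap_def L_half_pi)
    have Y0: "Y (L 0 w) h = smooth_gap k m sg (\<lambda>i r. w (i, r, n)) + sqrt k * (\<Sum>j<n. h j * w (k, 0, j))" if "h \<in> H" for w h
      using that by (simp add: Y_def R_def smooth_gap_def L_zero)
    have low: "f w * exp (- l * sqrt k * w (k, 0, n)) \<le> exp (l * c) * \<Psi> (L (pi/2) w)" for w
    proof (cases "ev w")
      case True
      then obtain h where h: "h \<in> H" "smooth_gap k m sg (\<lambda>i r. blk_mul n w i h r) \<le> c" by (auto simp: ev_def)
      have "exp (- l * (c + sqrt k * w (k, 0, n))) \<le> exp (- l * Y (L (pi/2) w) h)"
        using l h by (simp add: Y1)
      also have "\<dots> = exp (- (l / a) * Y (L (pi/2) w) h) powr a"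
        using a by (simp add: exp_powr_real)
      also have "\<dots> \<le> \<Psi> (L (pi/2) w)"
        unfolding \<Psi>_def using a by (intro powr_mono2 exp_le_W h) auto
      finally have "exp (l * c) * exp (- l * (c + sqrt k * w (k, 0, n))) \<le> exp (l * c) * \<Psi> (L (pi/2) w)"
        by (intro mult_left_mono) auto
      then show ?thesis using True by (simp add: f_def exp_add[symmetric] algebra_simps)
    next
      case False
      then show ?thesis using less_imp_le[OF \<Psi>_pos] by (simp add: f_def)
    qed
    have up: "\<Psi> (L 0 w) \<le> card H powr a * exp (- l * smooth_gap k m sg (\<lambda>i r. w (i, r, n)) +
         l * sqrt k * sqrt (\<Sum>j<n. (w (k, 0, j))\<^sup>2))" for w
    proof -
      let ?F = "smooth_gap k m sg (\<lambda>i r. w (i, r, n))" and ?g = "sqrt (\<Sum>j<n. (w (k, 0, j))\<^sup>2)"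
      have "W (L 0 w) \<le> (\<Sum>h\<in>H. exp ((l / a) * (- ?F + sqrt k * ?g)))"
        unfolding W_def
      proof (rule sum_mono)
        fix h assume h: "h \<in> H"
        have "\<bar>\<Sum>j<n. h j * w (k, 0, j)\<bar> \<le> L2_set h {..<n} * L2_set (\<lambda>j. w (k, 0, j)) {..<n}"
          using L2_set_mult_ineq[of h "\<lambda>j. w (k, 0, j)" "{..<n}"] sum_abs[of "\<lambda>j. h j * w (k, 0, j)" "{..<n}"]
          by (simp add: abs_mult)
        then have "- (\<Sum>j<n. h j * w (k, 0, j)) \<le> ?g"
          using unit[OF h] by (simp add: L2_set_def)
        then have "sqrt k * - (\<Sum>j<n. h j * w (k, 0, j)) \<le> sqrt k * ?g" by (intro mult_left_mono) auto
        then have "(l / a) * (- Y (L 0 w) h) \<le> (l / a) * (- ?F + sqrt k * ?g)"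
          using l a h by (intro mult_left_mono) (auto simp: Y0)
        then show "exp (- (l / a) * Y (L 0 w) h) \<le> exp ((l / a) * (- ?F + sqrt k * ?g))" by simp
      qed
      then have "W (L 0 w) \<le> card H * exp ((l / a) * (- ?F + sqrt k * ?g))" by simp
      then have "\<Psi> (L 0 w) \<le> (card H * exp ((l / a) * (- ?F + sqrt k * ?g))) powr a"
        unfolding \<Psi>_def using a W_pos[of "L 0 w"] by (intro powr_mono2) auto
      also have "\<dots> = card H powr a * exp (l * (- ?F + sqrt k * ?g))"
        using a by (simp add: powr_mult exp_powr_real)
      finally show ?thesis by (simp add: algebra_simps)
    qed
    have int_e: "integrable ?G (\<lambda>w. f w * exp (- l * sqrt k * w (k, 0, n)))"
    proof (rule Bochner_Integration.integrable_bound[OF integrable_mult_right[OF interpolation_le(1)[of "pi/2"], of "exp (l * c)"]])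
      have "(k, 0, n) \<in> gidx k m n" by (auto simp: gidx_def)
      note [measurable] = fm component_measurable_gidx[OF this]
      show "(\<lambda>w. f w * exp (- l * sqrt k * w (k, 0, n))) \<in> borel_measurable ?G" by measurable
      show "AE w in ?G. norm (f w * exp (- l * sqrt k * w (k, 0, n))) \<le> norm (exp (l * c) * \<Psi> (L (pi/2) w))"
      proof (rule AE_I2)
        fix w
        have "norm (f w * exp (- l * sqrt k * w (k, 0, n))) = f w * exp (- l * sqrt k * w (k, 0, n))"
          by (simp add: f_def)
        also note low[of w]
        also have "exp (l * c) * \<Psi> (L (pi/2) w) \<le> norm (exp (l * c) * \<Psi> (L (pi/2) w))" by simp
        finally show "norm (f w * exp (- l * sqrt k * w (k, 0, n))) \<le> norm (exp (l * c) * \<Psi> (L (pi/2) w))" .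
      qed
    qed
    \<comment> \<open>The event does not involve entry \<open>(k, 0, n)\<close>, so the scalar
      Gaussian integrates separately to \<open>exp (l\<^sup>2 * k / 2)\<close>; dividing by it
      yields the gain in the final bound.\<close>
    have "p0 * exp ((- l * sqrt k)\<^sup>2 / 2) = (\<integral>w. f w * exp (- l * sqrt k * w (k, 0, n)) \<partial>?G)"
      unfolding p0 std_gauss_exp_linear(2)[symmetric]
    proof (rule gauss_prod_integral_indep[symmetric, OF finite_gidx _ fint int_e])
      show "(k, 0, n) \<in> gidx k m n" by (auto simp: gidx_def)
      fix w :: "nat \<times> nat \<times> nat \<Rightarrow> real" and y
      have "smooth_gap k m sg (\<lambda>i r. blk_mul n (w((k, 0, n) := y)) i h r) = smooth_gap k m sg (\<lambda>i r. blk_mul n w i h r)" for h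
        by (rule smooth_gap_cong) (auto simp: blk_mul_def)
      then show "f (w((k, 0, n) := y)) = f w" by (simp add: f_def ev_def)
    qed
    also have "\<dots> \<le> (\<integral>w. exp (l * c) * \<Psi> (L (pi/2) w) \<partial>?G)"
      by (intro integral_mono int_e integrable_mult_right interpolation_le low)
    also have "\<dots> = exp (l * c) * (\<integral>w. \<Psi> (L (pi/2) w) \<partial>?G)" by simp
    also have "(\<integral>w. \<Psi> (L (pi/2) w) \<partial>?G) \<le> (\<integral>w. \<Psi> (L 0 w) \<partial>?G)" by (rule interpolation_le)
    also have "\<dots> \<le> card H powr a * gordon_moment k m n sg l"
      unfolding gordon_moment_def integral_mult_right_zero[symmetric]
      by (intro integral_mono integrable_mult_right interpolation_le integrable_gordon_moment sg l up)
    finally show ?thesis by (simp add: power_mult_distrib)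
  qed
  \<comment> \<open>As \<open>a\<close> tends to 0 the cardinality factor tends to 1, while all
    other terms are free of \<open>a\<close>.\<close>
  have "p0 * exp (l\<^sup>2 * k / 2) \<le> exp (l * c) * (card H powr 0 * gordon_moment k m n sg l)"
  proof (rule tendsto_lowerbound)
    show "((\<lambda>a. exp (l * c) * (card H powr a * gordon_moment k m n sg l)) \<longlongrightarrow>
        exp (l * c) * (card H powr 0 * gordon_moment k m n sg l)) (at_right 0)"
      using H by (intro tendsto_intros) auto
    show "\<forall>\<^sub>F a in at_right 0. p0 * exp (l\<^sup>2 * k / 2) \<le> exp (l * c) * (card H powr a * gordon_moment k m n sg l)"
      unfolding eventually_at_right_field by (intro exI[of _ 1]) (auto intro: main)
  qed simp
  then have "p0 * exp (l\<^sup>2 * k / 2) \<le> exp (l * c) * gordon_moment k m n sg l" using H by simp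
  then have "p0 \<le> exp (l * c) * gordon_moment k m n sg l / exp (l\<^sup>2 * k / 2)"
    by (simp add: pos_le_divide_eq)
  then show ?thesis unfolding marg[unfolded ev_def] by (simp add: exp_diff)
qed

section \<open>Exponential moments of Gaussian norms\<close>

text \<open>Exponentials of squared norms, unlike those of norms, factor over the entries. Expanding
  the product of sums over choice functions reduces everything to one-dimensional integrals, and the
  result folds back into a product of sums.\<close>

lemma gauss_prod_block_expectation:
  fixes t c :: "'b \<Rightarrow> nat \<Rightarrow> real" and X :: "'b \<Rightarrow> 'i set"
  assumes I: "finite I" and B: "finite B" and X: "\<And>i. i \<in> B \<Longrightarrow> X i \<subseteq> I"
    and disj: "disjoint_family_on X B" and t: "\<And>i \<nu>. i \<in> B \<Longrightarrow> \<nu> < N i \<Longrightarrow> t i \<nu> < 1"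
  defines "f \<equiv> (\<lambda>w. \<Prod>i\<in>B. \<Sum>\<nu><N i. c i \<nu> * exp (t i \<nu> * (\<Sum>x\<in>X i. (w x)\<^sup>2) / 2))"
  shows "integrable (PiM I (\<lambda>_. std_gauss)) f"
    and "(\<integral>w. f w \<partial>PiM I (\<lambda>_. std_gauss)) = (\<Prod>i\<in>B. \<Sum>\<nu><N i. c i \<nu> * (1 / sqrt (1 - t i \<nu>)) ^ card (X i))"
proof -
  let ?\<Phi> = "PiE B (\<lambda>i. {..<N i})"
  \<comment> \<open>The factor of entry \<open>x\<close> once \<phi> has selected one term per
    block; disjointness leaves at most one nontrivial factor in the product over
    \<open>B\<close>.\<close>
  define F where "F \<phi> x y = (\<Prod>i\<in>B. if x \<in> X i then exp (t i (\<phi> i) * y\<^sup>2 / 2) else 1)" for \<phi> and x :: 'i and y :: real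
  have fX: "finite (X i)" if "i \<in> B" for i using X[OF that] I finite_subset by blast
  have prodX: "(\<Prod>x\<in>I. if x \<in> X i then g x else 1) = (\<Prod>x\<in>X i. g x)" if "i \<in> B" for i and g :: "'i \<Rightarrow> real"
    using X[OF that] I by (simp add: prod.inter_restrict[symmetric] Int_absorb1)
  have f_eq: "f w = (\<Sum>\<phi>\<in>?\<Phi>. (\<Prod>i\<in>B. c i (\<phi> i)) * (\<Prod>x\<in>I. F \<phi> x (w x)))" for w
  proof -
    have "f w = (\<Sum>\<phi>\<in>?\<Phi>. \<Prod>i\<in>B. c i (\<phi> i) * exp (t i (\<phi> i) * (\<Sum>x\<in>X i. (w x)\<^sup>2) / 2))"
      unfolding f_def using B by (intro prod_sum_PiE) auto
    also have "\<dots> = (\<Sum>\<phi>\<in>?\<Phi>. (\<Prod>i\<in>B. c i (\<phi> i)) * (\<Prod>x\<in>I. F \<phi> x (w x)))"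
    proof (intro sum.cong refl)
      fix \<phi>
      have "(\<Prod>x\<in>I. F \<phi> x (w x)) = (\<Prod>i\<in>B. \<Prod>x\<in>I. if x \<in> X i then exp (t i (\<phi> i) * (w x)\<^sup>2 / 2) else 1)"
        unfolding F_def by (rule prod.swap)
      also have "\<dots> = (\<Prod>i\<in>B. \<Prod>x\<in>X i. exp (t i (\<phi> i) * (w x)\<^sup>2 / 2))"
        by (intro prod.cong refl prodX)
      also have "\<dots> = (\<Prod>i\<in>B. exp (t i (\<phi> i) * (\<Sum>x\<in>X i. (w x)\<^sup>2) / 2))"
        by (intro prod.cong refl) (simp add: exp_sum[symmetric] fX sum_distrib_left sum_divide_distrib)
      finally show "(\<Prod>i\<in>B. c i (\<phi> i) * exp (t i (\<phi> i) * (\<Sum>x\<in>X i. (w x)\<^sup>2) / 2)) =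
        (\<Prod>i\<in>B. c i (\<phi> i)) * (\<Prod>x\<in>I. F \<phi> x (w x))" by (simp add: prod.distrib)
    qed
    finally show ?thesis .
  qed
  have F: "integrable std_gauss (F \<phi> x)"
      "(\<integral>y. F \<phi> x y \<partial>std_gauss) = (\<Prod>i\<in>B. if x \<in> X i then 1 / sqrt (1 - t i (\<phi> i)) else 1)"
    if \<phi>: "\<phi> \<in> ?\<Phi>" for \<phi> x
  proof -
    have "integrable std_gauss (F \<phi> x) \<and>
      (\<integral>y. F \<phi> x y \<partial>std_gauss) = (\<Prod>i\<in>B. if x \<in> X i then 1 / sqrt (1 - t i (\<phi> i)) else 1)"
    proof (cases "\<exists>i\<in>B. x \<in> X i")
      case True
      then obtain i where i: "i \<in> B" "x \<in> X i" by auto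
      have iff: "x \<in> X j \<longleftrightarrow> j = i" if "j \<in> B" for j
        using that i disj by (auto simp: disjoint_family_on_def)
      have 1: "(\<Prod>j\<in>B. if x \<in> X j then g j else 1) = g i" for g :: "'b \<Rightarrow> real"
      proof -
        have "(\<Prod>j\<in>B. if x \<in> X j then g j else 1) = (\<Prod>j\<in>B. if j = i then g j else 1)"
          by (intro prod.cong refl) (simp add: iff)
        then show ?thesis using i B by simp
      qed
      have "t i (\<phi> i) < 1" using \<phi> i by (intro t) (auto simp: PiE_iff)
      then show ?thesis unfolding F_def 1 using std_gauss_exp_square by auto
    next
      case False
      then have "(\<Prod>j\<in>B. if x \<in> X j then g j else 1) = 1" for g :: "'b \<Rightarrow> real" by (intro prod.neutral) auto
      then show ?thesis unfolding F_def by (simp add: std_gauss.prob_space[simplified])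
    qed
    then show "integrable std_gauss (F \<phi> x)"
      "(\<integral>y. F \<phi> x y \<partial>std_gauss) = (\<Prod>i\<in>B. if x \<in> X i then 1 / sqrt (1 - t i (\<phi> i)) else 1)" by auto
  qed
  have int: "integrable (PiM I (\<lambda>_. std_gauss)) (\<lambda>w. \<Prod>x\<in>I. F \<phi> x (w x))" if "\<phi> \<in> ?\<Phi>" for \<phi>
    using that by (intro gauss_prod.product_integrable_prod I F)
  show "integrable (PiM I (\<lambda>_. std_gauss)) f"
    unfolding f_eq by (intro Bochner_Integration.integrable_sum integrable_mult_right int)
  have "(\<integral>w. f w \<partial>PiM I (\<lambda>_. std_gauss)) = (\<Sum>\<phi>\<in>?\<Phi>. (\<Prod>i\<in>B. c i (\<phi> i)) * (\<Prod>x\<in>I. \<Prod>i\<in>B. if x \<in> X i then 1 / sqrt (1 - t i (\<phi> i)) else 1))"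
    unfolding f_eq
    by (subst Bochner_Integration.integral_sum)
      (auto intro!: int sum.cong simp: gauss_prod.product_integral_prod[OF I F(1)] F(2))
  also have "\<dots> = (\<Sum>\<phi>\<in>?\<Phi>. \<Prod>i\<in>B. c i (\<phi> i) * (1 / sqrt (1 - t i (\<phi> i))) ^ card (X i))"
  proof (intro sum.cong refl)
    fix \<phi>
    have "(\<Prod>x\<in>I. \<Prod>i\<in>B. if x \<in> X i then 1 / sqrt (1 - t i (\<phi> i)) else 1) =
        (\<Prod>i\<in>B. \<Prod>x\<in>I. if x \<in> X i then 1 / sqrt (1 - t i (\<phi> i)) else 1)" by (rule prod.swap)
    also have "\<dots> = (\<Prod>i\<in>B. (1 / sqrt (1 - t i (\<phi> i))) ^ card (X i))"
      by (intro prod.cong refl) (subst prodX, auto)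
    finally show "(\<Prod>i\<in>B. c i (\<phi> i)) * (\<Prod>x\<in>I. \<Prod>i\<in>B. if x \<in> X i then 1 / sqrt (1 - t i (\<phi> i)) else 1) =
        (\<Prod>i\<in>B. c i (\<phi> i) * (1 / sqrt (1 - t i (\<phi> i))) ^ card (X i))" by (simp add: prod.distrib)
  qed
  also have "\<dots> = (\<Prod>i\<in>B. \<Sum>\<nu><N i. c i \<nu> * (1 / sqrt (1 - t i \<nu>)) ^ card (X i))"
    using B by (intro prod_sum_PiE[symmetric]) auto
  finally show "(\<integral>w. f w \<partial>PiM I (\<lambda>_. std_gauss)) = (\<Prod>i\<in>B. \<Sum>\<nu><N i. c i \<nu> * (1 / sqrt (1 - t i \<nu>)) ^ card (X i))" .
qed

text \<open>\<open>exp (b \<rho>)\<close> is dominated by a mixture of exponentials of \<open>\<rho>\<^sup>2\<close> whose expectation at the norm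
  of a standard Gaussian vector in dimension \<open>d\<close> is at most \<open>U\<close>.\<close>

definition mixture_dominated :: "real \<Rightarrow> nat \<Rightarrow> real \<Rightarrow> nat \<Rightarrow> (nat \<Rightarrow> real) \<Rightarrow> (nat \<Rightarrow> real) \<Rightarrow> bool" where
  "mixture_dominated b d U N c t \<longleftrightarrow> (\<forall>\<nu><N. 0 \<le> c \<nu> \<and> t \<nu> < 1) \<and>
     (\<forall>\<rho>\<ge>0. exp (b * \<rho>) \<le> (\<Sum>\<nu><N. c \<nu> * exp (t \<nu> * \<rho>\<^sup>2 / 2))) \<and>
     (\<Sum>\<nu><N. c \<nu> * (1 / sqrt (1 - t \<nu>)) ^ d) \<le> U"

text \<open>The exponent \<open>l * \<rho>\<close> is concave as a function of the squared norm, so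
  a single tangent line dominates it and a mixture of one term suffices.\<close>

lemma chi_exp_upper:
  assumes l: "l > 0" and d: "d > 0"
  shows "\<exists>N c t. mixture_dominated l d (exp (l * sqrt d + l\<^sup>2 / 2)) N c t"
proof -
  define x where "x = l / sqrt d"
  have x: "x > 0" using l d by (simp add: x_def)
  \<comment> \<open>With this tilt \<open>(1 - t)\<close> to the power \<open>- d / 2\<close> is at
    most \<open>exp (l * sqrt d / 2)\<close>, while \<open>l\<^sup>2 / (2 * t)\<close> equals
    \<open>l * sqrt d / 2 + l\<^sup>2 / 2\<close>; they add up to the claim.\<close>
  define t where "t = x / (1 + x)"
  have t: "0 < t" "t < 1" using x by (auto simp: t_def)
  have t1: "1 - t = 1 / (1 + x)" using x by (simp add: t_def field_simps)
  have dom: "exp (l * \<rho>) \<le> exp (l\<^sup>2 / (2 * t)) * exp (t * \<rho>\<^sup>2 / 2)" for \<rho>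
  proof -
    have "0 \<le> (t * \<rho> - l)\<^sup>2 / (2 * t)" using t by simp
    also have "\<dots> = l\<^sup>2 / (2 * t) + t * \<rho>\<^sup>2 / 2 - l * \<rho>" using t by (simp add: field_simps power2_eq_square)
    finally show ?thesis by (simp add: exp_add[symmetric])
  qed
  have "(1 / sqrt (1 - t)) ^ d \<le> exp (x / 2) ^ d"
  proof (rule power_mono)
    have "sqrt (1 + x) \<le> exp (x / 2)"
    proof (rule real_le_lsqrt)
      show "1 + x \<le> (exp (x / 2))\<^sup>2"
        using exp_ge_add_one_self[of x] by (simp add: power2_eq_square exp_add[symmetric])
    qed (use x in auto)
    then show "1 / sqrt (1 - t) \<le> exp (x / 2)" unfolding t1 by (simp add: real_sqrt_divide)
  qed (use t in auto)
  also have "\<dots> = exp (l * sqrt d / 2)"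
    unfolding exp_of_nat_mult[symmetric] x_def using d by (simp add: field_simps)
  finally have "exp (l\<^sup>2 / (2 * t)) * (1 / sqrt (1 - t)) ^ d \<le> exp (l\<^sup>2 / (2 * t)) * exp (l * sqrt d / 2)"
    by (intro mult_left_mono) auto
  also have "\<dots> = exp (l * sqrt d + l\<^sup>2 / 2)"
  proof -
    have "l\<^sup>2 / (2 * t) = l * sqrt d / 2 + l\<^sup>2 / 2"
      using l d by (simp add: t_def x_def field_simps power2_eq_square)
    then show ?thesis by (simp add: exp_add[symmetric])
  qed
  finally have "exp (l\<^sup>2 / (2 * t)) * (1 / sqrt (1 - t)) ^ d \<le> exp (l * sqrt d + l\<^sup>2 / 2)" .
  then have "mixture_dominated l d (exp (l * sqrt d + l\<^sup>2 / 2)) 1 (\<lambda>_. exp (l\<^sup>2 / (2 * t))) (\<lambda>_. t)"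
    using t dom by (simp add: mixture_dominated_def)
  then show ?thesis by blast
qed

text \<open>Here \<open>- l * \<rho>\<close> is convex in the squared norm, so tangent lines lie on
  the wrong side. The range below \<open>sqrt d\<close> is cut into unit intervals, each with its
  own tilt. The rounding costs the summand \<open>l\<close> in the exponent, and the number of
  pieces is at most \<open>d + 2\<close>.\<close>

lemma chi_exp_lower:
  assumes l: "l > 0" and d: "d > 0"
  shows "\<exists>N c t. mixture_dominated (- l) d ((real d + 2) * exp (l - l * sqrt d + l\<^sup>2 / 2)) N c t"
proof -
  define J where "J = nat \<lfloor>sqrt d\<rfloor>"
  have J: "real J \<le> sqrt d" "sqrt d < real J + 1" by (auto simp: J_def)
  have d1: "sqrt d \<ge> 1" using d by simp
  have sd: "sqrt d * sqrt d = d" by simp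
  \<comment> \<open>The tilt \<open>t \<nu>\<close> turns the variance into
    \<open>(\<nu> + 1)\<^sup>2 / d\<close>, so that the squared norm has mean
    \<open>(\<nu> + 1)\<^sup>2\<close>. The last index \<open>J\<close>, untilted, covers all norms
    from \<open>J\<close> on.\<close>
  define c where "c \<nu> = (if \<nu> < J then exp (- l * \<nu> + (real d - (real \<nu> + 1)\<^sup>2) / 2) else exp (- l * J))" for \<nu> :: nat
  define t where "t \<nu> = (if \<nu> < J then 1 - d / (real \<nu> + 1)\<^sup>2 else 0)" for \<nu> :: nat
  have c0: "c \<nu> \<ge> 0" for \<nu> by (simp add: c_def)
  have dom: "exp (- l * \<rho>) \<le> (\<Sum>\<nu><J + 1. c \<nu> * exp (t \<nu> * \<rho>\<^sup>2 / 2))" if \<rho>: "\<rho> \<ge> 0" for \<rho>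
  proof -
    have "\<exists>\<nu><J + 1. exp (- l * \<rho>) \<le> c \<nu> * exp (t \<nu> * \<rho>\<^sup>2 / 2)"
    proof (cases "\<rho> < J")
      case True
      define \<nu> where "\<nu> = nat \<lfloor>\<rho>\<rfloor>"
      have \<nu>: "real \<nu> \<le> \<rho>" "\<rho> < \<nu> + 1" using \<rho> by (auto simp: \<nu>_def) linarith
      with True have \<nu>J: "\<nu> < J" by linarith
      have yd: "(real \<nu> + 1)\<^sup>2 \<le> d"
      proof -
        have "real \<nu> + 1 \<le> sqrt d" using \<nu>J J by linarith
        then have "(real \<nu> + 1)\<^sup>2 \<le> (sqrt d)\<^sup>2" by (intro power_mono) auto
        then show ?thesis by simp
      qed
      have "\<rho>\<^sup>2 \<le> (real \<nu> + 1)\<^sup>2" using \<nu> \<rho> by (intro power_mono) auto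
      \<comment> \<open>Both factors are nonnegative since
        \<open>\<rho> \<le> \<nu> + 1 \<le> sqrt d\<close>: on its interval the tilted exponential
        is at least \<open>exp (- l * \<nu>)\<close>.\<close>
      then have "0 \<le> (d / (real \<nu> + 1)\<^sup>2 - 1) * ((real \<nu> + 1)\<^sup>2 - \<rho>\<^sup>2)"
        using yd by (intro mult_nonneg_nonneg) (auto simp: divide_simps)
      also have "\<dots> = (d - (real \<nu> + 1)\<^sup>2) + (1 - d / (real \<nu> + 1)\<^sup>2) * \<rho>\<^sup>2"
        by (simp add: algebra_simps)
      finally have "0 \<le> (d - (real \<nu> + 1)\<^sup>2) + (1 - d / (real \<nu> + 1)\<^sup>2) * \<rho>\<^sup>2" .
      then have "- l * \<rho> \<le> (- l * \<nu> + (d - (real \<nu> + 1)\<^sup>2) / 2) + (1 - d / (real \<nu> + 1)\<^sup>2) * \<rho>\<^sup>2 / 2"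
      proof -
        have "- l * \<rho> \<le> (- l * \<nu> + D / 2) + q / 2" if "0 \<le> D + q" for D q
          using that mult_left_mono[OF \<nu>(1) less_imp_le[OF l]] by linarith
        then show ?thesis using \<open>0 \<le> _ + _ * \<rho>\<^sup>2\<close> .
      qed
      then have "exp (- l * \<rho>) \<le> c \<nu> * exp (t \<nu> * \<rho>\<^sup>2 / 2)"
        using \<nu>J unfolding c_def t_def by (simp add: exp_add[symmetric] add.commute)
      then show ?thesis using \<nu>J by (intro exI[of _ \<nu>]) auto
    next
      case False
      then have "exp (- l * \<rho>) \<le> c J * exp (t J * \<rho>\<^sup>2 / 2)" using l by (simp add: c_def t_def)
      then show ?thesis by (intro exI[of _ J]) auto
    qed
    then obtain \<nu> where \<nu>: "\<nu> < J + 1" "exp (- l * \<rho>) \<le> c \<nu> * exp (t \<nu> * \<rho>\<^sup>2 / 2)" by auto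
    note \<nu>(2)
    also have "c \<nu> * exp (t \<nu> * \<rho>\<^sup>2 / 2) \<le> (\<Sum>\<nu><J + 1. c \<nu> * exp (t \<nu> * \<rho>\<^sup>2 / 2))"
      using \<nu>(1) c0 by (intro member_le_sum[of \<nu> _ "\<lambda>\<nu>. c \<nu> * exp (t \<nu> * \<rho>\<^sup>2 / 2)"]) auto
    finally show ?thesis .
  qed
  have val: "c \<nu> * (1 / sqrt (1 - t \<nu>)) ^ d \<le> exp (l - l * sqrt d + l\<^sup>2 / 2)" for \<nu>
  proof (cases "\<nu> < J")
    case True
    define y where "y = real \<nu> + 1"
    have y: "y > 0" by (simp add: y_def)
    have "1 / sqrt (1 - t \<nu>) = y / sqrt d"
      using True y by (simp add: t_def y_def[symmetric] real_sqrt_divide)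
    also have "\<dots> \<le> exp (y / sqrt d - 1)" using exp_ge_add_one_self[of "y / sqrt d - 1"] by simp
    finally have "(1 / sqrt (1 - t \<nu>)) ^ d \<le> exp (y / sqrt d - 1) ^ d"
      using True y by (intro power_mono) (auto simp: t_def)
    also have "\<dots> = exp (d * (y / sqrt d - 1))" by (simp add: exp_of_nat_mult)
    also have "d * (y / sqrt d - 1) = sqrt d * y - d"
    proof -
      have "d / sqrt d = sqrt d" using d by (simp add: real_div_sqrt)
      then show ?thesis by (simp add: right_diff_distrib) (simp add: times_divide_eq_left[symmetric] del: times_divide_eq_left)
    qed
    finally have "c \<nu> * (1 / sqrt (1 - t \<nu>)) ^ d \<le> exp (- l * (y - 1) + (d - y\<^sup>2) / 2) * exp (sqrt d * y - d)"
      using True by (intro mult_mono) (auto simp: c_def y_def t_def add.commute)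
    also have "\<dots> = exp (- l * (y - 1) + (d - y\<^sup>2) / 2 + (sqrt d * y - d))" by (simp add: exp_add)
    also have "\<dots> \<le> exp (l - l * sqrt d + l\<^sup>2 / 2)"
    proof -
      \<comment> \<open>The exponent to be bounded is
        \<open>l - l * y - (sqrt d - y)\<^sup>2 / 2\<close>, whose maximum is at
        \<open>y = sqrt d - l\<close>.\<close>
      have "0 \<le> (sqrt d - y - l)\<^sup>2" by simp
      also have "\<dots> = d + y\<^sup>2 + l\<^sup>2 - 2 * (sqrt d * y) - 2 * (l * sqrt d) + 2 * (l * y)"
        using sd by (simp add: power2_eq_square algebra_simps)
      finally have "- l * (y - 1) + (d - y\<^sup>2) / 2 + (sqrt d * y - d) \<le> l - l * sqrt d + l\<^sup>2 / 2"
        by (simp add: field_simps)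
      then show ?thesis by simp
    qed
    finally show ?thesis .
  next
    case False
    have "l * sqrt d \<le> l * (real J + 1)" using J l by (intro mult_left_mono) auto
    then have "- l * J \<le> l - l * sqrt d + l\<^sup>2 / 2"
      using zero_le_power2[of l] unfolding distrib_left by linarith
    then show ?thesis using False by (simp add: c_def t_def)
  qed
  have "(\<Sum>\<nu><J + 1. c \<nu> * (1 / sqrt (1 - t \<nu>)) ^ d) \<le> (\<Sum>\<nu><J + 1. exp (l - l * sqrt d + l\<^sup>2 / 2))"
    by (intro sum_mono val)
  also have "\<dots> = (J + 1) * exp (l - l * sqrt d + l\<^sup>2 / 2)" by simp
  also have "\<dots> \<le> (real d + 2) * exp (l - l * sqrt d + l\<^sup>2 / 2)"
  proof (intro mult_right_mono)
    have "sqrt d \<le> sqrt d * sqrt d" using mult_left_mono[OF d1, of "sqrt d"] d1 by simp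
    then show "real (J + 1) \<le> real d + 2" using J(1) sd by simp
  qed simp
  finally have "mixture_dominated (- l) d ((real d + 2) * exp (l - l * sqrt d + l\<^sup>2 / 2)) (J + 1) c t"
    using dom d c0 by (auto simp: mixture_dominated_def t_def)
  then show ?thesis by blast
qed

text \<open>Of \<open>2 * l * k\<close>, one half pays for the smoothing and the other for the
  rounding in the lower moment bound. The blocks and the vector \<open>g\<close> each contribute
  \<open>l\<^sup>2 * k / 2\<close>, and the signs sum to \<open>2 * card S - k\<close>.\<close>

lemma gordon_moment_le:
  assumes k: "k > 0" and m: "m > 0" and n: "n > 0" and l: "l > 0" and S: "S \<subseteq> {..<k}"
  shows "gordon_moment k m n (\<lambda>i. if i \<in> S then 1 else - 1) l \<le>
    (real m + 2) ^ k * exp (2 * l * k - l * ((2 * real (card S) - real k) * sqrt m - sqrt k * sqrt n) + l\<^sup>2 * k)"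
proof -
  let ?sg = "\<lambda>i. if i \<in> S then 1 else - 1 :: real"
  let ?G = "PiM (gidx k m n) (\<lambda>_. std_gauss)"
  \<comment> \<open>Index \<open>k\<close> stands for the vector \<open>g\<close> in
    \<open>n\<close>-space, so that blocks and \<open>g\<close> are treated as one family of norms
    with coefficients \<open>b\<close>.\<close>
  define d where "d i = (if i < k then m else n)" for i
  define b where "b i = (if i < k then - ?sg i * l else l * sqrt k)" for i
  define U where "U i = (if i < k then (if i \<in> S then (real m + 2) * exp (l - l * sqrt m + l\<^sup>2 / 2) else exp (l * sqrt m + l\<^sup>2 / 2))
      else exp (l * sqrt k * sqrt n + (l * sqrt k)\<^sup>2 / 2))" for i
  define X where "X i = (if i < k then (\<lambda>r. (i, r, n)) ` {..<m} else (\<lambda>j. (k, 0, j)) ` {..<n})" for i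
  have "\<exists>N c t. mixture_dominated (b i) (d i) (U i) N c t" for i
  proof -
    have "l * sqrt k > 0" using l k by simp
    from chi_exp_upper[OF this n] show ?thesis
      unfolding b_def d_def U_def using chi_exp_upper[OF l m] chi_exp_lower[OF l m] by simp
  qed
  then obtain N c t where dom: "\<And>i. mixture_dominated (b i) (d i) (U i) (N i) (c i) (t i)" by metis
  have X: "card (X i) = d i" "finite (X i)" for i
    by (auto simp: X_def d_def card_image inj_on_def)
  define \<rho> where "\<rho> w i = sqrt (\<Sum>x\<in>X i. (w x)\<^sup>2)" for w :: "nat \<times> nat \<times> nat \<Rightarrow> real" and i
  have \<rho>2: "(\<rho> w i)\<^sup>2 = (\<Sum>x\<in>X i. (w x)\<^sup>2)" "\<rho> w i \<ge> 0" for w i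
    unfolding \<rho>_def by (auto intro!: sum_nonneg)
  let ?T = "\<lambda>w i. \<Sum>\<nu><N i. c i \<nu> * exp (t i \<nu> * (\<Sum>x\<in>X i. (w x)\<^sup>2) / 2)"
  have T: "exp (b i * \<rho> w i) \<le> ?T w i" for w i
    using dom[of i] \<rho>2(2)[of w i] unfolding mixture_dominated_def \<rho>2(1)[symmetric] by blast
  have t: "\<nu> < N i \<Longrightarrow> t i \<nu> < 1" for i \<nu> using dom[of i] by (auto simp: mixture_dominated_def)
  have \<rho>i: "\<rho> w i = sqrt (\<Sum>r<m. (w (i, r, n))\<^sup>2)" if "i < k" for w i
    unfolding \<rho>_def X_def using that by (simp add: sum.reindex inj_on_def)
  have \<rho>k: "\<rho> w k = sqrt (\<Sum>j<n. (w (k, 0, j))\<^sup>2)" for w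
    unfolding \<rho>_def X_def by (simp add: sum.reindex inj_on_def)
  have pt: "exp (- l * smooth_gap k m ?sg (\<lambda>i r. w (i, r, n)) + l * sqrt k * sqrt (\<Sum>j<n. (w (k, 0, j))\<^sup>2))
      \<le> exp (l * k) * (\<Prod>i\<le>k. ?T w i)" for w
  proof -
    have "- l * smooth_gap k m ?sg (\<lambda>i r. w (i, r, n)) \<le> (\<Sum>i<k. l + b i * \<rho> w i)"
      unfolding smooth_gap_def sum_distrib_left
    proof (rule sum_mono)
      fix i assume "i \<in> {..<k}"
      then have i: "i < k" by simp
      let ?q = "sqrt (1 + (\<Sum>r<m. (w (i, r, n))\<^sup>2))"
      have "?q \<le> sqrt 1 + sqrt (\<Sum>r<m. (w (i, r, n))\<^sup>2)" by (rule sqrt_add_le_add_sqrt) (auto intro: sum_nonneg)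
      then have 1: "?q \<le> 1 + \<rho> w i" using \<rho>i[OF i] by simp
      have 2: "\<rho> w i \<le> ?q" using \<rho>i[OF i] by simp
      \<comment> \<open>For a positive sign the smoothed norm may be replaced by the smaller true
        norm; for a negative sign the replacement costs \<open>l\<close>.\<close>
      show "- l * (?sg i * ?q) \<le> l + b i * \<rho> w i"
      proof -
        have "l * ?q \<le> l * 1 + l * \<rho> w i" "l * \<rho> w i \<le> l * ?q"
          using mult_left_mono[OF 1 less_imp_le[OF l]] mult_left_mono[OF 2 less_imp_le[OF l]]
          by (simp_all only: distrib_left)
        then have "- (l * ?q) \<le> l - l * \<rho> w i" "l * ?q \<le> l + l * \<rho> w i" using l by linarith+
        then show ?thesis using i by (cases "i \<in> S") (simp_all add: b_def)
      qed
    qed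
    also have "\<dots> = l * k + (\<Sum>i<k. b i * \<rho> w i)" by (simp add: sum.distrib)
    finally have "- l * smooth_gap k m ?sg (\<lambda>i r. w (i, r, n)) + l * sqrt k * sqrt (\<Sum>j<n. (w (k, 0, j))\<^sup>2)
        \<le> l * k + (\<Sum>i\<le>k. b i * \<rho> w i)"
      unfolding lessThan_Suc_atMost[symmetric] by (simp add: \<rho>k b_def)
    then have "exp (- l * smooth_gap k m ?sg (\<lambda>i r. w (i, r, n)) + l * sqrt k * sqrt (\<Sum>j<n. (w (k, 0, j))\<^sup>2))
        \<le> exp (l * k + (\<Sum>i\<le>k. b i * \<rho> w i))" by simp
    also have "\<dots> = exp (l * k) * (\<Prod>i\<le>k. exp (b i * \<rho> w i))" by (simp add: exp_add exp_sum)
    also have "\<dots> \<le> exp (l * k) * (\<Prod>i\<le>k. ?T w i)"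
      using T by (intro mult_left_mono prod_mono) auto
    finally show ?thesis .
  qed
  have Xsub: "X i \<subseteq> gidx k m n" if "i \<in> {..k}" for i using that by (auto simp: X_def gidx_def)
  have disj: "disjoint_family_on X {..k}"
    unfolding disjoint_family_on_def by (auto simp: X_def split: if_splits)
  note E = gauss_prod_block_expectation[where N=N and c=c and t=t, OF finite_gidx finite_atMost Xsub disj t]
  have "gordon_moment k m n ?sg l \<le> (\<integral>w. exp (l * k) * (\<Prod>i\<le>k. ?T w i) \<partial>?G)"
    unfolding gordon_moment_def
    by (intro integral_mono integrable_mult_right E pt integrable_gordon_moment l) auto
  also have "\<dots> = exp (l * k) * (\<Prod>i\<le>k. \<Sum>\<nu><N i. c i \<nu> * (1 / sqrt (1 - t i \<nu>)) ^ d i)"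
    unfolding integral_mult_right_zero using E(2) by (simp add: X)
  also have "\<dots> \<le> exp (l * k) * (\<Prod>i\<le>k. U i)"
  proof (intro mult_left_mono prod_mono conjI)
    show "(\<Sum>\<nu><N i. c i \<nu> * (1 / sqrt (1 - t i \<nu>)) ^ d i) \<le> U i" for i
      using dom[of i] by (simp add: mixture_dominated_def)
    show "0 \<le> (\<Sum>\<nu><N i. c i \<nu> * (1 / sqrt (1 - t i \<nu>)) ^ d i)" for i
      using dom[of i] by (intro sum_nonneg mult_nonneg_nonneg) (auto simp: mixture_dominated_def less_imp_le)
  qed simp
  also have "\<dots> \<le> (real m + 2) ^ k * exp (2 * l * k - l * ((2 * real (card S) - real k) * sqrt m - sqrt k * sqrt n) + l\<^sup>2 * k)"
  proof -
    have "(\<Prod>i<k. U i) \<le> (\<Prod>i<k. (real m + 2) * exp (l + l\<^sup>2 / 2 - ?sg i * (l * sqrt m)))"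
    proof (rule prod_mono)
      fix i assume i: "i \<in> {..<k}"
      have "exp (l * sqrt m + l\<^sup>2 / 2) \<le> 1 * exp (l + l\<^sup>2 / 2 + l * sqrt m)" using l by simp
      also have "\<dots> \<le> (real m + 2) * exp (l + l\<^sup>2 / 2 + l * sqrt m)" by (intro mult_right_mono) auto
      finally show "0 \<le> U i \<and> U i \<le> (real m + 2) * exp (l + l\<^sup>2 / 2 - ?sg i * (l * sqrt m))"
        using i by (simp add: U_def algebra_simps)
    qed
    also have "\<dots> = (real m + 2) ^ k * exp (\<Sum>i<k. l + l\<^sup>2 / 2 - ?sg i * (l * sqrt m))"
      by (simp only: prod.distrib prod_constant card_lessThan exp_sum finite_lessThan)
    also have "(\<Sum>i<k. l + l\<^sup>2 / 2 - ?sg i * (l * sqrt m)) = k * (l + l\<^sup>2 / 2) - (\<Sum>i<k. ?sg i) * (l * sqrt m)"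
      by (simp only: sum_subtractf sum_distrib_right) simp
    also have "(\<Sum>i<k. ?sg i) = 2 * real (card S) - real k"
    proof -
      have "(\<Sum>i<k. ?sg i) = (\<Sum>i<k. 2 * (if i \<in> S then 1 else 0) - 1)" by (intro sum.cong) auto
      also have "\<dots> = 2 * (\<Sum>i<k. if i \<in> S then 1 else 0) - real k" by (simp only: sum_subtractf sum_distrib_left) simp
      also have "(\<Sum>i<k. if i \<in> S then 1 else 0 :: real) = card S"
        using S by (simp add: sum.inter_restrict[symmetric] Int_absorb1)
      finally show ?thesis .
    qed
    finally have P: "(\<Prod>i<k. U i) \<le> (real m + 2) ^ k * exp (k * (l + l\<^sup>2 / 2) - (2 * real (card S) - real k) * (l * sqrt m))" .
    have "(\<Prod>i\<le>k. U i) = (\<Prod>i<k. U i) * exp (l * sqrt k * sqrt n + l\<^sup>2 * k / 2)"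
      unfolding lessThan_Suc_atMost[symmetric] by (simp add: U_def power_mult_distrib)
    also have "\<dots> \<le> ((real m + 2) ^ k * exp (k * (l + l\<^sup>2 / 2) - (2 * real (card S) - real k) * (l * sqrt m))) * exp (l * sqrt k * sqrt n + l\<^sup>2 * k / 2)"
      using P by (intro mult_right_mono) auto
    finally have "exp (l * k) * (\<Prod>i\<le>k. U i) \<le> exp (l * k) * (((real m + 2) ^ k * exp (k * (l + l\<^sup>2 / 2) - (2 * real (card S) - real k) * (l * sqrt m))) * exp (l * sqrt k * sqrt n + l\<^sup>2 * k / 2))"
      by (intro mult_left_mono) auto
    also have "\<dots> = (real m + 2) ^ k * exp (l * k + (k * (l + l\<^sup>2 / 2) - (2 * real (card S) - real k) * (l * sqrt m)) + (l * sqrt k * sqrt n + l\<^sup>2 * k / 2))"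
      by (simp add: exp_add)
    also have "l * k + (k * (l + l\<^sup>2 / 2) - (2 * real (card S) - real k) * (l * sqrt m)) + (l * sqrt k * sqrt n + l\<^sup>2 * k / 2) =
        2 * l * k - l * ((2 * real (card S) - real k) * sqrt m - sqrt k * sqrt n) + l\<^sup>2 * k"
      by (simp add: algebra_simps)
    finally show ?thesis .
  qed
  finally show ?thesis .
qed

section \<open>Certificates of unsolvability\<close>

text \<open>Unsolvability of a linear system thereby becomes the existence of a vector satisfying
  equations. Normalizing the pairing with \<open>b\<close> to 1, instead of asking it to be nonzero,
  makes the condition closed.\<close>

lemma fredholm_alternative:
  fixes v :: "nat \<Rightarrow> 'a \<Rightarrow> real" and b :: "'a \<Rightarrow> real"
  assumes "finite I"
  shows "(\<exists>x. \<forall>i\<in>I. b i = (\<Sum>j<n. v j i * x j)) \<or>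
    (\<exists>y. (\<forall>j<n. (\<Sum>i\<in>I. y i * v j i) = 0) \<and> (\<Sum>i\<in>I. y i * b i) = 1)"
proof (induction n arbitrary: b)
  case 0
  show ?case
  proof (cases "\<forall>i\<in>I. b i = 0")
    case False
    then obtain i where i: "i \<in> I" "b i \<noteq> 0" by auto
    have "(\<Sum>j\<in>I. (if j = i then 1 / b i else 0) * b j) = (\<Sum>j\<in>I. if j = i then 1 else 0)"
      using i by (intro sum.cong) auto
    then show ?thesis using assms i by (intro disjI2 exI[of _ "\<lambda>j. if j = i then 1 / b i else 0"]) simp
  qed auto
next
  case (Suc n)
  from Suc[of "v n"] show ?case
  proof
    assume "\<exists>x. \<forall>i\<in>I. v n i = (\<Sum>j<n. v j i * x j)"
    then obtain x where x: "\<And>i. i \<in> I \<Longrightarrow> v n i = (\<Sum>j<n. v j i * x j)" by blast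
    from Suc[of b] show ?case
    proof
      assume "\<exists>z. \<forall>i\<in>I. b i = (\<Sum>j<n. v j i * z j)"
      then obtain z where "\<And>i. i \<in> I \<Longrightarrow> b i = (\<Sum>j<n. v j i * z j)" by blast
      then show ?thesis by (intro disjI1 exI[of _ "z(n := 0)"]) (auto intro!: sum.cong)
    next
      assume "\<exists>y. (\<forall>j<n. (\<Sum>i\<in>I. y i * v j i) = 0) \<and> (\<Sum>i\<in>I. y i * b i) = 1"
      then obtain y where y: "\<And>j. j < n \<Longrightarrow> (\<Sum>i\<in>I. y i * v j i) = 0" "(\<Sum>i\<in>I. y i * b i) = 1" by blast
      have "(\<Sum>i\<in>I. y i * v n i) = (\<Sum>i\<in>I. \<Sum>j<n. x j * (y i * v j i))"
        using x by (intro sum.cong) (auto simp: sum_distrib_left mult_ac)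
      also have "\<dots> = (\<Sum>j<n. x j * (\<Sum>i\<in>I. y i * v j i))"
        by (subst sum.swap) (simp add: sum_distrib_left)
      also have "\<dots> = 0" using y by simp
      finally show ?thesis using y by (intro disjI2 exI[of _ y]) (auto simp: less_Suc_eq)
    qed
  next
    assume "\<exists>y. (\<forall>j<n. (\<Sum>i\<in>I. y i * v j i) = 0) \<and> (\<Sum>i\<in>I. y i * v n i) = 1"
    then obtain y0 where y0: "\<And>j. j < n \<Longrightarrow> (\<Sum>i\<in>I. y0 i * v j i) = 0" "(\<Sum>i\<in>I. y0 i * v n i) = 1" by blast
    \<comment> \<open>Pairing with \<open>y0\<close>, which annihilates the first \<open>n\<close>
      columns and gives 1 on column \<open>n\<close>, forces the coefficient of column
      \<open>n\<close> in any solution to be \<beta>.\<close>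
    define \<beta> where "\<beta> = (\<Sum>i\<in>I. y0 i * b i)"
    from Suc[of "\<lambda>i. b i - \<beta> * v n i"] show ?case
    proof
      assume "\<exists>z. \<forall>i\<in>I. b i - \<beta> * v n i = (\<Sum>j<n. v j i * z j)"
      then obtain z where z: "\<And>i. i \<in> I \<Longrightarrow> b i - \<beta> * v n i = (\<Sum>j<n. v j i * z j)" by blast
      have "b i = (\<Sum>j<Suc n. v j i * (z(n := \<beta>)) j)" if "i \<in> I" for i
      proof -
        have "(\<Sum>j<n. v j i * (z(n := \<beta>)) j) = (\<Sum>j<n. v j i * z j)" by (intro sum.cong) auto
        then show ?thesis using z[OF that] by (simp add: algebra_simps)
      qed
      then show ?thesis by blast
    next
      assume "\<exists>y. (\<forall>j<n. (\<Sum>i\<in>I. y i * v j i) = 0) \<and> (\<Sum>i\<in>I. y i * (b i - \<beta> * v n i)) = 1"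
      then obtain y where y: "\<And>j. j < n \<Longrightarrow> (\<Sum>i\<in>I. y i * v j i) = 0"
          "(\<Sum>i\<in>I. y i * (b i - \<beta> * v n i)) = 1" by blast
      \<comment> \<open>Subtracting \<open>c\<close> times \<open>y0\<close> kills column
        \<open>n\<close> as well, and turns the pairing with \<open>b\<close> into the pairing of
        \<open>y\<close> with the reduced right-hand side.\<close>
      define c where "c = (\<Sum>i\<in>I. y i * v n i)"
      have lin: "(\<Sum>i\<in>I. (y i - c * y0 i) * u i) = (\<Sum>i\<in>I. y i * u i) - c * (\<Sum>i\<in>I. y0 i * u i)" for u
        by (simp add: left_diff_distrib sum_subtractf sum_distrib_left mult.assoc)
      have "(\<Sum>i\<in>I. y i * (b i - \<beta> * v n i)) = (\<Sum>i\<in>I. y i * b i) - \<beta> * c"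
        by (simp add: c_def right_diff_distrib sum_subtractf sum_distrib_left mult.left_commute)
      then have "(\<Sum>i\<in>I. (y i - c * y0 i) * b i) = 1" using y unfolding lin \<beta>_def[symmetric] by (simp add: mult.commute)
      moreover have "(\<Sum>i\<in>I. (y i - c * y0 i) * v j i) = 0" if "j < Suc n" for j
        using that y y0 unfolding lin less_Suc_eq by (auto simp: c_def)
      ultimately show ?thesis by (intro disjI2 exI[of _ "\<lambda>i. y i - c * y0 i"]) auto
    qed
  qed
qed

lemma fredholm_exclusive:
  fixes v :: "nat \<Rightarrow> 'a \<Rightarrow> real"
  assumes "\<And>i. i \<in> I \<Longrightarrow> b i = (\<Sum>j<n. v j i * x j)" "\<And>j. j < n \<Longrightarrow> (\<Sum>i\<in>I. y i * v j i) = 0"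
  shows "(\<Sum>i\<in>I. y i * b i) = 0"
proof -
  have "(\<Sum>i\<in>I. y i * b i) = (\<Sum>i\<in>I. \<Sum>j<n. x j * (y i * v j i))"
    using assms(1) by (intro sum.cong) (auto simp: sum_distrib_left mult_ac)
  also have "\<dots> = (\<Sum>j<n. x j * (\<Sum>i\<in>I. y i * v j i))"
    by (subst sum.swap) (simp add: sum_distrib_left)
  also have "\<dots> = 0" using assms(2) by simp
  finally show ?thesis .
qed

section \<open>Measurability of the recovery event\<close>

lemma closed_projection_compact:
  fixes K :: "'b::topological_space set" and T :: "('a::topological_space \<times> 'b) set"
  assumes "compact K" "closed T"
  shows "closed {x. \<exists>y\<in>K. (x, y) \<in> T}"
  unfolding closed_def
proof (subst open_subopen, intro ballI)
  fix x assume "x \<in> - {x. \<exists>y\<in>K. (x, y) \<in> T}"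
  then have "{x} \<times> K \<subseteq> - T" by auto
  from Elementary_Topology.tube_lemma[OF assms(1) _ this] assms(2)
  obtain X where "x \<in> X" "open X" "X \<times> K \<subseteq> - T" by (auto simp: open_Compl)
  then show "\<exists>X. open X \<and> x \<in> X \<and> X \<subseteq> - {x. \<exists>y\<in>K. (x, y) \<in> T}" by (intro exI[of _ X]) auto
qed

lemma closed_Collect_Ball:
  assumes "\<And>x. x \<in> X \<Longrightarrow> closed {z. Q x z}"
  shows "closed {z. \<forall>x\<in>X. Q x z}"
proof -
  have "{z. \<forall>x\<in>X. Q x z} = (\<Inter>x\<in>X. {z. Q x z})" by auto
  then show ?thesis using assms by auto
qed

lemma compact_function_box: "compact {w :: 'a \<Rightarrow> real. \<forall>i. \<bar>w i\<bar> \<le> N}"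
proof -
  have "compactin (product_topology (\<lambda>_::'a. euclidean) UNIV) (PiE UNIV (\<lambda>_. {- N..N}))"
    by (simp add: compactin_PiE)
  then have "compact (PiE UNIV (\<lambda>_::'a. {- N..N}))"
    by (simp add: euclidean_product_topology)
  also have "PiE UNIV (\<lambda>_::'a. {- N..N}) = {w. \<forall>i. \<bar>w i\<bar> \<le> N}"
  proof -
    have "x \<in> {- N..N} \<longleftrightarrow> \<bar>x\<bar> \<le> N" for x by auto
    then show ?thesis by (simp only: PiE_UNIV_domain Pi_def UNIV_I simp_thms)
  qed
  finally show ?thesis .
qed

text \<open>A witness of failure consists of \<open>b\<close> (tag 0), the two vectors (tags 1 and 2), for every
  block set \<open>T\<close> a certificate that the blocks in \<open>T\<close> are not simultaneously solvable (tag 3), and the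
  inverse of the squared distance of the two vectors (tag 4). All conditions on it are closed.\<close>

type_synonym witness = "nat \<times> nat set \<times> nat \<times> nat \<Rightarrow> real"

definition wvec :: "nat \<Rightarrow> nat \<Rightarrow> witness \<Rightarrow> nat \<Rightarrow> real" where
  "wvec n a w j = (if j < n then w (a, {}, 0, j) else 0)"

definition wrhs :: "witness \<Rightarrow> nat \<Rightarrow> nat \<Rightarrow> real" where "wrhs w i r = w (0, {}, i, r)"

definition failure_witness :: "nat \<Rightarrow> nat \<Rightarrow> nat \<Rightarrow> nat \<Rightarrow> nat set \<Rightarrow> (nat \<times> nat \<times> nat \<Rightarrow> real) \<Rightarrow> witness \<Rightarrow> bool" where
  "failure_witness k m n s S A w \<longleftrightarrow>
     (\<forall>i\<in>S. \<forall>r\<in>{..<m}. wrhs w i r = blk_mul n A i (wvec n 1 w) r) \<and>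
     (\<forall>T\<in>{T. T \<subseteq> {..<k} \<and> card T > s}.
        (\<forall>j\<in>{..<n}. (\<Sum>x\<in>T \<times> {..<m}. w (3, T, x) * A (fst x, snd x, j)) = 0) \<and>
        (\<Sum>x\<in>T \<times> {..<m}. w (3, T, x) * wrhs w (fst x) (snd x)) = 1) \<and>
     w (4, {}, 0, 0) * (\<Sum>j<n. (wvec n 2 w j - wvec n 1 w j)\<^sup>2) = 1 \<and>
     obj k m n A (wrhs w) (wvec n 2 w) \<le> obj k m n A (wrhs w) (wvec n 1 w)"

lemma closed_failure_witness: "closed {z. failure_witness k m n s S (fst z) (snd z)}"
proof -
  have 1: "continuous_on UNIV (\<lambda>z :: (nat \<times> nat \<times> nat \<Rightarrow> real) \<times> witness. fst z x)" for x
    by (rule continuous_on_compose2[OF continuous_on_product_coordinates continuous_on_fst[OF continuous_on_id]]) auto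
  have 2: "continuous_on UNIV (\<lambda>z :: (nat \<times> nat \<times> nat \<Rightarrow> real) \<times> witness. snd z x)" for x
    by (rule continuous_on_compose2[OF continuous_on_product_coordinates continuous_on_snd[OF continuous_on_id]]) auto
  have v: "continuous_on UNIV (\<lambda>z :: (nat \<times> nat \<times> nat \<Rightarrow> real) \<times> witness. wvec n a (snd z) j)" for a j
    unfolding wvec_def by (cases "j < n") (simp_all add: 2)
  have r: "continuous_on UNIV (\<lambda>z :: (nat \<times> nat \<times> nat \<Rightarrow> real) \<times> witness. wrhs (snd z) i r)" for i r
    unfolding wrhs_def by (rule 2)
  have b: "continuous_on UNIV (\<lambda>z :: (nat \<times> nat \<times> nat \<Rightarrow> real) \<times> witness. blk_mul n (fst z) i (wvec n a (snd z)) r)" for a i r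
    unfolding blk_mul_def by (intro continuous_intros 1 v)
  have o: "continuous_on UNIV (\<lambda>z :: (nat \<times> nat \<times> nat \<Rightarrow> real) \<times> witness. obj k m n (fst z) (wrhs (snd z)) (wvec n a (snd z)))" for a
    unfolding obj_def by (intro continuous_intros r b)
  show ?thesis
    unfolding failure_witness_def
    by (intro closed_Collect_conj closed_Collect_Ball closed_Collect_eq closed_Collect_le continuous_on_sum
        continuous_on_mult continuous_on_power continuous_on_diff continuous_on_const 1 2 v r b o)
qed

lemma blk_mul_cong: "(\<And>j. j < n \<Longrightarrow> A (i, r, j) = A' (i, r, j)) \<Longrightarrow> (\<And>j. j < n \<Longrightarrow> x j = x' j) \<Longrightarrow>
    blk_mul n A i x r = blk_mul n A' i x' r"
  unfolding blk_mul_def by (intro sum.cong) auto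

lemma wvec_in_vecs: "wvec n a w \<in> vecs n"
  by (simp add: vecs_def wvec_def)

text \<open>Solving the blocks in \<open>S\<close> is a closed condition, whereas missing all others
  is not. The certificates replace it: no vector solves more than \<open>s\<close> blocks, so the
  first vector solves exactly \<open>s\<close> and is a maximizer.\<close>

lemma failure_witness_imp_not_recovery:
  assumes S: "S \<subseteq> {..<k}" "card S = s" and w: "failure_witness k m n s S A w"
  shows "\<not> recovery_event k m n s A"
proof
  assume rec: "recovery_event k m n s A"
  let ?b = "wrhs w" and ?p = "wvec n 1 w" and ?q = "wvec n 2 w"
  define sat where "sat x = {i. i < k \<and> (\<forall>r<m. ?b i r = blk_mul n A i x r)}" for x
  have le: "card (sat x) \<le> s" for x
  proof (rule ccontr)
    assume "\<not> card (sat x) \<le> s"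
    then have T: "sat x \<in> {T. T \<subseteq> {..<k} \<and> card T > s}" by (auto simp: sat_def)
    have "(\<Sum>z\<in>sat x \<times> {..<m}. w (3, sat x, z) * ?b (fst z) (snd z)) = 0"
    proof (rule fredholm_exclusive[where n=n and v="\<lambda>j z. A (fst z, snd z, j)" and x=x])
      show "?b (fst z) (snd z) = (\<Sum>j<n. A (fst z, snd z, j) * x j)" if "z \<in> sat x \<times> {..<m}" for z
        using that by (auto simp: sat_def blk_mul_def)
      show "(\<Sum>z\<in>sat x \<times> {..<m}. w (3, sat x, z) * A (fst z, snd z, j)) = 0" if "j < n" for j
        using w T that unfolding failure_witness_def by blast
    qed
    moreover have "(\<Sum>z\<in>sat x \<times> {..<m}. w (3, sat x, z) * ?b (fst z) (snd z)) = 1"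
      using w T unfolding failure_witness_def by blast
    ultimately show False by simp
  qed
  have "S \<subseteq> sat ?p" using w S unfolding failure_witness_def sat_def by auto
  then have "s \<le> card (sat ?p)" using S by (auto simp: sat_def intro!: card_mono)
  then have num: "num_sat k m n A ?b ?p = s" "\<And>x. num_sat k m n A ?b x \<le> s"
    using antisym[OF le] le unfolding num_sat_def sat_def by blast+
  have "?q \<noteq> ?p"
  proof
    assume "?q = ?p"
    then show False using w unfolding failure_witness_def by simp
  qed
  then have "obj k m n A ?b ?p < obj k m n A ?b ?q"
    using rec num wvec_in_vecs unfolding recovery_event_def by (auto simp: num)
  then show False using w unfolding failure_witness_def by simp
qed

lemma not_recovery_imp_failure_witness:
  assumes "\<not> recovery_event k m n s A"
  obtains S w where "S \<subseteq> {..<k}" "card S = s" "failure_witness k m n s S A w"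
proof -
  from assms obtain b x0 x where x0: "x0 \<in> vecs n" "x \<in> vecs n" "x \<noteq> x0"
    and max: "\<And>x. x \<in> vecs n \<Longrightarrow> num_sat k m n A b x \<le> num_sat k m n A b x0"
    and num: "num_sat k m n A b x0 = s" and obj: "obj k m n A b x \<le> obj k m n A b x0"
    unfolding recovery_event_def by (auto simp: not_less)
  define S where "S = {i. i < k \<and> (\<forall>r<m. b i r = blk_mul n A i x0 r)}"
  have S: "S \<subseteq> {..<k}" "card S = s" using num by (auto simp: S_def num_sat_def)
  have "\<exists>y. (\<forall>j<n. (\<Sum>z\<in>T \<times> {..<m}. y z * A (fst z, snd z, j)) = 0) \<and>
      (\<Sum>z\<in>T \<times> {..<m}. y z * b (fst z) (snd z)) = 1" if T: "T \<subseteq> {..<k}" "card T > s" for T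
  \<comment> \<open>If the blocks of \<open>T\<close> were solvable together, the solution, cut off
    beyond \<open>n\<close>, would satisfy more blocks than the maximizer \<open>x0\<close>.\<close>
  proof (rule ccontr)
    assume no: "\<not> ?thesis"
    have "finite (T \<times> {..<m})" using T finite_subset by auto
    from fredholm_alternative[OF this, where b="\<lambda>z. b (fst z) (snd z)" and n=n and v="\<lambda>j z. A (fst z, snd z, j)"] no
    obtain u where u: "\<And>z. z \<in> T \<times> {..<m} \<Longrightarrow> b (fst z) (snd z) = (\<Sum>j<n. A (fst z, snd z, j) * u j)"
      by blast
    define u' where "u' j = (if j < n then u j else 0)" for j
    have "b i r = blk_mul n A i u' r" if "i \<in> T" "r < m" for i r
      using u[of "(i, r)"] that by (auto simp: blk_mul_def u'_def intro!: sum.cong)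
    then have "T \<subseteq> {i. i < k \<and> (\<forall>r<m. b i r = blk_mul n A i u' r)}" using T by auto
    then have "card T \<le> num_sat k m n A b u'" unfolding num_sat_def by (intro card_mono) auto
    moreover have "u' \<in> vecs n" by (simp add: vecs_def u'_def)
    ultimately show False using max[of u'] num T by linarith
  qed
  note certificate = this
  define Y where "Y T = (SOME y. (\<forall>j<n. (\<Sum>z\<in>T \<times> {..<m}. y z * A (fst z, snd z, j)) = 0) \<and>
      (\<Sum>z\<in>T \<times> {..<m}. y z * b (fst z) (snd z)) = 1)" for T
  have Y: "(\<forall>j<n. (\<Sum>z\<in>T \<times> {..<m}. Y T z * A (fst z, snd z, j)) = 0) \<and>
      (\<Sum>z\<in>T \<times> {..<m}. Y T z * b (fst z) (snd z)) = 1" if "T \<subseteq> {..<k}" "card T > s" for T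
    unfolding Y_def by (rule someI_ex[OF certificate[OF that]])
  define dd where "dd = (\<Sum>j<n. (x j - x0 j)\<^sup>2)"
  define w :: witness where "w = (\<lambda>(a, T, i, r). if a = 0 then b i r else if a = 1 then x0 r else if a = 2 then x r
      else if a = 3 then Y T (i, r) else 1 / dd)"
  have v: "wvec n 1 w = x0" "wvec n 2 w = x" "wrhs w = b"
    using x0 by (auto simp: fun_eq_iff wvec_def w_def vecs_def wrhs_def)
  have "dd \<noteq> 0"
  proof
    assume "dd = 0"
    then have "x j = x0 j" if "j < n" for j
      using that sum_nonneg_eq_0_iff[of "{..<n}" "\<lambda>j. (x j - x0 j)\<^sup>2"] by (simp add: dd_def)
    moreover have "x j = x0 j" if "j \<ge> n" for j using that x0 by (simp add: vecs_def)
    ultimately have "x = x0" by (intro ext) (metis not_le)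
    then show False using x0 by simp
  qed
  moreover have w4: "w (4, {}, 0, 0) = 1 / dd" and w3: "\<And>T z. w (3, T, z) = Y T z" by (auto simp: w_def)
  ultimately have "w (4, {}, 0, 0) * (\<Sum>j<n. (x j - x0 j)\<^sup>2) = 1" by (simp add: dd_def)
  moreover have "\<forall>i\<in>S. \<forall>r\<in>{..<m}. b i r = blk_mul n A i x0 r" by (simp add: S_def)
  ultimately have "failure_witness k m n s S A w"
    unfolding failure_witness_def v w3 using obj Y by (intro conjI ballI) blast+
  then show ?thesis using S that by blast
qed

text \<open>Only finitely many coordinates of a witness are inspected; setting the others to zero
  puts it into a box of integer radius, and countably many such boxes suffice.\<close>

lemma failure_witness_bounded:
  assumes S: "S \<subseteq> {..<k}" and w: "failure_witness k m n s S A w"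
  obtains w' and N :: nat where "failure_witness k m n s S A w'" "\<And>z. \<bar>w' z\<bar> \<le> N"
proof -
  define Z where "Z = {0::nat} \<times> {{}} \<times> {..<k} \<times> {..<m} \<union> {1, 2} \<times> {{}} \<times> {0} \<times> {..<n} \<union>
     {3} \<times> Pow {..<k} \<times> {..<k} \<times> {..<m} \<union> {(4, {}, 0, 0)}"
  have Z: "finite Z" by (simp add: Z_def)
  define w' where "w' z = (if z \<in> Z then w z else 0)" for z
  have v: "wvec n 1 w' = wvec n 1 w" "wvec n 2 w' = wvec n 2 w"
    by (auto simp: fun_eq_iff wvec_def w'_def Z_def)
  have b: "wrhs w' i r = wrhs w i r" if "i < k" "r < m" for i r
    using that by (auto simp: wrhs_def w'_def Z_def)
  have y: "w' (3, T, z) = w (3, T, z)" if "T \<subseteq> {..<k}" "z \<in> T \<times> {..<m}" for T z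
    using that by (auto simp: w'_def Z_def)
  have y4: "w' (4, {}, 0, 0) = w (4, {}, 0, 0)" by (auto simp: w'_def Z_def)
  have o: "obj k m n A (wrhs w') x = obj k m n A (wrhs w) x" for x
    unfolding obj_def using b by (intro sum.cong arg_cong[where f=sqrt]) auto
  have s1: "(\<Sum>z\<in>T \<times> {..<m}. w' (3, T, z) * A (fst z, snd z, j)) = (\<Sum>z\<in>T \<times> {..<m}. w (3, T, z) * A (fst z, snd z, j))"
    if "T \<subseteq> {..<k}" for T j using that y by (intro sum.cong) auto
  have s2: "(\<Sum>z\<in>T \<times> {..<m}. w' (3, T, z) * wrhs w' (fst z) (snd z)) = (\<Sum>z\<in>T \<times> {..<m}. w (3, T, z) * wrhs w (fst z) (snd z))"
    if "T \<subseteq> {..<k}" for T using that y b by (intro sum.cong) auto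
  have "failure_witness k m n s S A w'"
    using w S unfolding failure_witness_def v y4 o by (simp add: s1 s2 b subset_eq)
  moreover have "\<bar>w' z\<bar> \<le> nat \<lceil>\<Sum>z\<in>Z. \<bar>w z\<bar>\<rceil>" for z
  proof -
    have "\<bar>w' z\<bar> \<le> (\<Sum>z\<in>Z. \<bar>w z\<bar>)"
      using Z member_le_sum[of z Z "\<lambda>z. \<bar>w z\<bar>"] by (auto simp: w'_def sum_nonneg)
    also have "\<dots> \<le> nat \<lceil>\<Sum>z\<in>Z. \<bar>w z\<bar>\<rceil>" by linarith
    finally show ?thesis .
  qed
  ultimately show ?thesis by (rule that)
qed

lemma borel_not_recovery: "{A. \<not> recovery_event k m n s A} \<in> sets borel"
proof -
  define X where "X S N = {A. \<exists>w\<in>{w. \<forall>i. \<bar>w i\<bar> \<le> real N}. (A, w) \<in> {z. failure_witness k m n s S (fst z) (snd z)}}" for S and N :: nat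
  have "{A. \<not> recovery_event k m n s A} = (\<Union>S\<in>{S. S \<subseteq> {..<k} \<and> card S = s}. \<Union>N. X S N)"
  proof (intro equalityI subsetI)
    fix A assume "A \<in> {A. \<not> recovery_event k m n s A}"
    then obtain S w where S: "S \<subseteq> {..<k}" "card S = s" and "failure_witness k m n s S A w"
      using not_recovery_imp_failure_witness by blast
    then obtain w' and N :: nat where "failure_witness k m n s S A w'" "\<And>z. \<bar>w' z\<bar> \<le> N"
      using failure_witness_bounded by blast
    then show "A \<in> (\<Union>S\<in>{S. S \<subseteq> {..<k} \<and> card S = s}. \<Union>N. X S N)" using S by (auto simp: X_def)
  next
    fix A assume "A \<in> (\<Union>S\<in>{S. S \<subseteq> {..<k} \<and> card S = s}. \<Union>N. X S N)"
    then obtain S w where "S \<subseteq> {..<k}" "card S = s" "failure_witness k m n s S A w" by (auto simp: X_def)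
    from failure_witness_imp_not_recovery[OF this] show "A \<in> {A. \<not> recovery_event k m n s A}" by simp
  qed
  moreover have "X S N \<in> sets borel" for S N
    unfolding X_def by (intro borel_closed closed_projection_compact compact_function_box closed_failure_witness)
  moreover have "countable {S. S \<subseteq> {..<k} \<and> card S = s}" by (intro countable_finite) auto
  ultimately show ?thesis by (auto intro!: sets.countable_UN' sets.countable_UN)
qed

lemma recovery_event_cong:
  assumes "\<And>i r j. i < k \<Longrightarrow> r < m \<Longrightarrow> j < n \<Longrightarrow> A (i, r, j) = A' (i, r, j)"
  shows "recovery_event k m n s A = recovery_event k m n s A'"
proof -
  have b: "blk_mul n A i x r = blk_mul n A' i x r" if "i < k" "r < m" for i r x
    using assms that by (intro blk_mul_cong) auto
  have 1: "num_sat k m n A = num_sat k m n A'"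
    unfolding num_sat_def using b by (intro ext arg_cong[where f=card]) auto
  have 2: "obj k m n A = obj k m n A'"
    unfolding obj_def using b by (intro ext sum.cong arg_cong[where f=sqrt]) auto
  show ?thesis unfolding recovery_event_def 1 2 ..
qed

text \<open>Elements of the product space are undefined off the index set. Extending them by zero
  maps into the full function space, where, the index type being countable, the product
  sigma-algebra is the Borel one.\<close>

lemma recovery_event_measurable:
  "{A \<in> space (gauss_blocks k m n). recovery_event k m n s A} \<in> sets (gauss_blocks k m n)"
proof -
  let ?I = "{..<k} \<times> {..<m} \<times> {..<n}"
  define ext where "ext A x = (if x \<in> ?I then A x else 0)" for A :: "nat \<times> nat \<times> nat \<Rightarrow> real" and x
  have "(\<lambda>A x. ext A x) \<in> measurable (gauss_blocks k m n) (PiM UNIV (\<lambda>_. borel))"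
  proof (rule measurable_abs_UNIV)
    fix x
    show "(\<lambda>A. ext A x) \<in> borel_measurable (gauss_blocks k m n)"
      using measurable_component_singleton[of x ?I "\<lambda>_. std_gauss"] unfolding ext_def gauss_blocks_def
      by (cases "x \<in> ?I") (simp_all cong: measurable_cong_sets)
  qed
  then have m: "ext \<in> borel_measurable (gauss_blocks k m n)"
    by (simp cong: measurable_cong_sets add: sets_PiM_equal_borel)
  have "{A. recovery_event k m n s A} = UNIV - {A. \<not> recovery_event k m n s A}" by auto
  then have "{A. recovery_event k m n s A} \<in> sets borel"
    using borel_not_recovery[of k m n s] by (auto intro: borel_comp simp: Compl_eq_Diff_UNIV[symmetric])
  from measurable_sets[OF m this]
  have "ext -` {A. recovery_event k m n s A} \<inter> space (gauss_blocks k m n) \<in> sets (gauss_blocks k m n)" .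
  moreover have "recovery_event k m n s (ext A) = recovery_event k m n s A" for A
    by (rule recovery_event_cong) (auto simp: ext_def)
  then have "ext -` {A. recovery_event k m n s A} \<inter> space (gauss_blocks k m n) =
      {A \<in> space (gauss_blocks k m n). recovery_event k m n s A}" by auto
  ultimately show ?thesis by simp
qed

section \<open>Reduction of failure to a direction on the unit sphere\<close>

text \<open>Moving from \<open>x0\<close> to a competitor creates the full norm of the increment on
  \<open>S\<close>, where the residual is zero, and by the triangle inequality saves at most that
  norm elsewhere. Homogeneity allows the increment to be normalized.\<close>

lemma failure_imp_nonpos_direction:
  assumes "\<not> recovery_event k m n s A"
  obtains S h where "S \<subseteq> {..<k}" "card S = s" "(\<Sum>j<n. (h j)\<^sup>2) = 1"
    "(\<Sum>i<k. (if i \<in> S then 1 else - 1) * L2_set (blk_mul n A i h) {..<m}) \<le> 0"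
proof -
  from assms obtain b x0 x where x0: "x0 \<in> vecs n" "x \<in> vecs n" "x \<noteq> x0"
    and num: "num_sat k m n A b x0 = s" and obj: "obj k m n A b x \<le> obj k m n A b x0"
    unfolding recovery_event_def by (auto simp: not_less)
  define S where "S = {i. i < k \<and> (\<forall>r<m. b i r = blk_mul n A i x0 r)}"
  have S: "S \<subseteq> {..<k}" "card S = s" using num by (auto simp: S_def num_sat_def)
  define d where "d j = x j - x0 j" for j
  define e where "e i r = b i r - blk_mul n A i x0 r" for i r
  have lin: "b i r - blk_mul n A i x r = e i r - blk_mul n A i d r" for i r
    by (simp add: e_def blk_mul_def d_def right_diff_distrib sum_subtractf)
  let ?N = "\<lambda>z. L2_set z {..<m}"
  have o: "obj k m n A b x0 = (\<Sum>i<k. ?N (e i))" "obj k m n A b x = (\<Sum>i<k. ?N (\<lambda>r. e i r - blk_mul n A i d r))"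
    by (simp_all add: obj_def L2_set_def lin) (simp add: e_def)
  have "(if i \<in> S then 1 else - 1) * ?N (blk_mul n A i d) \<le> ?N (\<lambda>r. e i r - blk_mul n A i d r) - ?N (e i)" if "i < k" for i
  proof (cases "i \<in> S")
    case True
    then have "e i r = 0" if "r < m" for r using that by (simp add: S_def e_def)
    then show ?thesis using True by (simp add: L2_set_def)
  next
    case False
    have "?N (e i) \<le> ?N (\<lambda>r. e i r - blk_mul n A i d r) + ?N (blk_mul n A i d)"
      using L2_set_triangle_ineq[of "\<lambda>r. e i r - blk_mul n A i d r" "blk_mul n A i d" "{..<m}"] by simp
    then show ?thesis using False by simp
  qed
  then have "(\<Sum>i<k. (if i \<in> S then 1 else - 1) * ?N (blk_mul n A i d)) \<le> (\<Sum>i<k. ?N (\<lambda>r. e i r - blk_mul n A i d r) - ?N (e i))"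
    by (intro sum_mono) auto
  then have neg: "(\<Sum>i<k. (if i \<in> S then 1 else - 1) * ?N (blk_mul n A i d)) \<le> 0"
    using obj by (simp add: o sum_subtractf)
  define \<rho> where "\<rho> = sqrt (\<Sum>j<n. (d j)\<^sup>2)"
  have "(\<Sum>j<n. (d j)\<^sup>2) \<noteq> 0"
  proof
    assume "(\<Sum>j<n. (d j)\<^sup>2) = 0"
    then have "x j = x0 j" if "j < n" for j
      using that sum_nonneg_eq_0_iff[of "{..<n}" "\<lambda>j. (d j)\<^sup>2"] by (simp add: d_def)
    moreover have "x j = x0 j" if "j \<ge> n" for j using that x0 by (simp add: vecs_def)
    ultimately have "x = x0" by (intro ext) (metis not_le)
    then show False using x0 by simp
  qed
  moreover have "(\<Sum>j<n. (d j)\<^sup>2) \<ge> 0" by (intro sum_nonneg) auto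
  ultimately have \<rho>: "\<rho> > 0" "\<rho>\<^sup>2 = (\<Sum>j<n. (d j)\<^sup>2)" unfolding \<rho>_def by auto
  define h where "h j = (1 / \<rho>) * d j" for j
  have "(\<Sum>j<n. (h j)\<^sup>2) = (1 / \<rho>)\<^sup>2 * (\<Sum>j<n. (d j)\<^sup>2)"
    by (simp only: h_def power_mult_distrib sum_distrib_left)
  then have unit: "(\<Sum>j<n. (h j)\<^sup>2) = 1" using \<rho>(1) unfolding \<rho>(2)[symmetric] by (simp add: power_divide)
  have bh: "blk_mul n A i h = (\<lambda>r. (1 / \<rho>) * blk_mul n A i d r)" for i
    by (rule ext) (simp add: blk_mul_def h_def sum_distrib_left sum_divide_distrib)
  have Nh: "?N (blk_mul n A i h) = (1 / \<rho>) * ?N (blk_mul n A i d)" for i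
    unfolding bh using L2_set_right_distrib[of "1 / \<rho>" "blk_mul n A i d" "{..<m}"] \<rho> by simp
  have "(\<Sum>i<k. (if i \<in> S then 1 else - 1) * ?N (blk_mul n A i h)) =
      (1 / \<rho>) * (\<Sum>i<k. (if i \<in> S then 1 else - 1) * ?N (blk_mul n A i d))"
    unfolding Nh sum_distrib_left by (intro sum.cong refl) (simp only: mult.left_commute)
  also have "\<dots> \<le> 0" using \<rho> neg by (intro mult_nonneg_nonpos) auto
  finally show ?thesis using that[OF S unit] by simp
qed

lemma smooth_gap_le:
  assumes "\<And>i. \<bar>sg i\<bar> \<le> 1"
  shows "smooth_gap k m sg z \<le> (\<Sum>i<k. sg i * L2_set (z i) {..<m}) + k"
proof -
  have "smooth_gap k m sg z \<le> (\<Sum>i<k. sg i * L2_set (z i) {..<m} + 1)"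
    unfolding smooth_gap_def
  proof (rule sum_mono)
    fix i
    let ?N = "L2_set (z i) {..<m}" and ?q = "sqrt (1 + (\<Sum>r<m. (z i r)\<^sup>2))"
    have "?q \<le> sqrt 1 + sqrt (\<Sum>r<m. (z i r)\<^sup>2)" by (rule sqrt_add_le_add_sqrt) (auto intro: sum_nonneg)
    moreover have "sqrt (\<Sum>r<m. (z i r)\<^sup>2) \<le> ?q" by simp
    ultimately have q: "0 \<le> ?q - ?N" "?q - ?N \<le> 1" by (simp_all add: L2_set_def)
    have "sg i * (?q - ?N) \<le> \<bar>sg i * (?q - ?N)\<bar>" by (rule abs_ge_self)
    also have "\<dots> \<le> 1 * 1" unfolding abs_mult using q assms by (intro mult_mono) auto
    finally show "sg i * ?q \<le> sg i * ?N + 1" by (simp add: right_diff_distrib)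
  qed
  then show ?thesis by (simp add: sum.distrib)
qed

section \<open>From finite sets of directions to the whole sphere\<close>

text \<open>The events for initial segments of an enumeration of \<open>D\<close> increase to the
  union, and the finite bound is the same for all of them.\<close>

lemma gordon_prob_countable:
  fixes k m n :: nat and c l :: real and sg :: "nat \<Rightarrow> real" and D :: "(nat \<Rightarrow> real) set"
  assumes sg: "\<And>i. \<bar>sg i\<bar> \<le> 1" and l: "l > 0" and k: "k > 0" and D: "countable D"
    and unit: "\<And>h. h \<in> D \<Longrightarrow> (\<Sum>j<n. (h j)\<^sup>2) = 1"
  defines "E \<equiv> (\<lambda>h. {A \<in> space (gauss_blocks k m n). smooth_gap k m sg (\<lambda>i r. blk_mul n A i h r) \<le> c})"
  shows "(\<Union>h\<in>D. E h) \<in> sets (gauss_blocks k m n)"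
    and "measure (gauss_blocks k m n) (\<Union>h\<in>D. E h) \<le> exp (l * c - l\<^sup>2 * k / 2) * gordon_moment k m n sg l"
proof -
  interpret prob_space "gauss_blocks k m n"
    unfolding gauss_blocks_def by (intro prob_space_PiM prob_space_std_gauss)
  have [measurable]: "(\<lambda>A. smooth_gap k m sg (\<lambda>i r. blk_mul n A i h r)) \<in> borel_measurable (gauss_blocks k m n)" for h
    unfolding gauss_blocks_def by (intro smooth_gap_measurable blk_mul_measurable) auto
  have E: "E h \<in> sets (gauss_blocks k m n)" for h unfolding E_def by measurable
  then show "(\<Union>h\<in>D. E h) \<in> sets (gauss_blocks k m n)" using D by (intro sets.countable_UN') auto
  let ?b = "exp (l * c - l\<^sup>2 * k / 2) * gordon_moment k m n sg l"
  show "measure (gauss_blocks k m n) (\<Union>h\<in>D. E h) \<le> ?b"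
  proof (cases "D = {}")
    case True
    then show ?thesis by (simp add: gordon_moment_def)
  next
    case False
    define X where "X N = (\<Union>h\<in>from_nat_into D ` {..N}. E h)" for N :: nat
    have "(\<Union>N. X N) = (\<Union>h\<in>range (from_nat_into D). E h)" by (auto simp: X_def)
    then have U: "(\<Union>N. X N) = (\<Union>h\<in>D. E h)" using range_from_nat_into[OF False D] by simp
    have "(\<lambda>N. measure (gauss_blocks k m n) (X N)) \<longlonglongrightarrow> measure (gauss_blocks k m n) (\<Union>N. X N)"
    proof (rule finite_Lim_measure_incseq)
      show "range X \<subseteq> sets (gauss_blocks k m n)" using E by (auto simp: X_def)
      show "incseq X" unfolding incseq_def X_def by (intro allI impI UN_mono image_mono) auto
    qed
    moreover have "measure (gauss_blocks k m n) (X N) \<le> ?b" for N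
    proof -
      have "X N = {A \<in> space (gauss_blocks k m n). \<exists>h\<in>from_nat_into D ` {..N}. smooth_gap k m sg (\<lambda>i r. blk_mul n A i h r) \<le> c}"
        by (auto simp: X_def E_def)
      also have "measure (gauss_blocks k m n) \<dots> \<le> ?b"
        using from_nat_into[OF False] unit by (intro gordon_prob_finite sg l k) auto
      finally show ?thesis .
    qed
    ultimately show ?thesis unfolding U by (intro LIMSEQ_le_const2) auto
  qed
qed

lemma continuous_on_smooth_gap: "continuous_on UNIV (\<lambda>h. smooth_gap k m sg (\<lambda>i r. blk_mul n A i h r))"
proof -
  have "continuous_on UNIV (\<lambda>h. blk_mul n A i h r)" for i r
    unfolding blk_mul_def by (intro continuous_on_sum continuous_on_mult continuous_on_const continuous_on_product_coordinates)
  then show ?thesis unfolding smooth_gap_def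
    by (intro continuous_on_sum continuous_on_mult continuous_on_const continuous_on_add continuous_on_power continuous_on_real_sqrt)
qed

text \<open>The number \<open>3 * k + 1\<close> consists of the threshold \<open>k + 1\<close> and
  the \<open>2 * k\<close> of the moment bound; the term \<open>l\<^sup>2 * k / 2\<close> is what
  remains of \<open>l\<^sup>2 * k\<close> after the gain from the scalar Gaussian. A union bound
  over the sets \<open>S\<close> gives \<open>2 ^ k\<close>.\<close>

lemma failure_probability:
  assumes k: "k > 0" and m: "m > 0" and n: "n > 0" and l: "l > 0"
  shows "measure (gauss_blocks k m n) {A \<in> space (gauss_blocks k m n). \<not> recovery_event k m n s A} \<le>
    2 ^ k * ((real m + 2) ^ k * exp (l * (3 * real k + 1) - l * ((2 * real s - real k) * sqrt m - sqrt k * sqrt n) + l\<^sup>2 * k / 2))"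
proof -
  interpret prob_space "gauss_blocks k m n"
    unfolding gauss_blocks_def by (intro prob_space_PiM prob_space_std_gauss)
  let ?G = "gauss_blocks k m n" and ?sg = "\<lambda>S i. if i \<in> S then 1 else - 1 :: real"
  define \<S> where "\<S> = {S. S \<subseteq> {..<k} \<and> card S = s}"
  have \<S>: "finite \<S>" "card \<S> \<le> 2 ^ k"
  proof -
    have sub: "\<S> \<subseteq> Pow {..<k}" by (auto simp: \<S>_def)
    then show "finite \<S>" by (rule finite_subset) simp
    show "card \<S> \<le> 2 ^ k" using card_mono[OF _ sub] by (simp add: card_Pow)
  qed
  define Sph where "Sph = {h :: nat \<Rightarrow> real. (\<Sum>j<n. (h j)\<^sup>2) = 1}"
  obtain D where D: "countable D" "D \<subseteq> Sph" "Sph \<subseteq> closure D" using separable[of Sph] by blast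
  define E where "E S = (\<Union>h\<in>D. {A \<in> space ?G. smooth_gap k m (?sg S) (\<lambda>i r. blk_mul n A i h r) \<le> real k + 1})" for S
  let ?b = "(real m + 2) ^ k * exp (l * (3 * real k + 1) - l * ((2 * real s - real k) * sqrt m - sqrt k * sqrt n) + l\<^sup>2 * k / 2)"
  have E: "E S \<in> sets ?G" "measure ?G (E S) \<le> ?b" if "S \<in> \<S>" for S
  proof -
    have unit: "\<And>h. h \<in> D \<Longrightarrow> (\<Sum>j<n. (h j)\<^sup>2) = 1" using D by (auto simp: Sph_def)
    have sg: "\<And>i. \<bar>?sg S i\<bar> \<le> 1" by simp
    note g = gordon_prob_countable[where sg="?sg S" and D=D and c="real k + 1" and l=l and k=k and m=m and n=n, OF sg l k D(1) unit, folded E_def]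
    show "E S \<in> sets ?G" by (rule g(1))
    have S: "S \<subseteq> {..<k}" "card S = s" using that by (auto simp: \<S>_def)
    have "measure ?G (E S) \<le> exp (l * (real k + 1) - l\<^sup>2 * k / 2) * gordon_moment k m n (?sg S) l" by (rule g(2))
    also have "\<dots> \<le> exp (l * (real k + 1) - l\<^sup>2 * k / 2) *
        ((real m + 2) ^ k * exp (2 * l * k - l * ((2 * real (card S) - real k) * sqrt m - sqrt k * sqrt n) + l\<^sup>2 * k))"
      by (intro mult_left_mono gordon_moment_le k m n l S) auto
    also have "\<dots> = (real m + 2) ^ k * exp ((l * (real k + 1) - l\<^sup>2 * k / 2) +
        (2 * l * k - l * ((2 * real s - real k) * sqrt m - sqrt k * sqrt n) + l\<^sup>2 * k))"
      unfolding S(2) exp_add by (simp only: mult_ac)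
    also have "(l * (real k + 1) - l\<^sup>2 * k / 2) + (2 * l * k - l * ((2 * real s - real k) * sqrt m - sqrt k * sqrt n) + l\<^sup>2 * k)
       = l * (3 * real k + 1) - l * ((2 * real s - real k) * sqrt m - sqrt k * sqrt n) + l\<^sup>2 * k / 2"
      by (simp add: algebra_simps)
    finally show "measure ?G (E S) \<le> ?b" .
  qed
  have "{A \<in> space ?G. \<not> recovery_event k m n s A} \<subseteq> (\<Union>S\<in>\<S>. E S)"
  proof
    fix A assume A: "A \<in> {A \<in> space ?G. \<not> recovery_event k m n s A}"
    then have "\<not> recovery_event k m n s A" by simp
    then obtain S h where "S \<subseteq> {..<k}" "card S = s" "(\<Sum>j<n. (h j)\<^sup>2) = 1"
      and neg: "(\<Sum>i<k. ?sg S i * L2_set (blk_mul n A i h) {..<m}) \<le> 0"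
      by (rule failure_imp_nonpos_direction)
    then have S: "S \<in> \<S>" and h: "h \<in> Sph" by (auto simp: \<S>_def Sph_def)
    \<comment> \<open>Smoothing raises a nonpositive gap to at most \<open>k\<close>. The threshold
      \<open>k + 1\<close> leaves room for a strict inequality, which is open in \<open>h\<close>
      and hence also holds at some point of the dense set \<open>D\<close>.\<close>
    define V where "V = {h. smooth_gap k m (?sg S) (\<lambda>i r. blk_mul n A i h r) < real k + 1}"
    have "open V" unfolding V_def by (intro open_Collect_less continuous_on_smooth_gap continuous_on_const)
    moreover have "h \<in> V"
    proof -
      have "smooth_gap k m (?sg S) (\<lambda>i r. blk_mul n A i h r) \<le> (\<Sum>i<k. ?sg S i * L2_set (blk_mul n A i h) {..<m}) + k"
        by (rule smooth_gap_le) simp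
      then show ?thesis using neg unfolding V_def by simp
    qed
    moreover have "h \<in> closure D" using h D by blast
    ultimately obtain h' where "h' \<in> D" "h' \<in> V" using open_Int_closure_eq_empty[of V D] by blast
    then have "A \<in> E S" using A unfolding E_def V_def by (auto intro: less_imp_le)
    then show "A \<in> (\<Union>S\<in>\<S>. E S)" using S by blast
  qed
  then have "measure ?G {A \<in> space ?G. \<not> recovery_event k m n s A} \<le> measure ?G (\<Union>S\<in>\<S>. E S)"
    using \<S>(1) E by (intro finite_measure_mono) auto
  also have "\<dots> \<le> (\<Sum>S\<in>\<S>. measure ?G (E S))"
    using \<S>(1) E by (intro finite_measure_subadditive_finite) auto
  also have "\<dots> \<le> (\<Sum>S\<in>\<S>. ?b)" by (intro sum_mono E)
  also have "\<dots> = card \<S> * ?b" by simp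
  also have "\<dots> \<le> 2 ^ k * ?b"
  proof (rule mult_right_mono)
    show "real (card \<S>) \<le> 2 ^ k" using \<S>(2) by (metis of_nat_le_iff of_nat_numeral of_nat_power)
  qed simp
  finally show ?thesis .
qed

section \<open>Choice of the exponent and the final bound\<close>

theorem theorem2:
  fixes k s :: nat and \<gamma> \<alpha> :: real
  assumes "k > 0" and "s \<le> k" and "real s > real k / 2"
    and "\<gamma> > 0" and "0 < \<alpha>" and "\<alpha> < 1"
    and "real s / real k > (sqrt \<gamma> + 1) / 2"
  shows "\<exists>g :: nat \<Rightarrow> real. ((\<lambda>n. g n / real n) \<longlonglongrightarrow> 0) \<and>
    (\<forall>m n :: nat. 0 < m \<longrightarrow> m < n \<longrightarrow> real n = \<gamma> * real k * real m \<longrightarrow>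
       real m \<ge> (real s / real k) * ln (exp 1 / (real s / real k))
                 / ((1 - \<alpha>) * c0 (real s / real k) \<gamma> * \<gamma>) \<longrightarrow>
       measure (gauss_blocks k m n) {A \<in> space (gauss_blocks k m n). recovery_event k m n s A}
         > 1 - exp (- \<alpha> * c0 (real s / real k) \<gamma> * real n + g n))"
proof -
  define \<delta> where "\<delta> = (2 * (real s / real k) - 1) / sqrt \<gamma> - 1"
  have k: "k > 0" and \<gamma>: "\<gamma> > 0" by fact+
  have "2 * (real s / real k) - 1 > sqrt \<gamma>" using assms(7) by (simp add: field_simps)
  then have \<delta>: "\<delta> > 0" using \<gamma> by (simp add: \<delta>_def)
  have c0: "c0 (real s / real k) \<gamma> = \<delta>\<^sup>2 / 2" by (simp add: c0_def \<delta>_def)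
  define C where "C = \<delta> / sqrt k * (3 * real k + 1)"
  define a where "a = k * ln 4 + 1"
  \<comment> \<open>The error term must be chosen before \<open>m\<close> and \<open>n\<close>, so
    it depends on \<open>n\<close> alone: \<open>k * ln 4\<close> and \<open>k * ln n\<close> absorb
    the factor \<open>(4 * n) ^ k\<close>, \<open>C * sqrt n\<close> is the linear error
    \<open>l * (3 * k + 1)\<close>, and the 1 in \<open>a\<close> makes the final inequality
    strict.\<close>
  define g where "g n = a + (k * ln (real n) + C * sqrt (real n))" for n :: nat
  have "(\<lambda>n. a / real n + (k * (ln (real n) / real n) + C * (1 / sqrt (real n)))) \<longlonglongrightarrow> 0 + (real k * 0 + C * 0)"
  proof (intro tendsto_add tendsto_mult tendsto_const lim_ln_over_n lim_const_over_n)
    show "(\<lambda>n. 1 / sqrt (real n)) \<longlonglongrightarrow> 0"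
      by (intro tendsto_divide_0[OF tendsto_const] filterlim_at_top_imp_at_infinity
          filterlim_compose[OF sqrt_at_top] filterlim_real_sequentially)
  qed
  moreover have "g n / real n = a / real n + (k * (ln (real n) / real n) + C * (1 / sqrt (real n)))" for n
  proof -
    have "sqrt (real n) / real n = 1 / sqrt (real n)"
      using sqrt_divide_self_eq[of "real n"] by (simp add: inverse_eq_divide)
    then show ?thesis unfolding g_def add_divide_distrib times_divide_eq_right[symmetric] by simp
  qed
  ultimately have "(\<lambda>n. g n / real n) \<longlonglongrightarrow> 0" by simp
  moreover have "measure (gauss_blocks k m n) {A \<in> space (gauss_blocks k m n). recovery_event k m n s A}
       > 1 - exp (- \<alpha> * c0 (real s / real k) \<gamma> * real n + g n)"
    if m: "0 < m" and mn: "m < n" and n: "real n = \<gamma> * real k * real m" for m n :: nat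
  proof -
    interpret prob_space "gauss_blocks k m n"
      unfolding gauss_blocks_def by (intro prob_space_PiM prob_space_std_gauss)
    have n0: "n > 0" using mn by simp
    \<comment> \<open>The value \<open>l = \<mu> / k\<close> minimizes
      \<open>- l * \<mu> + l\<^sup>2 * k / 2\<close>. The relation between \<open>n\<close> and
      \<open>m\<close> turns it into the formula with \<delta>, and the minimum into
      \<open>- \<delta>\<^sup>2 / 2 * n\<close>.\<close>
    define \<mu> where "\<mu> = (2 * real s - real k) * sqrt m - sqrt k * sqrt n"
    define l where "l = \<delta> * sqrt n / sqrt k"
    have l: "l > 0" using \<delta> n0 k by (simp add: l_def)
    have \<mu>: "\<mu> = l * k"
    proof -
      have sn: "sqrt n = sqrt \<gamma> * sqrt k * sqrt m" unfolding n by (simp add: real_sqrt_mult)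
      have kk: "sqrt k * sqrt k = k" by simp
      have "l * k = \<delta> * sqrt n * sqrt k" using k kk by (simp add: l_def field_simps)
      also have "\<dots> = (\<delta> * sqrt \<gamma>) * k * sqrt m" unfolding sn using kk by (simp add: mult_ac)
      also have "\<delta> * sqrt \<gamma> = (2 * (real s / real k) - 1) - sqrt \<gamma>"
      proof -
        have "(q / sqrt \<gamma> - 1) * sqrt \<gamma> = q - sqrt \<gamma>" for q using \<gamma> by (simp add: left_diff_distrib)
        then show ?thesis unfolding \<delta>_def .
      qed
      also have "\<dots> * k * sqrt m = (2 * real s - real k) * sqrt m - sqrt \<gamma> * k * sqrt m"
        using k by (simp add: field_simps)
      also have "sqrt \<gamma> * k * sqrt m = sqrt k * sqrt n" unfolding sn using kk by (simp add: mult_ac)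
      finally show ?thesis by (simp add: \<mu>_def)
    qed
    have lk: "l\<^sup>2 * k = \<delta>\<^sup>2 * n" using k by (simp add: l_def power_mult_distrib power_divide)
    have exponent: "l * (3 * real k + 1) - l * \<mu> + l\<^sup>2 * k / 2 = C * sqrt n - \<delta>\<^sup>2 / 2 * n"
    proof -
      have "l * \<mu> = l\<^sup>2 * k" by (simp add: \<mu> power2_eq_square)
      moreover have "l * (3 * real k + 1) = C * sqrt n" by (simp add: C_def l_def)
      ultimately show ?thesis using lk by simp
    qed
    have "measure (gauss_blocks k m n) {A \<in> space (gauss_blocks k m n). \<not> recovery_event k m n s A} \<le>
        2 ^ k * ((real m + 2) ^ k * exp (C * sqrt n - \<delta>\<^sup>2 / 2 * n))"
      using failure_probability[OF k m n0 l, of s] unfolding \<mu>_def[symmetric] exponent .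
    also have "\<dots> = (2 * (real m + 2)) ^ k * exp (C * sqrt n - \<delta>\<^sup>2 / 2 * n)"
      by (simp only: power_mult_distrib mult.assoc)
    also have "\<dots> \<le> (4 * real n) ^ k * exp (C * sqrt n - \<delta>\<^sup>2 / 2 * n)"
    proof (intro mult_right_mono power_mono)
      have "2 * (m + 2) \<le> 4 * n" using mn by simp
      then have "real (2 * (m + 2)) \<le> real (4 * n)" by (simp only: of_nat_le_iff)
      then show "2 * (real m + 2) \<le> 4 * real n" by simp
    qed auto
    also have "(4 * real n) ^ k = exp (k * (ln 4 + ln n))"
    proof -
      have "(4 * real n) ^ k = exp (ln (4 * real n)) ^ k" using n0 by simp
      also have "\<dots> = exp (k * ln (4 * real n))" by (rule exp_of_nat_mult[symmetric])
      also have "ln (4 * real n) = ln 4 + ln n" using n0 by (simp add: ln_mult)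
      finally show ?thesis .
    qed
    also have "exp (k * (ln 4 + ln n)) * exp (C * sqrt n - \<delta>\<^sup>2 / 2 * n) = exp (g n - 1 - \<delta>\<^sup>2 / 2 * n)"
      by (simp add: exp_add[symmetric] g_def a_def algebra_simps)
    also have "\<dots> < exp (- \<alpha> * c0 (real s / real k) \<gamma> * real n + g n)"
    proof -
      \<comment> \<open>Multiplying the rate by \<alpha> only enlarges the right-hand side.\<close>
      have "\<alpha> * (\<delta>\<^sup>2 / 2 * n) \<le> 1 * (\<delta>\<^sup>2 / 2 * n)" using assms(6) by (intro mult_right_mono) auto
      then have "g n - 1 - \<delta>\<^sup>2 / 2 * n < - \<alpha> * (\<delta>\<^sup>2 / 2) * n + g n" by simp
      then show ?thesis unfolding c0 by simp
    qed
    finally have bad: "measure (gauss_blocks k m n) {A \<in> space (gauss_blocks k m n). \<not> recovery_event k m n s A}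
        < exp (- \<alpha> * c0 (real s / real k) \<gamma> * real n + g n)" .
    have "{A \<in> space (gauss_blocks k m n). \<not> recovery_event k m n s A} =
        space (gauss_blocks k m n) - {A \<in> space (gauss_blocks k m n). recovery_event k m n s A}" by auto
    then have "measure (gauss_blocks k m n) {A \<in> space (gauss_blocks k m n). \<not> recovery_event k m n s A} =
        1 - measure (gauss_blocks k m n) {A \<in> space (gauss_blocks k m n). recovery_event k m n s A}"
      using prob_compl[OF recovery_event_measurable[of k m n s]] by simp
    then show ?thesis using bad by linarith
  qed
  ultimately show ?thesis by blast
qed
end
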